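(* Let $\alpha_1(s)\mid\cdots\mid\alpha_n(s)$ be monic real polynomials with $\sum_i\deg\alpha_i(s)=n$, let $\underline r:\ r=r_1\ge\cdots\ge r_k>0$ be integers with $\sum_ir_i=n$ and conjugate partition $(k_1,\dots,k_r)$, and assume $(k_1,\dots,k_r)\prec(\deg\alpha_n(s),\dots,\deg\alpha_1(s))$. Let $A\in\mathbb R^{n\times n}$ be the real Weyr canonical form with invariant polynomials $\alpha_1(s)\mid\cdots\mid\alpha_n(s)$ and let $\underline{\mathcal I}\in\mathcal A_A$. Then the map $$\psi_{\underline{\mathcal I}}:\ \mathcal W_{\underline{\mathcal I}}\longrightarrow\widetilde{\mathcal V}_{\underline{\mathcal I}},\qquad \psi_{\underline{\mathcal I}}(x)=\widetilde{P^{(\mathrm{re})}_x},$$ where $\widetilde{P^{(\mathrm{re})}_x}$ is the orbit of $P^{(\mathrm{re})}_x=\nu_{\underline{\mathcal I}}(x)$ under the action of $\widetilde C_A$, is a diffeomorphism from the open set $\mathcal W_{\underline{\mathcal I}}\subseteq\mathbb R^{nr-N}$ onto the open set $\widetilde{\mathcal V}_{\underline{\mathcal I}}\subseteq\mathcal P_{(A;\underline r)}/\widetilde C_A$.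
   Context: Majorization $a\prec b$ (nonincreasing sequences padded with zeros to equal length): $\sum_{i\le j}a_i\le\sum_{i\le j}b_i$ for all $j$ and equal total sums. The conjugate partition of $(a_i)$ is $b_i=\#\{j:a_j\ge i\}$. $I_{p,q}=\begin{bmatrix}I_q\\0\end{bmatrix}\in\mathbb R^{p\times q}$ for $p\ge q$; $X^{(p)}=\operatorname{diag}(X,\dots,X)$ ($p$ copies). Real Weyr form. Let $\lambda_1,\dots,\lambda_p$ be the distinct real roots of $\alpha_n$ and $\lambda_{p+1},\overline\lambda_{p+1},\dots,\lambda_{p+q},\overline\lambda_{p+q}$ the distinct nonreal ones. For $1\le i\le p+q$ let $m_{i1}\ge m_{i2}\ge\cdots$ be the multiplicities of $\lambda_i$ in $\alpha_n,\alpha_{n-1},\dots$, let $(w_{i1},\dots,w_{im_i})$, $m_i=m_{i1}$, be the conjugate partition of $(m_{i1},m_{i2},\dots)$, and $s^{(i)}=\sum_jw_{ij}$. $A=\operatorname{diag}(W_1,\dots,W_p,\widehat W_{p+1},\dots,\widehat W_{p+q})$, where for $i\le p$, $W_i$ has diagonal blocks $\lambda_iI_{w_{ij}}$, $1\le j\le m_i$, $(j,j+1)$ blocks $I_{w_{ij},w_{i,j+1}}$ and zeros elsewhere; for $i>p$, $\lambda_i=a_i+b_i\mathrm i$, $B_i=\begin{bmatrix}a_i&b_i\\-b_i&a_i\end{bmatrix}$, $\widehat W_i$ has diagonal blocks $B_i^{(w_{ij})}$, $(j,j+1)$ blocks $I_{2w_{ij},2w_{i,j+1}}$ and zeros elsewhere.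 Put $\epsilon_i=1$ for $i\le p$, $\epsilon_i=2$ for $i>p$, and write $M_i=W_i$ ($i\le p$), $M_i=\widehat W_i$ ($i>p$); $M_i$ has size $\epsilon_is^{(i)}$. For a square matrix $M$ of size $d$, $\mathcal P_{(M;\underline r)}$ is the set of $P=\begin{bmatrix}P_1\\ \vdots\\P_k\end{bmatrix}\in\mathbb R^{n\times d}$ with $\operatorname{rank}P=d$, $P_1\in\mathbb R^{r\times d}$ and $P_l\in\mathbb R^{r_l\times d}$ equal to the first $r_l$ rows of $P_1M^{l-1}$. $\widetilde C_M$ is the Lie group of invertible real matrices commuting with $M$, acting on $\mathcal P_{(M;\underline r)}$ by $P\mapsto PX$; $\pi:\mathcal P_{(A;\underline r)}\to\mathcal P_{(A;\underline r)}/\widetilde C_A$ is the natural projection and the quotient has the manifold structure making $\pi$ a smooth submersion. $N=\dim\widetilde C_A=\sum_{l=1}^n(2l-1)\deg\alpha_{n-l+1}$. For $z=[z_1\ z_2]$, $z^\diamond=\begin{bmatrix}z_1&z_2\\-z_2&z_1\end{bmatrix}$, and for $Z=[z_{ij}]\in\mathbb R^{p\times2q}$, $z_{ij}\in\mathbb R^{1\times2}$, $Z^\diamond=[z_{ij}^\diamond]\in\mathbb R^{2p\times2q}$. Index sequences. For each $i$ put $\tau^{(i)}_0=0$, $\tau^{(i)}_j=w_{i,m_i-j+1}$. $\mathcal A_{M_i}$ is the set of $\underline{\mathcal I}^{(i)}=(\mathcal I_1,\dots,\mathcal I_{m_i})$ where $\mathcal I_j$ is a sequence of $\tau_j^{(i)}$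 distinct indices in $\{1,\dots,r\}$, $\mathcal I_{j-1}$ is an initial segment of $\mathcal I_j$ ($\mathcal I_0=\emptyset$), and the remaining part $\mathcal I_j\setminus\mathcal I_{j-1}$ is strictly increasing. $\mathcal A_A=\prod_{i=1}^{p+q}\mathcal A_{M_i}$. Write $P(\mathcal I,1{:}t)$ for the submatrix with rows $\mathcal I$ and first $t$ columns. $\mathcal U_{\underline{\mathcal I}^{(i)}}$ is the open set of $P\in\mathcal P_{(M_i;\underline r)}$ such that for all $j$, $P(\mathcal I_j,1{:}\tau^{(i)}_j)$ is invertible (if $i\le p$), respectively $P(\mathcal I_j,1{:}2\tau^{(i)}_j)^\diamond$ is invertible (if $i>p$). For $\underline{\mathcal I}=(\underline{\mathcal I}^{(1)},\dots,\underline{\mathcal I}^{(p+q)})\in\mathcal A_A$, $\mathcal V_{\underline{\mathcal I}}$ is the set of $P=[P^{(1)}\ \cdots\ P^{(p+q)}]\in\mathcal P_{(A;\underline r)}$ (columns partitioned according to the diagonal blocks of $A$) with $P^{(i)}\in\mathcal U_{\underline{\mathcal I}^{(i)}}$ for all $i$, an open subset of $\mathcal P_{(A;\underline r)}$; $\widetilde{\mathcal V}_{\underline{\mathcal I}}=\pi(\mathcal V_{\underline{\mathcal I}})$, which is open. Reduced shape and $\nu_{\underline{\mathcal I}}$. For given $i$, a matrix $R=\begin{bmatrix}R_1\\ \vdots\\R_k\end{bmatrix}\in\mathbb R^{n\times\epsilon_is^{(i)}}$ has reduced shape with respect to $\underline{\mathcal I}^{(i)}$ if $R_l$ is the first $r_l$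 rows of $R_1M_i^{l-1}$ for all $l$ and, writing $R_1=[R_{11}\cdots R_{1m_i}]$ with $R_{1j}\in\mathbb R^{r\times\epsilon_iw_{ij}}$ and partitioning $R_{1j}(\mathcal I_{m_i},:)$ (the rows of $R_{1j}$ indexed by $\mathcal I_{m_i}$, in that order) into blocks $R^{(j)}_{ab}$ of size $(\tau^{(i)}_a-\tau^{(i)}_{a-1})\times\epsilon_i(\tau^{(i)}_b-\tau^{(i)}_{b-1})$, $1\le a\le m_i$, $1\le b\le m_i-j+1$: $R^{(1)}_{aa}$ (if $i\le p$), resp. $R^{(1)\diamond}_{aa}$ (if $i>p$), is the identity; $R^{(1)}_{ab}=0$ for $a<b$; and $R^{(j)}_{ab}=0$ for $j\ge2$ and $\max\{a-j+1,1\}\le b\le m_i-j+1$. All the other entries of $R_1$ (including all those in rows not indexed by $\mathcal I_{m_i}$) are free; their number, summed over all $i$, is $nr-N$. $\nu_{\underline{\mathcal I}}$ is the affine bijection which assigns to $x\in\mathbb R^{nr-N}$ the matrix $[R^{(1)}\ \cdots\ R^{(p+q)}]\in\mathbb R^{n\times n}$, with $R^{(i)}$ here denoting the $i$-th block of columns, of reduced shape with respect to $\underline{\mathcal I}^{(i)}$, whose free entries, listed in some fixed order, are the coordinates of $x$. Finally $\mathcal W_{\underline{\mathcal I}}=\{x\in\mathbb R^{nr-N}:\ \nu_{\underline{\mathcal I}}(x)\in\mathcal P_{(A;\underline r)}\}$ (that is, $\nu_{\underline{\mathcal I}}(x)$ is invertible), an open set, and $P_x^{(\mathrm{re})}=\nu_{\underline{\mathcal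 I}}(x)$ for $x\in\mathcal W_{\underline{\mathcal I}}$. *)

theory Defs
  imports "HOL-Analysis.Analysis" "HOL-Computational_Algebra.Polynomial"
    "Jordan_Normal_Form.DL_Rank"
begin

text \<open>
  Rows, columns and list entries are counted from \<open>0\<close>, as usual for lists and for
  the type of matrices used here.  The block numbers \<open>a\<close>, \<open>b\<close>, \<open>j\<close> and the
  index \<open>j\<close> of \<open>\<tau>\<^sub>j\<close> and \<open>I\<^sub>j\<close> start from \<open>1\<close>, as in the mathematical text.
\<close>

section \<open>Smooth manifolds\<close>

text \<open>
  The dimensions occurring below depend on the data and can be \<open>0\<close>, so the model of \<open>d\<close>-space is
  \<open>Euclidean_space d\<close>, the topological space of all \<open>x :: nat \<Rightarrow> real\<close> with \<open>x i = 0\<close> for \<open>i \<ge> d\<close>.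
  The next two notions are meant for open subsets \<open>S\<close> of \<open>Euclidean_space d\<close>; they depend only on
  the values of the function on \<open>S\<close>.
\<close>

fun C_k_on :: "nat \<Rightarrow> nat \<Rightarrow> (nat \<Rightarrow> real) set \<Rightarrow> ((nat \<Rightarrow> real) \<Rightarrow> real) \<Rightarrow> bool" where
  "C_k_on 0 d S f \<longleftrightarrow> continuous_map (subtopology (Euclidean_space d) S) euclideanreal f"
| "C_k_on (Suc k) d S f \<longleftrightarrow>
     continuous_map (subtopology (Euclidean_space d) S) euclideanreal f \<and>
     (\<forall>i<d. (\<forall>x\<in>S. (\<lambda>t. f (x(i := t))) differentiable (at (x i))) \<and>
            C_k_on k d S (\<lambda>x. deriv (\<lambda>t. f (x(i := t))) (x i)))"

definition smooth_on :: "nat \<Rightarrow> nat \<Rightarrow> (nat \<Rightarrow> real) set \<Rightarrow> ((nat \<Rightarrow> real) \<Rightarrow> (nat \<Rightarrow> real)) \<Rightarrow> bool" where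
  "smooth_on d e S f \<longleftrightarrow>
     f ` S \<subseteq> topspace (Euclidean_space e) \<and> (\<forall>k. \<forall>i<e. C_k_on k d S (\<lambda>x. f x i))"

definition jacobian :: "nat \<Rightarrow> nat \<Rightarrow> ((nat \<Rightarrow> real) \<Rightarrow> (nat \<Rightarrow> real)) \<Rightarrow> (nat \<Rightarrow> real) \<Rightarrow> real mat" where
  "jacobian d e f x = mat e d (\<lambda>(i, j). deriv (\<lambda>t. f (x(j := t)) i) (x j))"

record 'a mfd =
  mdim :: nat
  mtop :: "'a topology"
  charts :: "('a set \<times> ('a \<Rightarrow> nat \<Rightarrow> real)) set"

definition smooth_manifold :: "'a mfd \<Rightarrow> bool" where
  "smooth_manifold X \<longleftrightarrow>
     Hausdorff_space (mtop X) \<and> second_countable (mtop X) \<and>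
     (\<Union>(U, \<phi>)\<in>charts X. U) = topspace (mtop X) \<and>
     (\<forall>(U, \<phi>)\<in>charts X.
        openin (mtop X) U \<and> openin (Euclidean_space (mdim X)) (\<phi> ` U) \<and>
        homeomorphic_map (subtopology (mtop X) U) (subtopology (Euclidean_space (mdim X)) (\<phi> ` U)) \<phi>) \<and>
     (\<forall>(U, \<phi>)\<in>charts X. \<forall>(V, \<psi>)\<in>charts X.
        smooth_on (mdim X) (mdim X) (\<phi> ` (U \<inter> V)) (\<psi> \<circ> inv_into U \<phi>))"

definition smooth_map :: "'a mfd \<Rightarrow> 'b mfd \<Rightarrow> ('a \<Rightarrow> 'b) \<Rightarrow> bool" where
  "smooth_map X Y f \<longleftrightarrow>
     continuous_map (mtop X) (mtop Y) f \<and>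
     (\<forall>(U, \<phi>)\<in>charts X. \<forall>(V, \<psi>)\<in>charts Y.
        smooth_on (mdim X) (mdim Y) (\<phi> ` (U \<inter> f -` V)) (\<psi> \<circ> f \<circ> inv_into U \<phi>))"

text \<open>Surjectivity of the differential is full row rank of the Jacobian matrix in charts.\<close>

definition smooth_submersion :: "'a mfd \<Rightarrow> 'b mfd \<Rightarrow> ('a \<Rightarrow> 'b) \<Rightarrow> bool" where
  "smooth_submersion X Y f \<longleftrightarrow>
     smooth_map X Y f \<and>
     (\<forall>(U, \<phi>)\<in>charts X. \<forall>(V, \<psi>)\<in>charts Y. \<forall>p\<in>U \<inter> f -` V.
        vec_space.rank (mdim Y) (jacobian (mdim X) (mdim Y) (\<psi> \<circ> f \<circ> inv_into U \<phi>) (\<phi> p)) = mdim Y)"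

definition diffeomorphism :: "'a mfd \<Rightarrow> 'b mfd \<Rightarrow> ('a \<Rightarrow> 'b) \<Rightarrow> bool" where
  "diffeomorphism X Y f \<longleftrightarrow>
     bij_betw f (topspace (mtop X)) (topspace (mtop Y)) \<and>
     smooth_map X Y f \<and> smooth_map Y X (inv_into (topspace (mtop X)) f)"

definition open_submanifold :: "'a mfd \<Rightarrow> 'a set \<Rightarrow> 'a mfd" where
  "open_submanifold X S =
     \<lparr>mdim = mdim X, mtop = subtopology (mtop X) S, charts = (\<lambda>(U, \<phi>). (U \<inter> S, \<phi>)) ` charts X\<rparr>"

definition Euclidean_mfd :: "nat \<Rightarrow> (nat \<Rightarrow> real) mfd" where
  "Euclidean_mfd d =
     \<lparr>mdim = d, mtop = Euclidean_space d, charts = {(topspace (Euclidean_space d), \<lambda>x. x)}\<rparr>"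

section \<open>Partitions and majorization\<close>

text \<open>Both are applied to nonincreasing lists only, and \<open>take j\<close> beyond the end of a list amounts to
  padding it with zeros.\<close>

definition majorized :: "nat list \<Rightarrow> nat list \<Rightarrow> bool" where
  "majorized a b \<longleftrightarrow> (\<forall>j. sum_list (take j a) \<le> sum_list (take j b)) \<and> sum_list a = sum_list b"

definition conjugate_partition :: "nat list \<Rightarrow> nat list" where
  "conjugate_partition a =
     (if a = [] then [] else map (\<lambda>i. card {j. j < length a \<and> i \<le> a ! j}) [1..<Suc (hd a)])"

section \<open>Matrices\<close>

definition block :: "'a mat \<Rightarrow> nat \<Rightarrow> nat \<Rightarrow> nat \<Rightarrow> nat \<Rightarrow> 'a mat" where
  "block M i h j w = mat h w (\<lambda>(u, v). M $$ (i + u, j + v))"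

definition rows_at :: "'a mat \<Rightarrow> nat list \<Rightarrow> 'a mat" where
  "rows_at M I = mat (length I) (dim_col M) (\<lambda>(u, v). M $$ (I ! u, v))"

definition I_rect :: "nat \<Rightarrow> nat \<Rightarrow> real mat" where
  "I_rect p q = mat p q (\<lambda>(u, v). if u = v then 1 else 0)"

definition offset :: "nat list \<Rightarrow> nat \<Rightarrow> nat" where
  "offset ws j = sum_list (take j ws)"

definition block_no :: "nat list \<Rightarrow> nat \<Rightarrow> nat" where
  "block_no ws u = (LEAST j. u < offset ws (Suc j))"

text \<open>The square matrix with blocks \<open>F i j\<close> (counted from \<open>0\<close>) of size \<open>ws ! i\<close> times \<open>ws ! j\<close>.\<close>

definition assemble :: "nat list \<Rightarrow> (nat \<Rightarrow> nat \<Rightarrow> real mat) \<Rightarrow> real mat" where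
  "assemble ws F = mat (sum_list ws) (sum_list ws)
     (\<lambda>(u, v). let i = block_no ws u; j = block_no ws v
               in F i j $$ (u - offset ws i, v - offset ws j))"

text \<open>Every pair \<open>(z\<^sub>1, z\<^sub>2)\<close> in positions \<open>2c, 2c + 1\<close> of a row
  becomes the two by two block with rows \<open>(z\<^sub>1, z\<^sub>2)\<close> and \<open>(- z\<^sub>2, z\<^sub>1)\<close>.\<close>

definition diamond :: "real mat \<Rightarrow> real mat" where
  "diamond Z = mat (2 * dim_row Z) (dim_col Z)
     (\<lambda>(u, v). let z1 = Z $$ (u div 2, 2 * (v div 2)); z2 = Z $$ (u div 2, 2 * (v div 2) + 1)
               in if even u then (if even v then z1 else z2) else (if even v then - z2 else z1))"

section \<open>The real Weyr form\<close>

text \<open>A list \<open>rts\<close> of the distinct real roots, and a list \<open>cts\<close> containing exactly one member of each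
  pair of conjugate nonreal roots.\<close>

definition enumerates_roots :: "real poly \<Rightarrow> real list \<Rightarrow> complex list \<Rightarrow> bool" where
  "enumerates_roots \<alpha> rts cts \<longleftrightarrow>
     distinct rts \<and> set rts = {x. poly \<alpha> x = 0} \<and>
     distinct (cts @ map cnj cts) \<and>
     set (cts @ map cnj cts) = {z. z \<notin> \<real> \<and> poly (map_poly complex_of_real \<alpha>) z = 0}"

definition weyr_chars :: "real poly list \<Rightarrow> complex \<Rightarrow> nat list" where
  "weyr_chars alphas z =
     conjugate_partition (map (\<lambda>\<alpha>. Polynomial.order z (map_poly complex_of_real \<alpha>)) (rev alphas))"

definition eps :: "complex \<Rightarrow> nat" where
  "eps z = (if z \<in> \<real> then 1 else 2)"

definition weyr_real :: "real \<Rightarrow> nat list \<Rightarrow> real mat" where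
  "weyr_real x w = assemble w (\<lambda>i j.
     if j = i then x \<cdot>\<^sub>m 1\<^sub>m (w ! i)
     else if j = Suc i then I_rect (w ! i) (w ! j)
     else 0\<^sub>m (w ! i) (w ! j))"

definition weyr_nonreal :: "complex \<Rightarrow> nat list \<Rightarrow> real mat" where
  "weyr_nonreal z w = assemble (map ((*) 2) w) (\<lambda>i j.
     if j = i then diag_block_mat (replicate (w ! i) (mat_of_rows_list 2 [[Re z, Im z], [- Im z, Re z]]))
     else if j = Suc i then I_rect (2 * w ! i) (2 * w ! j)
     else 0\<^sub>m (2 * w ! i) (2 * w ! j))"

definition weyr_block :: "complex \<Rightarrow> nat list \<Rightarrow> real mat" where
  "weyr_block z w = (if z \<in> \<real> then weyr_real (Re z) w else weyr_nonreal z w)"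

text \<open>Here and below \<open>zs\<close> is the list of the \<open>\<lambda>\<^sub>i\<close>, that is, the real roots followed by the
  chosen nonreal ones.\<close>

definition weyr_form :: "real poly list \<Rightarrow> complex list \<Rightarrow> real mat" where
  "weyr_form alphas zs = diag_block_mat (map (\<lambda>z. weyr_block z (weyr_chars alphas z)) zs)"

definition col_block :: "real poly list \<Rightarrow> complex list \<Rightarrow> nat \<Rightarrow> real mat \<Rightarrow> real mat" where
  "col_block alphas zs i P =
     (let ds = map (\<lambda>z. eps z * sum_list (weyr_chars alphas z)) zs
      in block P 0 (dim_row P) (offset ds i) (ds ! i))"

section \<open>The space \<open>\<P>\<close> and its quotient\<close>

definition stacked :: "real mat \<Rightarrow> nat list \<Rightarrow> real mat \<Rightarrow> bool" where
  "stacked M rs P \<longleftrightarrow>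
     P \<in> carrier_mat (sum_list rs) (dim_row M) \<and>
     (\<forall>l<length rs.
        block P (offset rs l) (rs ! l) 0 (dim_row M) =
        block (block P 0 (hd rs) 0 (dim_row M) * M ^\<^sub>m l) 0 (rs ! l) 0 (dim_row M))"

definition P_set :: "real mat \<Rightarrow> nat list \<Rightarrow> real mat set" where
  "P_set M rs = {P. stacked M rs P \<and> vec_space.rank (sum_list rs) P = dim_row M}"

definition centralizer_group :: "real mat \<Rightarrow> real mat set" where
  "centralizer_group M =
     {X \<in> carrier_mat (dim_row M) (dim_row M). invertible_mat X \<and> X * M = M * X}"

definition cent_orbit :: "real mat \<Rightarrow> real mat \<Rightarrow> real mat set" where
  "cent_orbit M P = (\<lambda>X. P * X) ` centralizer_group M"

definition mat_coords :: "nat \<Rightarrow> nat \<Rightarrow> real mat \<Rightarrow> nat \<Rightarrow> real" where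
  "mat_coords h w P = (\<lambda>k. if k < h * w then P $$ (k div w, k mod w) else 0)"

text \<open>\<open>P_set M rs\<close> is an open subset of the linear space of all \<open>P\<close> with \<open>stacked M rs P\<close>.  It carries
  the topology given by the matrix entries.  Such a \<open>P\<close> is linearly determined by its first block
  \<open>P\<^sub>1\<close>, which is arbitrary, so the entries of \<open>P\<^sub>1\<close> are linear coordinates on that linear space
  and serve as a global chart.\<close>

definition P_mfd :: "real mat \<Rightarrow> nat list \<Rightarrow> real mat mfd" where
  "P_mfd M rs =
     \<lparr>mdim = hd rs * dim_row M,
      mtop = pullback_topology (P_set M rs) (mat_coords (sum_list rs) (dim_row M))
               (Euclidean_space (sum_list rs * dim_row M)),
      charts = {(P_set M rs, mat_coords (hd rs) (dim_row M))}\<rparr>"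

text \<open>The manifold structure on the quotient is the unique one with the following property.\<close>

definition quotient_structure :: "real mat \<Rightarrow> nat list \<Rightarrow> real mat set mfd \<Rightarrow> bool" where
  "quotient_structure M rs Q \<longleftrightarrow>
     smooth_manifold Q \<and> topspace (mtop Q) = cent_orbit M ` P_set M rs \<and>
     smooth_submersion (P_mfd M rs) Q (cent_orbit M)"

section \<open>Index sequences\<close>

definition tau :: "nat list \<Rightarrow> nat \<Rightarrow> nat" where
  "tau w j = (if j = 0 then 0 else w ! (length w - j))"

text \<open>A tuple \<open>(I\<^sub>1, \<dots>, I\<^sub>m)\<close> is a list of length \<open>m\<close>, with
  \<open>I\<^sub>0\<close> empty.\<close>

definition idx :: "nat list list \<Rightarrow> nat \<Rightarrow> nat list" where
  "idx Is j = (if j = 0 then [] else Is ! (j - 1))"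

definition index_tuples :: "nat \<Rightarrow> nat list \<Rightarrow> nat list list set" where
  "index_tuples r w = {Is. length Is = length w \<and>
     (\<forall>j\<in>{1..length w}.
        length (idx Is j) = tau w j \<and> distinct (idx Is j) \<and> set (idx Is j) \<subseteq> {..<r} \<and>
        take (tau w (j - 1)) (idx Is j) = idx Is (j - 1) \<and>
        sorted_wrt (<) (drop (tau w (j - 1)) (idx Is j)))}"

definition index_family :: "nat \<Rightarrow> real poly list \<Rightarrow> complex list \<Rightarrow> nat list list list set" where
  "index_family r alphas zs = {Iss. length Iss = length zs \<and>
     (\<forall>i<length zs. Iss ! i \<in> index_tuples r (weyr_chars alphas (zs ! i)))}"

definition U_set :: "complex \<Rightarrow> nat list \<Rightarrow> nat list \<Rightarrow> nat list list \<Rightarrow> real mat set" where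
  "U_set z w rs Is = {P \<in> P_set (weyr_block z w) rs.
     \<forall>j\<in>{1..length w}.
       let S = block (rows_at P (idx Is j)) 0 (tau w j) 0 (eps z * tau w j)
       in if z \<in> \<real> then invertible_mat S else invertible_mat (diamond S)}"

definition V_set :: "real poly list \<Rightarrow> complex list \<Rightarrow> nat list \<Rightarrow> nat list list list \<Rightarrow> real mat set" where
  "V_set alphas zs rs Iss = {P \<in> P_set (weyr_form alphas zs) rs.
     \<forall>i<length zs. col_block alphas zs i P \<in> U_set (zs ! i) (weyr_chars alphas (zs ! i)) rs (Iss ! i)}"

section \<open>Reduced shape\<close>

text \<open>\<open>sub_R z w Is R j a b\<close> is the block \<open>R\<^sup>(\<^sup>j\<^sup>)\<^sub>a\<^sub>b\<close>.\<close>

definition sub_R :: "complex \<Rightarrow> nat list \<Rightarrow> nat list list \<Rightarrow> real mat \<Rightarrow> nat \<Rightarrow> nat \<Rightarrow> nat \<Rightarrow> real mat" where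
  "sub_R z w Is R j a b =
     block (rows_at R (idx Is (length w)))
       (tau w (a - 1)) (tau w a - tau w (a - 1))
       (eps z * offset w (j - 1) + eps z * tau w (b - 1)) (eps z * (tau w b - tau w (b - 1)))"

definition reduced_shape :: "complex \<Rightarrow> nat list \<Rightarrow> nat list \<Rightarrow> nat list list \<Rightarrow> real mat \<Rightarrow> bool" where
  "reduced_shape z w rs Is R \<longleftrightarrow>
     (let m = length w; t = (\<lambda>a. tau w a - tau w (a - 1)) in
      stacked (weyr_block z w) rs R \<and>
      (\<forall>a\<in>{1..m}. if z \<in> \<real> then sub_R z w Is R 1 a a = 1\<^sub>m (t a)
                  else diamond (sub_R z w Is R 1 a a) = 1\<^sub>m (2 * t a)) \<and>
      (\<forall>a\<in>{1..m}. \<forall>b\<in>{1..m}. a < b \<longrightarrow> sub_R z w Is R 1 a b = 0\<^sub>m (t a) (eps z * t b)) \<and>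
      (\<forall>j\<in>{2..m}. \<forall>a\<in>{1..m}. \<forall>b\<in>{max (a + 1 - j) 1..m - j + 1}.
         sub_R z w Is R j a b = 0\<^sub>m (t a) (eps z * t b)))"

text \<open>The positions (row, column) in the first block \<open>R\<^sub>1\<close> of a matrix of reduced shape which belong
  to one of the blocks \<open>R\<^sup>(\<^sup>j\<^sup>)\<^sub>a\<^sub>b\<close> prescribed by the definition of reduced shape.\<close>

definition prescribed_pos :: "complex \<Rightarrow> nat list \<Rightarrow> nat list list \<Rightarrow> (nat \<times> nat) set" where
  "prescribed_pos z w Is =
     {(idx Is (length w) ! u, eps z * offset w (j - 1) + v) | j a b u v.
        j \<in> {1..length w} \<and> a \<in> {1..length w} \<and> b \<in> {1..length w - j + 1} \<and>
        (if j = 1 then a \<le> b else max (a + 1 - j) 1 \<le> b) \<and>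
        u \<in> {tau w (a - 1)..<tau w a} \<and> v \<in> {eps z * tau w (b - 1)..<eps z * tau w b}}"

text \<open>A free position is \<open>(i, row, column)\<close> where \<open>i\<close> is the number of the column block.\<close>

definition free_pos :: "nat \<Rightarrow> real poly list \<Rightarrow> complex list \<Rightarrow> nat list list list \<Rightarrow> (nat \<times> nat \<times> nat) set" where
  "free_pos r alphas zs Iss =
     {(i, u, c). i < length zs \<and> u < r \<and>
        c < eps (zs ! i) * sum_list (weyr_chars alphas (zs ! i)) \<and>
        (u, c) \<notin> prescribed_pos (zs ! i) (weyr_chars alphas (zs ! i)) (Iss ! i)}"

text \<open>The list \<open>fs\<close> fixes the order of the free entries.\<close>

definition nu :: "real poly list \<Rightarrow> complex list \<Rightarrow> nat list \<Rightarrow> nat list list list \<Rightarrow>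
    (nat \<times> nat \<times> nat) list \<Rightarrow> (nat \<Rightarrow> real) \<Rightarrow> real mat" where
  "nu alphas zs rs Iss fs x = (THE R.
     R \<in> carrier_mat (sum_list rs) (sum_list rs) \<and>
     (\<forall>i<length zs. reduced_shape (zs ! i) (weyr_chars alphas (zs ! i)) rs (Iss ! i)
        (col_block alphas zs i R)) \<and>
     (\<forall>k<length fs. case fs ! k of (i, u, c) \<Rightarrow> col_block alphas zs i R $$ (u, c) = x k))"

text \<open>\<open>cent_dim alphas\<close> is the dimension \<open>N\<close> of the centralizer of the Weyr form, as given by the
  degrees of the invariant polynomials.\<close>

definition cent_dim :: "real poly list \<Rightarrow> nat" where
  "cent_dim alphas = (\<Sum>l=1..length alphas. (2 * l - 1) * degree (alphas ! (length alphas - l)))"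

definition W_set :: "real poly list \<Rightarrow> complex list \<Rightarrow> nat list \<Rightarrow> nat list list list \<Rightarrow>
    (nat \<times> nat \<times> nat) list \<Rightarrow> (nat \<Rightarrow> real) set" where
  "W_set alphas zs rs Iss fs =
     {x \<in> topspace (Euclidean_space (length alphas * hd rs - cent_dim alphas)).
        nu alphas zs rs Iss fs x \<in> P_set (weyr_form alphas zs) rs}"

definition psi :: "real poly list \<Rightarrow> complex list \<Rightarrow> nat list \<Rightarrow> nat list list list \<Rightarrow>
    (nat \<times> nat \<times> nat) list \<Rightarrow> (nat \<Rightarrow> real) \<Rightarrow> real mat set" where
  "psi alphas zs rs Iss fs x = cent_orbit (weyr_form alphas zs) (nu alphas zs rs Iss fs x)"

end

theory Submission
  imports Defs "HOL-Homology.Invariance_of_Domain" "HOL-Computational_Algebra.Fundamental_Theorem_Algebra"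
begin

text \<open>Read a row of a matrix \<open>P\<close> blockwise as a family of complex-valued functions, pairing the two
  real coordinates of a nonreal block as \<open>Re z + \<i> Im z\<close>.  In this model the centralizer of \<open>A\<close>
  consists of families of Toeplitz type that are linear over the complex numbers in each block.  If
  \<open>P\<close> satisfies the invertibility conditions of an index family, then \<open>X \<mapsto> P X\<close>, restricted to
  the prescribed entries, is therefore a block triangular system on the centralizer: each choice of
  prescribed entries is attained by exactly one \<open>X\<close>.  Hence every orbit in the chart domain meets
  the set of matrices of reduced shape exactly once, and \<open>\<psi>\<close> is a smooth bijection.  Moreover every
  direction of \<open>\<P>\<close> is the sum of a direction of reduced shape and one along an orbit, which the
  differential of \<open>\<pi>\<close> kills; as \<open>\<pi>\<close> is a submersion, the differential of \<open>\<psi>\<close> is onto.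
  Invariance of domain makes the dimensions agree and \<open>\<psi>\<close> open, and the inverse is smooth by the
  inverse function theorem.\<close>

subsection \<open>Calculus on Euclidean spaces of sequences\<close>

text \<open>Of \<open>Q\<close> only the submersion property is given: its dimension and its charts
  are unknown. Hence surjectivity of the differential is tested by left kernels in an arbitrary
  chart, and the two inequalities between dimensions have different sources: a surjective
  differential bounds \<open>mdim Q\<close> from above, injectivity with invariance of domain bounds
  it from below. The block indices (j, a, b) of reduced shape hide the triangularity. In terms of
  Jordan chains, a commuting X is fixed by the image x of the top vector of each chain; the vector s
  steps below the top goes to x lowered by s levels. Equation s of a chain involves only the levels
  >= s of x, its diagonal part is an invertible corner of P of size w_s, and there are w_s such
  equations. In a chain of length h the prescribed entries in level l are exactly the equations s =
  h - 1 - l; this is the meaning of the bound a <= b + j - 1. Solving the system does not make X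
  invertible. Invertibility comes from solving a second time, from the reduced matrix back to P, and
  comparing by uniqueness. Transversality instead uses commuting directions X that may be singular,
  since 1 + tX only has to be invertible where the line stays in the open set.\<close>

abbreviation Euc :: "nat \<Rightarrow> (nat \<Rightarrow> real) set" where
  "Euc d \<equiv> topspace (Euclidean_space d)"

definition partial :: "((nat \<Rightarrow> real) \<Rightarrow> real) \<Rightarrow> nat \<Rightarrow> (nat \<Rightarrow> real) \<Rightarrow> real" where
  "partial f i x = deriv (\<lambda>t. f (x(i := t))) (x i)"

lemma Euc_iff: "x \<in> Euc d \<longleftrightarrow> (\<forall>i\<ge>d. x i = 0)"
  by (simp add: topspace_Euclidean_space)

lemma Euclidean_space_top_of_set: "Euclidean_space d = top_of_set {x. \<forall>i\<ge>d. x i = 0}"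
  by (simp add: Euclidean_space_def euclidean_product_topology)

lemma continuous_map_Euc_iff:
  assumes "S \<subseteq> Euc d"
  shows "continuous_map (subtopology (Euclidean_space d) S) euclidean f \<longleftrightarrow> continuous_on S f"
proof -
  have "subtopology (Euclidean_space d) S = top_of_set S"
    using assms by (simp add: Euclidean_space_top_of_set subtopology_subtopology Int_absorb1)
  then show ?thesis by simp
qed

lemma fun_upd_Euc: "x \<in> Euc d \<Longrightarrow> i < d \<Longrightarrow> x(i := t) \<in> Euc d"
  by (auto simp: Euc_iff)

text \<open>A basic open set of the product topology restricts only finitely many coordinates, so
  finitely many eventual conditions have to be combined.\<close>

lemma tendsto_fun_coordinatewise:
  fixes y :: "'b \<Rightarrow> 'i \<Rightarrow> 'c :: topological_space"
  assumes "\<And>i. ((\<lambda>t. y t i) \<longlongrightarrow> x i) F"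
  shows "(y \<longlongrightarrow> x) F"
proof (rule topological_tendstoI)
  fix S :: "('i \<Rightarrow> 'c) set" assume "open S" "x \<in> S"
  then have "openin (product_topology (\<lambda>i. euclidean) UNIV) S"
    by (simp add: open_fun_def)
  from product_topology_open_contains_basis[OF this \<open>x \<in> S\<close>]
  obtain X where X: "x \<in> (\<Pi>\<^sub>E i\<in>UNIV. X i)" "\<And>i. open (X i)"
    "finite {i. X i \<noteq> UNIV}" "(\<Pi>\<^sub>E i\<in>UNIV. X i) \<subseteq> S"
    by auto
  have "\<forall>\<^sub>F t in F. \<forall>i\<in>{i. X i \<noteq> UNIV}. y t i \<in> X i"
    by (rule eventually_ball_finite[OF X(3)])
       (use assms X in \<open>auto simp: tendsto_def PiE_iff\<close>)
  then show "\<forall>\<^sub>F t in F. y t \<in> S"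
    by eventually_elim (use X(4) in \<open>fastforce simp: PiE_iff subset_iff\<close>)
qed

text \<open>Coordinates from \<open>d\<close> on are eventually equal to 0 on both sides, so the
  first \<open>d\<close> limits suffice. The filter is arbitrary, which serves coordinate lines,
  curves and punctured neighbourhoods alike.\<close>

lemma eventually_in_open_Euc:
  assumes S: "openin (Euclidean_space d) S" and x: "x \<in> S"
    and y: "\<forall>\<^sub>F t in F. y t \<in> Euc d" "\<And>i. i < d \<Longrightarrow> ((\<lambda>t. y t i) \<longlongrightarrow> x i) F"
  shows "(y \<longlongrightarrow> x) F" "\<forall>\<^sub>F t in F. y t \<in> S"
proof -
  obtain T where T: "open T" "S = Euc d \<inter> T"
    using S by (auto simp: Euclidean_space_top_of_set openin_open)
  show lim: "(y \<longlongrightarrow> x) F"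
  proof (rule tendsto_fun_coordinatewise)
    fix i show "((\<lambda>t. y t i) \<longlongrightarrow> x i) F"
    proof (cases "i < d")
      case False
      from y(1) have "\<forall>\<^sub>F t in F. y t i = x i"
        by eventually_elim (use x T False in \<open>auto simp: Euc_iff\<close>)
      then show ?thesis by (rule tendsto_eventually)
    qed (use y in auto)
  qed
  have "\<forall>\<^sub>F t in F. y t \<in> T"
    using lim T x by (auto simp: tendsto_def)
  then show "\<forall>\<^sub>F t in F. y t \<in> S" using y(1) by eventually_elim (use T in auto)
qed

text \<open>The derivatives in \<open>C_k_on\<close> evaluate the function at
  \<open>x(i := t)\<close>, possibly outside \<open>S\<close>, where its values mean nothing.
  Openness confines the relevant \<open>t\<close> to \<open>S\<close>.\<close>

lemma line_in_open:
  assumes "openin (Euclidean_space d) S" "x \<in> S" "i < d"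
  shows "\<forall>\<^sub>F t in nhds (x i). x(i := t) \<in> S"
proof -
  have "S \<subseteq> Euc d" using assms openin_subset by blast
  have 1: "\<forall>\<^sub>F t in nhds (x i). x(i := t) \<in> Euc d"
    using assms \<open>S \<subseteq> Euc d\<close> by (auto intro!: always_eventually fun_upd_Euc)
  show ?thesis
    by (rule eventually_in_open_Euc(2)[OF assms(1,2) 1])
       (auto simp: tendsto_def fun_upd_def eventually_nhds)
qed

section \<open>Differentiability classes and their closure properties\<close>

lemma C_k_on_continuous: "S \<subseteq> Euc d \<Longrightarrow> C_k_on k d S f \<Longrightarrow> continuous_on S f"
  by (cases k) (auto simp: continuous_map_Euc_iff)

lemma C_k_on_0: "S \<subseteq> Euc d \<Longrightarrow> C_k_on 0 d S f \<longleftrightarrow> continuous_on S f"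
  by (auto simp: continuous_map_Euc_iff)

text \<open>A derivative at a point of an open set depends only on the germ there, so agreement on
  \<open>S\<close> passes to all iterated partial derivatives.\<close>

lemma C_k_on_cong:
  assumes S: "openin (Euclidean_space d) S" and "\<And>x. x \<in> S \<Longrightarrow> f x = g x"
  shows "C_k_on k d S f = C_k_on k d S g"
  using assms(2)
proof (induction k arbitrary: f g)
  case 0
  show ?case using openin_subset[OF S] 0
    by (simp add: continuous_map_Euc_iff cong: continuous_on_cong del: topspace_Euclidean_space)
next
  case (Suc k)
  have *: "\<forall>\<^sub>F t in nhds (x i). f (x(i := t)) = g (x(i := t))" if "i < d" "x \<in> S" for i x
    using line_in_open[OF S that(2,1)] by eventually_elim (use Suc in auto)
  have "(\<lambda>t. f (x(i := t))) differentiable (at (x i)) \<longleftrightarrow>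
     (\<lambda>t. g (x(i := t))) differentiable (at (x i))" if "i < d" "x \<in> S" for i x
    using DERIV_cong_ev[OF refl *[OF that] refl] by (auto simp: real_differentiable_def)
  moreover have "C_k_on k d S (\<lambda>x. deriv (\<lambda>t. f (x(i := t))) (x i)) =
     C_k_on k d S (\<lambda>x. deriv (\<lambda>t. g (x(i := t))) (x i))" if "i < d" for i
    by (rule Suc.IH, rule deriv_cong_ev[OF *[OF that] refl])
  ultimately show ?case using openin_subset[OF S] Suc.prems
    by (simp add: continuous_map_Euc_iff cong: continuous_on_cong)
qed

text \<open>Lets an explicit formula \<open>D\<close> stand in for \<open>deriv\<close>; every
  closure rule below then reduces to a differentiation rule plus the induction hypothesis applied to
  \<open>D\<close>.\<close>

lemma C_k_on_SucI:
  assumes S: "openin (Euclidean_space d) S" and "continuous_on S f"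
    and D: "\<And>i x. i < d \<Longrightarrow> x \<in> S \<Longrightarrow> ((\<lambda>t. f (x(i := t))) has_real_derivative D i x) (at (x i))"
    and "\<And>i. i < d \<Longrightarrow> C_k_on k d S (D i)"
  shows "C_k_on (Suc k) d S f"
proof -
  have "C_k_on k d S (\<lambda>x. deriv (\<lambda>t. f (x(i := t))) (x i))" if "i < d" for i
    using C_k_on_cong[OF S, of "\<lambda>x. deriv (\<lambda>t. f (x(i := t))) (x i)" "D i" k]
      assms(4)[OF that] DERIV_imp_deriv[OF D[OF that]] by auto
  then show ?thesis using assms openin_subset[OF S]
    by (auto simp: continuous_map_Euc_iff real_differentiable_def)
qed

lemma C_k_on_SucD:
  assumes "S \<subseteq> Euc d" "C_k_on (Suc k) d S f" "i < d"
  shows "x \<in> S \<Longrightarrow> ((\<lambda>t. f (x(i := t))) has_real_derivative partial f i x) (at (x i))"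
    and "C_k_on k d S (partial f i)"
  using assms by (auto simp: partial_def DERIV_deriv_iff_real_differentiable cong: if_cong)
    (simp add: partial_def[abs_def])

lemma C_k_on_mono:
  assumes S: "S \<subseteq> Euc d" shows "C_k_on (Suc k) d S f \<Longrightarrow> C_k_on k d S f"
proof (induction k arbitrary: f)
  case (Suc k)
  then show ?case
    unfolding C_k_on.simps(2)[of "Suc k"] C_k_on.simps(2)[of k] by blast
qed simp

lemma C_k_on_const: "openin (Euclidean_space d) S \<Longrightarrow> C_k_on k d S (\<lambda>x. c)"
  by (induction k arbitrary: c)
     (auto dest: openin_subset simp: C_k_on_0 intro!: C_k_on_SucI[where D = "\<lambda>_ _. 0"] derivative_eq_intros)

lemma C_k_on_coord: "openin (Euclidean_space d) S \<Longrightarrow> C_k_on k d S (\<lambda>x. x j)"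
proof (induction k)
  case 0
  then show ?case
    using continuous_on_product_then_coordinatewise[OF continuous_on_id, of S j]
    by (simp only: C_k_on_0[OF openin_subset])
next
  case (Suc k)
  show ?case
    by (rule C_k_on_SucI[OF Suc.prems, where D = "\<lambda>i _. if i = j then 1 else 0"])
       (use Suc continuous_on_product_then_coordinatewise[OF continuous_on_id, of S j] in \<open>auto intro!: C_k_on_const\<close>)
qed

lemma C_k_on_add:
  assumes S: "openin (Euclidean_space d) S"
  shows "C_k_on k d S f \<Longrightarrow> C_k_on k d S g \<Longrightarrow> C_k_on k d S (\<lambda>x. f x + g x)"
proof (induction k arbitrary: f g)
  case 0
  then show ?case unfolding C_k_on_0[OF openin_subset[OF S]] by (rule continuous_on_add)
next
  case (Suc k)
  note E = openin_subset[OF S]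
  show ?case
  proof (rule C_k_on_SucI[OF S, where D = "\<lambda>i x. partial f i x + partial g i x"])
    show "continuous_on S (\<lambda>x. f x + g x)"
      by (rule continuous_on_add) (rule C_k_on_continuous[OF E Suc.prems(1)] C_k_on_continuous[OF E Suc.prems(2)])+
    fix i assume i: "i < d"
    show "C_k_on k d S (\<lambda>x. partial f i x + partial g i x)"
      by (rule Suc.IH) (rule C_k_on_SucD(2)[OF E Suc.prems(1) i] C_k_on_SucD(2)[OF E Suc.prems(2) i])+
    fix x assume x: "x \<in> S"
    show "((\<lambda>t. f (x(i := t)) + g (x(i := t))) has_real_derivative
      partial f i x + partial g i x) (at (x i))"
      by (rule DERIV_add) (rule C_k_on_SucD(1)[OF E Suc.prems(1) i x] C_k_on_SucD(1)[OF E Suc.prems(2) i x])+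
  qed
qed

lemma C_k_on_mult:
  assumes S: "openin (Euclidean_space d) S"
  shows "C_k_on k d S f \<Longrightarrow> C_k_on k d S g \<Longrightarrow> C_k_on k d S (\<lambda>x. f x * g x)"
proof (induction k arbitrary: f g)
  case 0
  then show ?case unfolding C_k_on_0[OF openin_subset[OF S]] by (rule continuous_on_mult)
next
  case (Suc k)
  note E = openin_subset[OF S]
  show ?case
  proof (rule C_k_on_SucI[OF S, where D = "\<lambda>i x. partial f i x * g x + partial g i x * f x"])
    show "continuous_on S (\<lambda>x. f x * g x)"
      by (rule continuous_on_mult) (rule C_k_on_continuous[OF E Suc.prems(1)] C_k_on_continuous[OF E Suc.prems(2)])+
    fix i assume i: "i < d"
    show "C_k_on k d S (\<lambda>x. partial f i x * g x + partial g i x * f x)"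
      by (rule C_k_on_add[OF S]; rule Suc.IH)
         (rule C_k_on_SucD(2)[OF E Suc.prems(1) i] C_k_on_SucD(2)[OF E Suc.prems(2) i]
            C_k_on_mono[OF E Suc.prems(1)] C_k_on_mono[OF E Suc.prems(2)])+
    fix x assume x: "x \<in> S"
    note D = C_k_on_SucD(1)[OF E Suc.prems(1) i x] C_k_on_SucD(1)[OF E Suc.prems(2) i x]
    show "((\<lambda>t. f (x(i := t)) * g (x(i := t))) has_real_derivative
      partial f i x * g x + partial g i x * f x) (at (x i))"
      using DERIV_mult[OF D] unfolding fun_upd_triv .
  qed
qed

lemma C_k_on_sum:
  assumes S: "openin (Euclidean_space d) S"
  shows "(\<And>a. a \<in> A \<Longrightarrow> C_k_on k d S (f a)) \<Longrightarrow> C_k_on k d S (\<lambda>x. \<Sum>a\<in>A. f a x)"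
  by (induction A rule: infinite_finite_induct) (auto intro: C_k_on_const C_k_on_add S)

lemma C_k_on_prod:
  assumes S: "openin (Euclidean_space d) S"
  shows "(\<And>a. a \<in> A \<Longrightarrow> C_k_on k d S (f a)) \<Longrightarrow> C_k_on k d S (\<lambda>x. \<Prod>a\<in>A. f a x)"
  by (induction A rule: infinite_finite_induct) (auto intro: C_k_on_const C_k_on_mult S)

text \<open>The derivative is a product containing the same inverse, needed only at one order less,
  so the induction on \<open>k\<close> closes without generalizing \<open>f\<close>.\<close>

lemma C_k_on_inverse:
  assumes S: "openin (Euclidean_space d) S" and nz: "\<And>x. x \<in> S \<Longrightarrow> f x \<noteq> 0"
  shows "C_k_on k d S f \<Longrightarrow> C_k_on k d S (\<lambda>x. inverse (f x))"
proof (induction k)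
  case 0
  then show ?case unfolding C_k_on_0[OF openin_subset[OF S]]
    by (rule continuous_on_inverse) (use nz in blast)
next
  case (Suc k)
  note E = openin_subset[OF S]
  show ?case
  proof (rule C_k_on_SucI[OF S, where D = "\<lambda>i x. (-1) * partial f i x * (inverse (f x) * inverse (f x))"])
    show "continuous_on S (\<lambda>x. inverse (f x))"
      by (rule continuous_on_inverse[OF C_k_on_continuous[OF E Suc.prems]]) (use nz in blast)
    fix i assume i: "i < d"
    show "C_k_on k d S (\<lambda>x. (-1) * partial f i x * (inverse (f x) * inverse (f x)))"
      by (rule C_k_on_mult[OF S] C_k_on_const[OF S] Suc.IH[OF C_k_on_mono[OF E Suc.prems]]
          C_k_on_SucD(2)[OF E Suc.prems i])+
    fix x assume x: "x \<in> S"
    show "((\<lambda>t. inverse (f (x(i := t)))) has_real_derivative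
      (-1) * partial f i x * (inverse (f x) * inverse (f x))) (at (x i))"
      using DERIV_inverse_fun[OF C_k_on_SucD(1)[OF E Suc.prems(1) i x]] nz[OF x]
      unfolding fun_upd_triv by (simp add: power2_eq_square mult.assoc del: fun_upd_apply)
  qed
qed

section \<open>Increments, chain rule and composition\<close>

lemma open_Euc_contains_box:
  assumes S: "openin (Euclidean_space d) S" and x0: "x0 \<in> S"
  obtains e where "e > 0" "\<And>x. x \<in> Euc d \<Longrightarrow> (\<And>i. i < d \<Longrightarrow> \<bar>x i - x0 i\<bar> < e) \<Longrightarrow> x \<in> S"
proof -
  obtain T where T: "open T" "S = Euc d \<inter> T"
    using S by (auto simp: Euclidean_space_top_of_set openin_open)
  then have "openin (product_topology (\<lambda>i. euclidean) UNIV) T" "x0 \<in> T"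
    using x0 by (auto simp: open_fun_def)
  from product_topology_open_contains_basis[OF this]
  obtain X where X: "x0 \<in> (\<Pi>\<^sub>E i\<in>UNIV. X i)" "\<And>i. open (X i)" "(\<Pi>\<^sub>E i\<in>UNIV. X i) \<subseteq> T"
    by auto
  have "\<exists>e>0. \<forall>t. \<bar>t - x0 i\<bar> < e \<longrightarrow> t \<in> X i" for i
    using X(1) X(2)[of i] unfolding open_dist by (auto simp: PiE_iff dist_real_def)
  then obtain e where e: "\<And>i. e i > 0" "\<And>i t. \<bar>t - x0 i\<bar> < e i \<Longrightarrow> t \<in> X i"
    by metis
  show thesis
  proof
    \<comment> \<open>Only the \<open>d\<close> movable coordinates need a radius. Inserting 1 keeps
      the set nonempty when \<open>d\<close> is 0.\<close>
    show "Min (insert 1 (e ` {..<d})) > 0" using e(1) by simp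
    fix x assume x: "x \<in> Euc d" and lt: "\<And>i. i < d \<Longrightarrow> \<bar>x i - x0 i\<bar> < Min (insert 1 (e ` {..<d}))"
    have "x i \<in> X i" for i
    proof (cases "i < d")
      case True
      then have "\<bar>x i - x0 i\<bar> < e i" using lt[OF True] by simp
      then show ?thesis using e(2) by blast
    next
      case False
      then have "x i = x0 i" using x x0 T(2) by (simp add: Euc_iff)
      then show ?thesis using X(1) by (auto simp: PiE_iff)
    qed
    then have "x \<in> T" using X(3) by (auto simp: subset_iff PiE_iff)
    then show "x \<in> S" using x T(2) by simp
  qed
qed

text \<open>The mean value theorem without an order on the endpoints and with \<open>a = b\<close>
  allowed, as needed for increments of unknown sign.\<close>

lemma MVT_between:
  fixes h :: "real \<Rightarrow> real"
  assumes "\<And>t. \<bar>t - a\<bar> \<le> \<bar>b - a\<bar> \<Longrightarrow> (h has_real_derivative h' t) (at t)"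
  shows "\<exists>\<xi>. \<bar>\<xi> - a\<bar> \<le> \<bar>b - a\<bar> \<and> h b - h a = h' \<xi> * (b - a)"
proof (cases a b rule: linorder_cases)
  case less
  have "\<exists>z>a. z < b \<and> h b - h a = (b - a) * h' z"
    by (rule MVT2[OF less]) (rule assms, simp)
  then show ?thesis by (force simp: mult.commute)
next
  case greater
  have "\<exists>z>b. z < a \<and> h a - h b = (a - b) * h' z"
    by (rule MVT2[OF greater]) (rule assms, simp)
  then obtain z where "z > b" "z < a" "h a - h b = (a - b) * h' z" by blast
  then have "\<bar>z - a\<bar> \<le> \<bar>b - a\<bar> \<and> h b - h a = h' z * (b - a)"
    by (auto simp: algebra_simps)
  then show ?thesis by blast
next
  case equal
  then show ?thesis by (intro exI[of _ a]) auto
qed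

text \<open>The several-variable form of Caratheodory's characterization of the derivative: increments are
  linear with coefficients that are continuous at the base point.  It is stated along curves, so
  that the chain rule and the inverse rule follow without using norms.\<close>

lemma C1_increment:
  fixes f :: "(nat \<Rightarrow> real) \<Rightarrow> real"
  assumes S: "openin (Euclidean_space d) S" and x0: "x0 \<in> S" and f: "C_k_on (Suc 0) d S f"
  obtains q where
    "\<forall>(F :: real filter) y. (\<forall>\<^sub>F t in F. y t \<in> Euc d) \<and> (\<forall>i<d. ((\<lambda>t. y t i) \<longlongrightarrow> x0 i) F) \<longrightarrow>
       (\<forall>\<^sub>F t in F. f (y t) - f x0 = (\<Sum>j<d. q j (y t) * (y t j - x0 j))) \<and>
       (\<forall>j<d. ((\<lambda>t. q j (y t)) \<longlongrightarrow> partial f j x0) F)"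
proof -
  have E: "S \<subseteq> Euc d" using openin_subset[OF S] .
  obtain e where e: "e > 0" "\<And>x. x \<in> Euc d \<Longrightarrow> (\<And>i. i < d \<Longrightarrow> \<bar>x i - x0 i\<bar> < e) \<Longrightarrow> x \<in> S"
    using open_Euc_contains_box[OF S x0] by blast
  define box where "box = {x \<in> Euc d. \<forall>i<d. \<bar>x i - x0 i\<bar> < e}"
  \<comment> \<open>The staircase from \<open>x0\<close> to \<open>x\<close>: \<open>z j x\<close>
    already has the first \<open>j\<close> coordinates of \<open>x\<close>. Consecutive corners
    differ in one coordinate, so the one-variable mean value theorem applies to each step.\<close>
  define z where "z = (\<lambda>j x i. if i < j then x i else x0 i :: real)"
  have "\<exists>w\<in>Euc d. (\<forall>i<d. \<bar>w i - x0 i\<bar> \<le> \<bar>x i - x0 i\<bar>) \<and>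
      f (z (Suc j) x) - f (z j x) = partial f j w * (x j - x0 j)" if x: "x \<in> box" and j: "j < d" for x j
  proof -
    have zx: "(z j x)(j := t) \<in> Euc d \<and> (\<forall>i<d. \<bar>((z j x)(j := t)) i - x0 i\<bar> \<le> \<bar>x i - x0 i\<bar>)"
      if "\<bar>t - x0 j\<bar> \<le> \<bar>x j - x0 j\<bar>" for t
      using that x x0 E j by (auto simp: box_def z_def Euc_iff subset_iff)
    have zS: "(z j x)(j := t) \<in> S" if "\<bar>t - x0 j\<bar> \<le> \<bar>x j - x0 j\<bar>" for t
    proof (rule e(2))
      show "(z j x)(j := t) \<in> Euc d" using zx[OF that] by blast
      fix i assume "i < d"
      then have "\<bar>((z j x)(j := t)) i - x0 i\<bar> \<le> \<bar>x i - x0 i\<bar>" "\<bar>x i - x0 i\<bar> < e"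
        using zx[OF that] x by (auto simp: box_def)
      then show "\<bar>((z j x)(j := t)) i - x0 i\<bar> < e" by linarith
    qed
    have "((\<lambda>t. f ((z j x)(j := t))) has_real_derivative partial f j ((z j x)(j := t))) (at t)"
      if "\<bar>t - x0 j\<bar> \<le> \<bar>x j - x0 j\<bar>" for t
      using C_k_on_SucD(1)[OF E f j zS[OF that]] by simp
    from MVT_between[of "x0 j" "x j" "\<lambda>t. f ((z j x)(j := t))", OF this]
    obtain \<xi> where \<xi>: "\<bar>\<xi> - x0 j\<bar> \<le> \<bar>x j - x0 j\<bar>"
      "f ((z j x)(j := x j)) - f ((z j x)(j := x0 j)) = partial f j ((z j x)(j := \<xi>)) * (x j - x0 j)"
      by blast
    moreover have "(z j x)(j := x j) = z (Suc j) x" "(z j x)(j := x0 j) = z j x"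
      by (auto simp: z_def fun_eq_iff)
    ultimately show ?thesis using zx[OF \<xi>(1)]
      by (intro bexI[of _ "(z j x)(j := \<xi>)"]) (simp_all del: fun_upd_apply)
  qed
  then obtain w where w: "\<And>x j. x \<in> box \<Longrightarrow> j < d \<Longrightarrow> w x j \<in> Euc d"
    "\<And>x j i. x \<in> box \<Longrightarrow> j < d \<Longrightarrow> i < d \<Longrightarrow> \<bar>w x j i - x0 i\<bar> \<le> \<bar>x i - x0 i\<bar>"
    "\<And>x j. x \<in> box \<Longrightarrow> j < d \<Longrightarrow> f (z (Suc j) x) - f (z j x) = partial f j (w x j) * (x j - x0 j)"
    by metis
  have tele: "f x - f x0 = (\<Sum>j<d. partial f j (w x j) * (x j - x0 j))" if x: "x \<in> box" for x
  proof -
    have "z d x = x" "z 0 x = x0"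
      using x x0 E by (auto simp: box_def z_def Euc_iff fun_eq_iff subset_iff)
    then have "f x - f x0 = (\<Sum>j<d. f (z (Suc j) x) - f (z j x))"
      using sum_lessThan_telescope[of "\<lambda>j. f (z j x)" d] by simp
    then show ?thesis using w(3)[OF x] by simp
  qed
  have ev: "\<forall>\<^sub>F t in F. y t \<in> box" if "\<forall>\<^sub>F t in F. y t \<in> Euc d" "\<And>i. i < d \<Longrightarrow> ((\<lambda>t. y t i) \<longlongrightarrow> x0 i) F"
    for F :: "real filter" and y
  proof -
    have "\<forall>\<^sub>F t in F. \<forall>i\<in>{..<d}. dist (y t i) (x0 i) < e"
      by (rule eventually_ball_finite) (use that(2) e(1) in \<open>auto simp: tendsto_iff\<close>)
    with that(1) show ?thesis
      by eventually_elim (auto simp: box_def dist_real_def)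
  qed
  \<comment> \<open>The coefficient \<open>q j\<close> is the partial derivative at the intermediate
    point \<open>w x j\<close>. That point is no farther from \<open>x0\<close> than
    \<open>x\<close> in any coordinate, so continuity of the partial derivative gives the
    limit.\<close>
  show thesis
  proof (rule that, intro allI impI, elim conjE, intro conjI allI impI)
    fix F :: "real filter" and y
    assume *: "\<forall>\<^sub>F t in F. y t \<in> Euc d" "\<forall>i<d. ((\<lambda>t. y t i) \<longlongrightarrow> x0 i) F"
    have evb: "\<forall>\<^sub>F t in F. y t \<in> box" by (rule ev) (use * in auto)
    then show "\<forall>\<^sub>F t in F. f (y t) - f x0 = (\<Sum>j<d. partial f j (w (y t) j) * (y t j - x0 j))"
      by eventually_elim (rule tele)
    fix j assume j: "j < d"
    from evb have 1: "\<forall>\<^sub>F t in F. w (y t) j \<in> Euc d" by eventually_elim (use w j in auto)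
    have 2: "((\<lambda>t. w (y t) j i) \<longlongrightarrow> x0 i) F" if i: "i < d" for i
    proof (rule LIM_zero_cancel)
      have "((\<lambda>t. \<bar>y t i - x0 i\<bar>) \<longlongrightarrow> 0) F"
        using *(2) i by (intro tendsto_rabs_zero LIM_zero) auto
      then show "((\<lambda>t. w (y t) j i - x0 i) \<longlongrightarrow> 0) F"
        by (rule Lim_null_comparison[rotated])
           (use evb in \<open>auto elim!: eventually_mono intro!: w(2) i j\<close>)
    qed
    have 3: "continuous_on S (partial f j)"
      using C_k_on_SucD(2)[OF E f j] C_k_on_0[OF E] by blast
    show "((\<lambda>t. partial f j (w (y t) j)) \<longlongrightarrow> partial f j x0) F"
      by (rule continuous_on_tendsto_compose[OF 3 eventually_in_open_Euc(1)[OF S x0 1 2] x0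
            eventually_in_open_Euc(2)[OF S x0 1 2]])
  qed
qed

text \<open>Divide the increment formula by \<open>t - t0\<close>: both factors in each summand
  converge. Differentiability of the curve is needed only at \<open>t0\<close>.\<close>

lemma chain_rule_curve:
  assumes S: "openin (Euclidean_space d) S" and x0: "y t0 \<in> S" and f: "C_k_on (Suc 0) d S f"
    and y: "\<forall>\<^sub>F t in at t0. y t \<in> Euc d"
    and v: "\<And>j. j < d \<Longrightarrow> ((\<lambda>t. y t j) has_real_derivative v j) (at t0)"
  shows "((\<lambda>t. f (y t)) has_real_derivative (\<Sum>j<d. partial f j (y t0) * v j)) (at t0)"
proof -
  have lim: "((\<lambda>t. y t i) \<longlongrightarrow> y t0 i) (at t0)" if "i < d" for i
    using DERIV_isCont[OF v[OF that]] by (simp add: isCont_def)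
  from C1_increment[OF S x0 f] obtain q where
    "\<forall>(F :: real filter) y'. (\<forall>\<^sub>F t in F. y' t \<in> Euc d) \<and> (\<forall>i<d. ((\<lambda>t. y' t i) \<longlongrightarrow> y t0 i) F) \<longrightarrow>
       (\<forall>\<^sub>F t in F. f (y' t) - f (y t0) = (\<Sum>j<d. q j (y' t) * (y' t j - y t0 j))) \<and>
       (\<forall>j<d. ((\<lambda>t. q j (y' t)) \<longlongrightarrow> partial f j (y t0)) F)" .
  from this[rule_format, of y "at t0"] y lim
  have q: "\<forall>\<^sub>F t in at t0. f (y t) - f (y t0) = (\<Sum>j<d. q j (y t) * (y t j - y t0 j))"
    "\<And>j. j < d \<Longrightarrow> ((\<lambda>t. q j (y t)) \<longlongrightarrow> partial f j (y t0)) (at t0)" by auto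
  have "((\<lambda>t. \<Sum>j<d. q j (y t) * ((y t j - y t0 j) / (t - t0))) \<longlongrightarrow> (\<Sum>j<d. partial f j (y t0) * v j)) (at t0)"
    by (intro tendsto_sum tendsto_mult) (use v q in \<open>auto simp: has_field_derivative_iff\<close>)
  then show ?thesis unfolding has_field_derivative_iff
  proof (rule Lim_transform_eventually)
    show "\<forall>\<^sub>F t in at t0. (\<Sum>j<d. q j (y t) * ((y t j - y t0 j) / (t - t0))) = (f (y t) - f (y t0)) / (t - t0)"
      using q(1) by eventually_elim (simp add: sum_divide_distrib)
  qed
qed

text \<open>Each partial derivative of the composite is a sum of products of a partial derivative of
  \<open>g\<close>, composed with \<open>f\<close>, and one of \<open>f\<close>. The induction
  therefore runs over all outer functions at once.\<close>

lemma C_k_on_compose: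
  assumes S: "openin (Euclidean_space d) S" and T: "openin (Euclidean_space e) T"
    and fT: "\<And>x. x \<in> S \<Longrightarrow> f x \<in> T"
  shows "(\<And>j. j < e \<Longrightarrow> C_k_on k d S (\<lambda>x. f x j)) \<Longrightarrow> C_k_on k e T g \<Longrightarrow> C_k_on k d S (\<lambda>x. g (f x))"
proof (induction k arbitrary: g)
  case 0
  note E = openin_subset[OF S] openin_subset[OF T]
  have "continuous_on S f"
  proof (rule continuous_on_coordinatewise_then_product)
    fix i show "continuous_on S (\<lambda>x. f x i)"
    proof (cases "i < e")
      case True then show ?thesis using 0 C_k_on_0[OF E(1)] by blast
    next
      case False
      then have "\<And>x. x \<in> S \<Longrightarrow> f x i = 0" using fT E(2) by (auto simp: Euc_iff subset_iff)
      then show ?thesis by (simp cong: continuous_on_cong)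
    qed
  qed
  moreover have "continuous_on (f ` S) g"
    using 0(2) fT continuous_on_subset unfolding C_k_on_0[OF E(2)] by blast
  ultimately show ?case unfolding C_k_on_0[OF E(1)]
    by (intro continuous_on_compose2[of "f ` S" g S f]) auto
next
  case (Suc k)
  note E = openin_subset[OF S] openin_subset[OF T]
  have C1: "C_k_on (Suc 0) e T g" if "C_k_on (Suc m) e T g" for m
    using that by (induction m) (use C_k_on_mono[OF E(2)] in blast)+
  have less: "C_k_on k d S (\<lambda>x. f x j)" if "j < e" for j
    by (rule C_k_on_mono[OF E(1) Suc.prems(1)[OF that]])
  have IH: "C_k_on k e T g' \<Longrightarrow> C_k_on k d S (\<lambda>x. g' (f x))" for g'
    by (rule Suc.IH[OF less])
  show ?case
  proof (rule C_k_on_SucI[OF S, where D = "\<lambda>i x. \<Sum>j<e. partial g j (f x) * partial (\<lambda>x. f x j) i x"])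
    show "continuous_on S (\<lambda>x. g (f x))"
      by (rule C_k_on_continuous[OF E(1) IH[OF C_k_on_mono[OF E(2) Suc.prems(2)]]])
    fix i assume i: "i < d"
    show "C_k_on k d S (\<lambda>x. \<Sum>j<e. partial g j (f x) * partial (\<lambda>x. f x j) i x)"
    proof (rule C_k_on_sum[OF S], rule C_k_on_mult[OF S])
      fix j assume "j \<in> {..<e}"
      then have j: "j < e" by simp
      show "C_k_on k d S (\<lambda>x. partial g j (f x))"
        by (rule IH[OF C_k_on_SucD(2)[OF E(2) Suc.prems(2) j]])
      show "C_k_on k d S (\<lambda>x. partial (\<lambda>x. f x j) i x)"
        by (rule C_k_on_SucD(2)[OF E(1) Suc.prems(1)[OF j] i])
    qed
    fix x assume x: "x \<in> S"
    have "((\<lambda>t. g (f (x(i := t)))) has_real_derivative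
        (\<Sum>j<e. partial g j (f (x(i := x i))) * partial (\<lambda>x. f x j) i x)) (at (x i))"
    proof (rule chain_rule_curve[OF T _ C1[OF Suc.prems(2)]])
      show "f (x(i := x i)) \<in> T" using fT x by simp
      have "\<forall>\<^sub>F t in at (x i). x(i := t) \<in> S"
        using line_in_open[OF S x i] by (simp add: eventually_at_filter eventually_mono)
      then show "\<forall>\<^sub>F t in at (x i). f (x(i := t)) \<in> Euc e"
        by eventually_elim (rule subsetD[OF E(2) fT])
      show "((\<lambda>t. f (x(i := t)) j) has_real_derivative partial (\<lambda>x. f x j) i x) (at (x i))"
        if "j < e" for j
        by (rule C_k_on_SucD(1)[OF E(1) Suc.prems(1)[OF that] i x])
    qed
    then show "((\<lambda>t. g (f (x(i := t)))) has_real_derivative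
        (\<Sum>j<e. partial g j (f x) * partial (\<lambda>x. f x j) i x)) (at (x i))" by simp
  qed
qed

section \<open>Determinants, Cramer's rule and the inverse function theorem\<close>

definition fdet :: "nat \<Rightarrow> (nat \<Rightarrow> nat \<Rightarrow> real) \<Rightarrow> real" where
  "fdet m J = Determinant.det (mat m m (\<lambda>(i, j). J i j))"

text \<open>The entry (j, k) of the adjugate: row \<open>k\<close> and column \<open>j\<close> are
  deleted.\<close>

definition fcof :: "nat \<Rightarrow> (nat \<Rightarrow> nat \<Rightarrow> real) \<Rightarrow> nat \<Rightarrow> nat \<Rightarrow> real" where
  "fcof m J j k = (-1) ^ (k + j) *
     fdet (m - 1) (\<lambda>a b. J (if a < k then a else Suc a) (if b < j then b else Suc b))"

text \<open>The Leibniz formula shows the determinant to be a polynomial in the entries; smoothness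
  and limits of \<open>fdet\<close> and \<open>fcof\<close> both come from it.\<close>

lemma fdet_altdef:
  "fdet m J = (\<Sum>p | p permutes {0..<m}. of_int (sign p) * (\<Prod>i = 0..<m. J i (p i)))"
  unfolding fdet_def Determinant.det_def
  by (auto intro!: sum.cong prod.cong simp: permutes_in_image)

lemma C_k_on_fdet:
  assumes S: "openin (Euclidean_space d) S"
    and "\<And>i j. i < m \<Longrightarrow> j < m \<Longrightarrow> C_k_on k d S (\<lambda>x. J x i j)"
  shows "C_k_on k d S (\<lambda>x. fdet m (J x))"
  unfolding fdet_altdef
  by (intro C_k_on_sum[OF S] C_k_on_mult[OF S] C_k_on_const[OF S] C_k_on_prod[OF S] assms)
     (auto simp: permutes_in_image)

lemma tendsto_fdet:
  assumes "\<And>i j. i < m \<Longrightarrow> j < m \<Longrightarrow> ((\<lambda>t. J t i j) \<longlongrightarrow> L i j) F"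
  shows "((\<lambda>t. fdet m (J t)) \<longlongrightarrow> fdet m L) F"
  unfolding fdet_altdef
  by (intro tendsto_sum tendsto_mult tendsto_const tendsto_prod assms)
     (auto simp: permutes_in_image)

lemma C_k_on_fcof:
  assumes S: "openin (Euclidean_space d) S"
    and "\<And>i j. i < m \<Longrightarrow> j < m \<Longrightarrow> C_k_on k d S (\<lambda>x. J x i j)" "a < m" "b < m"
  shows "C_k_on k d S (\<lambda>x. fcof m (J x) a b)"
  unfolding fcof_def
  by (intro C_k_on_mult[OF S] C_k_on_const[OF S] C_k_on_fdet[OF S] assms) (use assms in auto)

lemma tendsto_fcof:
  assumes "\<And>i j. i < m \<Longrightarrow> j < m \<Longrightarrow> ((\<lambda>t. J t i j) \<longlongrightarrow> L i j) F" "a < m" "b < m"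
  shows "((\<lambda>t. fcof m (J t) a b) \<longlongrightarrow> fcof m L a b) F"
  unfolding fcof_def
  by (intro tendsto_mult tendsto_const tendsto_fdet assms) (use assms in auto)

text \<open>Multiplication by the adjugate. Stated without division so that it also yields
  \<open>fdet m J = 0\<close> when a nonzero vector is sent to 0.\<close>

lemma fcof_cramer:
  assumes "\<And>i. i < m \<Longrightarrow> (\<Sum>j<m. J i j * u j) = c i" and j: "j < m"
  shows "fdet m J * u j = (\<Sum>k<m. fcof m J j k * c k)"
proof -
  define A where "A = mat m m (\<lambda>(i, j). J i j)"
  have A: "A \<in> carrier_mat m m" by (simp add: A_def)
  have cof: "adj_mat A $$ (a, b) = fcof m J a b" if "a < m" "b < m" for a b
  proof -
    have "mat_delete A b a = mat (m - 1) (m - 1)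
       (\<lambda>(i, j). J (if i < b then i else Suc i) (if j < a then j else Suc j))"
      by (rule eq_matI) (use that in \<open>auto simp: mat_delete_def A_def\<close>)
    then show ?thesis using that A
      by (simp add: adj_mat_def cofactor_def fcof_def fdet_def)
  qed
  have mv: "A *\<^sub>v vec m u = vec m c"
    by (rule eq_vecI) (use assms in \<open>auto simp: A_def scalar_prod_def atLeast0LessThan\<close>)
  have "adj_mat A *\<^sub>v (A *\<^sub>v vec m u) = (adj_mat A * A) *\<^sub>v vec m u"
    by (rule assoc_mult_mat_vec[symmetric, OF adj_mat(1)[OF A] A]) simp
  also have "\<dots> = Determinant.det A \<cdot>\<^sub>v vec m u"
    by (rule eq_vecI) (simp_all add: adj_mat(3)[OF A] scalar_prod_def sum.delta if_distrib[of "\<lambda>x. x * _"] if_distrib[of "\<lambda>x. _ * x"] cong: if_cong)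
  finally have "(adj_mat A *\<^sub>v vec m c) $ j = Determinant.det A * u j"
    using j by (simp add: mv)
  moreover have "(adj_mat A *\<^sub>v vec m c) $ j = (\<Sum>k<m. fcof m J j k * c k)"
    using j adj_mat(1)[OF A] cof by (auto simp: scalar_prod_def atLeast0LessThan)
  ultimately show ?thesis by (simp add: fdet_def A_def)
qed

text \<open>Continuity of the inverse \<open>G\<close> is assumed, so only its differentiability has
  to be earned. The increments of \<open>f\<close> between \<open>G y0\<close> and a nearby value of
  \<open>G\<close> form a linear system whose matrix tends to the Jacobian matrix; Cramer's rule
  gives the difference quotients of \<open>G\<close> and their limits.\<close>

lemma smooth_inverse_function:
  assumes S: "openin (Euclidean_space d) S" and T: "openin (Euclidean_space d) T"
    and f: "\<And>k j. j < d \<Longrightarrow> C_k_on k d S (\<lambda>x. f x j)"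
    and G: "continuous_on T G" "\<And>y. y \<in> T \<Longrightarrow> G y \<in> S" "\<And>y. y \<in> T \<Longrightarrow> f (G y) = y"
    and nz: "\<And>x. x \<in> S \<Longrightarrow> fdet d (\<lambda>i j. partial (\<lambda>x. f x i) j x) \<noteq> 0"
    and j: "j < d"
  shows "C_k_on k d T (\<lambda>y. G y j)"
proof -
  note E = openin_subset[OF S] openin_subset[OF T]
  define J where "J = (\<lambda>x i j. partial (\<lambda>x. f x i) j x)"
  \<comment> \<open>The entries of the inverse Jacobian matrix, as smooth functions on
    \<open>S\<close>.\<close>
  define h where "h = (\<lambda>x j i. fcof d (J x) j i * inverse (fdet d (J x)))"
  have h: "C_k_on k d S (\<lambda>x. h x j i)" if "j < d" "i < d" for k i j
  proof -
    have "C_k_on k d S (\<lambda>x. J x i j)" if "i < d" "j < d" for i j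
      unfolding J_def by (rule C_k_on_SucD(2)[OF E(1) f[OF that(1)] that(2)])
    then show ?thesis unfolding h_def
      by (intro C_k_on_mult[OF S] C_k_on_fcof[OF S] C_k_on_inverse[OF S] C_k_on_fdet[OF S] that)
         (use nz in \<open>auto simp: J_def\<close>)
  qed
  have der: "((\<lambda>t. G (y0(i := t)) j) has_real_derivative h (G y0) j i) (at (y0 i))"
    if y0: "y0 \<in> T" and i: "i < d" and j: "j < d" for y0 i j
  proof -
    define F where "F = at (y0 i)"
    have inT: "\<forall>\<^sub>F t in F. y0(i := t) \<in> T"
      using line_in_open[OF T y0 i] by (simp add: F_def eventually_at_filter eventually_mono)
    have "((\<lambda>t. y0(i := t)) \<longlongrightarrow> y0) F"
    proof (rule tendsto_fun_coordinatewise)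
      fix a show "((\<lambda>t. (y0(i := t)) a) \<longlongrightarrow> y0 a) F"
        by (cases "a = i") (auto simp: F_def)
    qed
    then have "((\<lambda>t. G (y0(i := t))) \<longlongrightarrow> G y0) F"
      by (rule continuous_on_tendsto_compose[OF G(1) _ y0 inT])
    then have lim: "((\<lambda>t. G (y0(i := t)) a) \<longlongrightarrow> G y0 a) F" for a
      using continuous_on_tendsto_compose[OF continuous_on_product_then_coordinatewise[OF continuous_on_id, of UNIV a]]
      by auto
    have inE: "\<forall>\<^sub>F t in F. G (y0(i := t)) \<in> Euc d"
      using inT by eventually_elim (use G(2) E(1) in blast)
    define incr where "incr = (\<lambda>k q. \<forall>(F :: real filter) y. (\<forall>\<^sub>F t in F. y t \<in> Euc d) \<and> (\<forall>i<d. ((\<lambda>t. y t i) \<longlongrightarrow> G y0 i) F) \<longrightarrow>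
       (\<forall>\<^sub>F t in F. f (y t) k - f (G y0) k = (\<Sum>j<d. q j (y t) * (y t j - G y0 j))) \<and>
       (\<forall>j<d. ((\<lambda>t. q j (y t)) \<longlongrightarrow> J (G y0) k j) F))"
    have "\<exists>q. incr k q" if "k < d" for k
      unfolding J_def incr_def by (rule C1_increment[OF S G(2)[OF y0] f[OF that]]) (rule exI)
    then obtain q where q0: "\<And>k. k < d \<Longrightarrow> incr k (q k)"
      by metis
    \<comment> \<open>The matrix of the increment coefficients along \<open>G (y0(i := t))\<close>.
      Its determinant tends to that of the Jacobian matrix, hence is eventually nonzero.\<close>
    define Q where "Q = (\<lambda>t k j. q k j (G (y0(i := t))))"
    have q1: "\<forall>\<^sub>F t in F. f (G (y0(i := t))) k - f (G y0) k = (\<Sum>j<d. Q t k j * (G (y0(i := t)) j - G y0 j))"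
      and q2: "j < d \<Longrightarrow> ((\<lambda>t. Q t k j) \<longlongrightarrow> J (G y0) k j) F" if "k < d" for k j
      using q0[OF that, unfolded incr_def, rule_format, of "\<lambda>t. G (y0(i := t))" F] inE lim by (auto simp: Q_def)
    have "\<forall>\<^sub>F t in F. \<forall>k\<in>{..<d}. f (G (y0(i := t))) k - f (G y0) k = (\<Sum>j<d. Q t k j * (G (y0(i := t)) j - G y0 j))"
      by (rule eventually_ball_finite) (use q1 in auto)
    moreover have limd: "((\<lambda>t. fdet d (Q t)) \<longlongrightarrow> fdet d (J (G y0))) F"
      by (rule tendsto_fdet) (rule q2)
    moreover have nz0: "fdet d (J (G y0)) \<noteq> 0" using nz[OF G(2)[OF y0]] by (simp add: J_def)
    moreover have "\<forall>\<^sub>F t in F. t \<noteq> y0 i" by (simp add: F_def eventually_at_filter)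
    ultimately have "\<forall>\<^sub>F t in F. (\<forall>k\<in>{..<d}. f (G (y0(i := t))) k - f (G y0) k = (\<Sum>j<d. Q t k j * (G (y0(i := t)) j - G y0 j)))
      \<and> fdet d (Q t) \<noteq> 0 \<and> y0(i := t) \<in> T \<and> t \<noteq> y0 i"
      using inT tendsto_imp_eventually_ne[OF limd nz0] by (intro eventually_conj)
    then have "\<forall>\<^sub>F t in F. fcof d (Q t) j i * inverse (fdet d (Q t)) = (G (y0(i := t)) j - G y0 j) / (t - y0 i)"
    proof eventually_elim
      case (elim t)
      have "(\<Sum>j<d. Q t k j * (G (y0(i := t)) j - G y0 j)) = (if k = i then t - y0 i else 0)" if "k < d" for k
      proof -
        have "f (G (y0(i := t))) k - f (G y0) k = (\<Sum>j<d. Q t k j * (G (y0(i := t)) j - G y0 j))"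
          using elim that by blast
        moreover have "f (G (y0(i := t))) = y0(i := t)" "f (G y0) = y0" using elim G(3) y0 by auto
        ultimately show ?thesis by auto
      qed
      from fcof_cramer[of d "Q t" "\<lambda>j. G (y0(i := t)) j - G y0 j" _ j, OF this j]
      have "fdet d (Q t) * (G (y0(i := t)) j - G y0 j) = (\<Sum>k<d. fcof d (Q t) j k * (if k = i then t - y0 i else 0))" .
      also have "\<dots> = fcof d (Q t) j i * (t - y0 i)"
        using i by (simp add: if_distrib[of "\<lambda>x. _ * x"] cong: if_cong)
      finally show ?case using elim by (simp add: field_simps)
    qed
    moreover have "((\<lambda>t. fcof d (Q t) j i * inverse (fdet d (Q t))) \<longlongrightarrow> h (G y0) j i) F"
      unfolding h_def by (intro tendsto_mult tendsto_inverse limd nz0 tendsto_fcof q2 i j)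
    ultimately show ?thesis
      unfolding has_field_derivative_iff F_def fun_upd_triv by (rule Lim_transform_eventually[rotated])
  qed
  show ?thesis using j
  proof (induction k arbitrary: j)
    case 0
    show ?case unfolding C_k_on_0[OF E(2)]
      by (rule continuous_on_product_then_coordinatewise[OF G(1)])
  next
    case (Suc k)
    show ?case
    proof (rule C_k_on_SucI[OF T _ der])
      show "continuous_on T (\<lambda>y. G y j)" by (rule continuous_on_product_then_coordinatewise[OF G(1)])
      fix i assume i: "i < d"
      \<comment> \<open>Bootstrapping: the partial derivatives of \<open>G\<close> are
        \<open>h\<close> composed with \<open>G\<close>, so order \<open>k\<close> for all
        coordinates of \<open>G\<close> gives order \<open>Suc k\<close>.\<close>
      show "C_k_on k d T (\<lambda>x. h (G x) j i)"
        by (rule C_k_on_compose[OF T S G(2) Suc.IH h[OF Suc.prems i]])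
    qed (use Suc.prems in auto)
  qed
qed

section \<open>Rank and left kernels\<close>

lemma fdet_zero_left_kernel:
  assumes "fdet m J = 0"
  shows "\<exists>y. (\<exists>i<m. y i \<noteq> 0) \<and> (\<forall>j<m. (\<Sum>i<m. y i * J i j) = 0)"
proof -
  define A where "A = mat m m (\<lambda>(i, j). J i j)"
  have A: "A\<^sup>T \<in> carrier_mat m m" by (simp add: A_def)
  have "Determinant.det A\<^sup>T = 0" using assms by (simp add: A_def fdet_def Determinant.det_transpose[of _ m])
  then obtain v where v: "v \<in> carrier_vec m" "v \<noteq> 0\<^sub>v m" "A\<^sup>T *\<^sub>v v = 0\<^sub>v m"
    using det_0_iff_vec_prod_zero[OF A] by blast
  then obtain i where i: "i < m" "v $ i \<noteq> 0" by (metis carrier_vecD eq_vecI index_zero_vec)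
  have "(\<Sum>i<m. v $ i * J i j) = 0" if "j < m" for j
  proof -
    have "(A\<^sup>T *\<^sub>v v) $ j = 0" using v(3) that by simp
    then show ?thesis using that v(1)
      by (simp add: A_def scalar_prod_def atLeast0LessThan mult.commute)
  qed
  with i show ?thesis by blast
qed

text \<open>A maximal independent set of columns has \<open>m\<close> members and forms an
  invertible square matrix. A row vector annihilating all columns annihilates this matrix and so
  vanishes.\<close>

lemma full_row_rank_left_kernel:
  fixes M :: "real mat"
  assumes M: "M \<in> carrier_mat m n" and rank: "vec_space.rank m M = m"
    and y: "\<And>j. j < n \<Longrightarrow> (\<Sum>i<m. y i * M $$ (i, j)) = 0" and i: "i < m"
  shows "y i = 0"
proof -
  interpret vec_space "TYPE(real)" m .
  obtain S where S: "maximal S (\<lambda>T. T \<subseteq> set (cols M) \<and> lin_indpt T)"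
    using maximal_exists[of "\<lambda>T. T \<subseteq> set (cols M) \<and> lin_indpt T" "card (set (cols M))" "{}"]
    by (metis (no_types, lifting) List.finite_set card_mono empty_iff empty_subsetI finite_lin_indpt2 rev_finite_subset)
  then have S': "S \<subseteq> set (cols M)" "lin_indpt S" by (auto simp: maximal_def)
  have "card S = m" using rank_card_indpt[OF M S] rank by simp
  have "finite S" using S' finite_subset by blast
  then obtain l where l: "set l = S" "distinct l" using finite_distinct_list by blast
  then have len: "length l = m" using \<open>card S = m\<close> distinct_card by fastforce
  have lc: "set l \<subseteq> carrier_vec m" using l(1) S'(1) cols_dim M by blast
  define B where "B = mat_of_cols m l"
  have B: "B \<in> carrier_mat m m" using len by (simp add: B_def mat_of_cols_def)
  have "cols B = l" unfolding B_def by (rule cols_mat_of_cols[OF lc])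
  then have "Determinant.det B \<noteq> 0"
    using det_rank_iff[OF B] lin_indpt_full_rank[OF B] l S' by simp
  then have "Determinant.det B\<^sup>T \<noteq> 0" using Determinant.det_transpose[OF B] by simp
  moreover have "B\<^sup>T *\<^sub>v vec m y = 0\<^sub>v m"
  proof (rule eq_vecI)
    fix k assume "k < dim_vec (0\<^sub>v m)"
    then have k: "k < m" by simp
    then obtain j where j: "j < n" "l ! k = col M j"
      using S'(1) l(1) len M nth_mem[of k l] by (auto simp: cols_def)
    have "(B\<^sup>T *\<^sub>v vec m y) $ k = (\<Sum>i<m. B $$ (i, k) * y i)"
      using B k by (simp add: scalar_prod_def atLeast0LessThan)
    also have "\<dots> = (\<Sum>i<m. y i * M $$ (i, j))"
      using j k M len by (intro sum.cong) (auto simp: B_def mat_of_cols_index)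
    finally show "(B\<^sup>T *\<^sub>v vec m y) $ k = 0\<^sub>v m $ k" using y[OF j(1)] k by simp
  qed (use B in simp)
  ultimately have "vec m y = 0\<^sub>v m"
    using det_0_iff_vec_prod_zero[of "B\<^sup>T" m] B by (metis transpose_carrier_mat vec_carrier)
  then show ?thesis using i by (metis index_vec index_zero_vec(1))
qed

subsection \<open>Slices of a submersion\<close>

text \<open>\<open>p\<close> is the submersion, and \<open>L\<close> embeds the parameters by copying them to the free
  coordinates (those \<open>j\<close> with \<open>\<sigma> j \<noteq> None\<close>).  The assumption \<open>fill\<close> provides the transversality:
  the fixed coordinates can be moved arbitrarily along fibres of \<open>p\<close>.\<close>

locale smooth_slice =
  fixes Q :: "'b mfd" and d D :: nat and T :: "(nat \<Rightarrow> real) set" and p :: "(nat \<Rightarrow> real) \<Rightarrow> 'b"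
    and L :: "(nat \<Rightarrow> real) \<Rightarrow> nat \<Rightarrow> real" and \<sigma> :: "nat \<Rightarrow> nat option" and c :: "nat \<Rightarrow> real"
    and W :: "(nat \<Rightarrow> real) set"
  assumes Q: "smooth_manifold Q"
    and T: "openin (Euclidean_space D) T"
    and p_cont: "continuous_map (subtopology (Euclidean_space D) T) (mtop Q) p"
    and p_smooth: "\<And>V \<phi> k i. (V, \<phi>) \<in> charts Q \<Longrightarrow> i < mdim Q \<Longrightarrow> C_k_on k D (T \<inter> p -` V) (\<lambda>x. \<phi> (p x) i)"
    and p_rank: "\<And>V \<phi> x y. (V, \<phi>) \<in> charts Q \<Longrightarrow> x \<in> T \<Longrightarrow> p x \<in> V \<Longrightarrow>
       (\<And>j. j < D \<Longrightarrow> (\<Sum>i<mdim Q. y i * partial (\<lambda>x. \<phi> (p x) i) j x) = 0) \<Longrightarrow> \<forall>i<mdim Q. y i = 0"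
    and L_eq: "\<And>x j. L x j = (if j < D then case \<sigma> j of Some k \<Rightarrow> x k | None \<Rightarrow> c j else 0)"
    and \<sigma>: "\<And>j k. j < D \<Longrightarrow> \<sigma> j = Some k \<Longrightarrow> k < d"
      "\<And>j j' k. j < D \<Longrightarrow> j' < D \<Longrightarrow> \<sigma> j = Some k \<Longrightarrow> \<sigma> j' = Some k \<Longrightarrow> j = j'"
      "\<And>k. k < d \<Longrightarrow> \<exists>j<D. \<sigma> j = Some k"
    and W: "W = {x \<in> Euc d. L x \<in> T}"
    and inj: "inj_on (p \<circ> L) W"
    and fill: "\<And>x Z. x \<in> W \<Longrightarrow> \<exists>\<zeta>. (\<forall>j<D. \<sigma> j = None \<longrightarrow> \<zeta> j = Z j) \<and> (\<forall>j\<ge>D. \<zeta> j = 0) \<and>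
       (\<forall>t. (\<lambda>j. L x j + t * \<zeta> j) \<in> T \<longrightarrow> p (\<lambda>j. L x j + t * \<zeta> j) = p (L x))"
begin

abbreviation "e \<equiv> mdim Q"
abbreviation "\<psi> \<equiv> p \<circ> L"

lemma chart:
  assumes "(V, \<phi>) \<in> charts Q"
  shows "openin (mtop Q) V" "openin (Euclidean_space e) (\<phi> ` V)" "V \<subseteq> topspace (mtop Q)"
    "homeomorphic_map (subtopology (mtop Q) V) (subtopology (Euclidean_space e) (\<phi> ` V)) \<phi>"
  using assms Q openin_subset unfolding smooth_manifold_def by blast+

lemma chart_inj: "(V, \<phi>) \<in> charts Q \<Longrightarrow> inj_on \<phi> V"
  using chart[of V \<phi>] homeomorphic_eq_everything_map by (metis topspace_subtopology_subset)

lemma chart_cover: "q \<in> topspace (mtop Q) \<Longrightarrow> \<exists>V \<phi>. (V, \<phi>) \<in> charts Q \<and> q \<in> V"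
  using Q unfolding smooth_manifold_def by blast

lemma L_Euc: "L x \<in> Euc D" by (simp add: L_eq Euc_iff)

lemma L_cont: "continuous_on S L"
proof (rule continuous_on_coordinatewise_then_product)
  fix j show "continuous_on S (\<lambda>x. L x j)"
    using continuous_on_product_then_coordinatewise[OF continuous_on_id, of S]
    by (cases "\<sigma> j"; cases "j < D") (auto simp: L_eq)
qed

lemma L_cmap: "continuous_map (Euclidean_space d) (Euclidean_space D) L"
  using cm_Euclidean_space_iff_continuous_on[of d UNIV D L] L_cont L_Euc by auto

lemma W_open: "openin (Euclidean_space d) W"
  unfolding W by (rule openin_continuous_map_preimage[OF L_cmap T])

lemma W_Euc: "W \<subseteq> Euc d" by (auto simp: W)

lemma psi_cont: "continuous_map (subtopology (Euclidean_space d) W) (mtop Q) \<psi>"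
proof (rule continuous_map_compose[OF _ p_cont])
  show "continuous_map (subtopology (Euclidean_space d) W) (subtopology (Euclidean_space D) T) L"
    using continuous_map_from_subtopology[OF L_cmap] by (auto simp: continuous_map_in_subtopology W)
qed

lemma W_chart_open: "openin (mtop Q) V \<Longrightarrow> openin (Euclidean_space d) (W \<inter> \<psi> -` V)"
proof -
  assume "openin (mtop Q) V"
  from openin_continuous_map_preimage[OF psi_cont this]
  have "openin (subtopology (Euclidean_space d) W) (W \<inter> \<psi> -` V)"
    by (rule back_subst[of "openin _"]) (use W_Euc in auto)
  then show ?thesis using W_open openin_trans_full by blast
qed

lemma T_chart_open: "openin (mtop Q) V \<Longrightarrow> openin (Euclidean_space D) (T \<inter> p -` V)"
proof -
  assume "openin (mtop Q) V"
  from openin_continuous_map_preimage[OF p_cont this]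
  have "openin (subtopology (Euclidean_space D) T) (T \<inter> p -` V)"
    by (rule back_subst[of "openin _"]) (use openin_subset[OF T] in auto)
  then show ?thesis using T openin_trans_full by blast
qed

lemma L_smooth: "openin (Euclidean_space d) S \<Longrightarrow> C_k_on k d S (\<lambda>x. L x j)"
  by (cases "\<sigma> j"; cases "j < D") (simp_all add: L_eq C_k_on_const C_k_on_coord)

lemma psi_smooth:
  assumes "(V, \<phi>) \<in> charts Q" "i < e"
  shows "C_k_on k d (W \<inter> \<psi> -` V) (\<lambda>x. \<phi> (\<psi> x) i)"
  unfolding o_def
  by (rule C_k_on_compose[OF W_chart_open[OF chart(1)[OF assms(1)], unfolded o_def] T_chart_open[OF chart(1)[OF assms(1)]] _ L_smooth])
     (use assms W p_smooth W_chart_open chart in \<open>auto simp: o_def\<close>)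

text \<open>Let \<gamma> be \<open>y\<close> times the differential of \<open>p\<close> at
  \<open>L x\<close>. On free coordinates \<gamma> vanishes because those are the partial
  derivatives of \<open>\<psi>\<close>. On a fixed coordinate it vanishes because
  \<open>fill\<close> supplies a direction tangent to a fibre. Thus \<gamma> is 0 and the rank
  condition on \<open>p\<close> kills \<open>y\<close>.\<close>

lemma psi_left_kernel:
  assumes ch: "(V, \<phi>) \<in> charts Q" and x: "x \<in> W" "\<psi> x \<in> V"
    and y: "\<And>k. k < d \<Longrightarrow> (\<Sum>i<e. y i * partial (\<lambda>x. \<phi> (\<psi> x) i) k x) = 0" and i: "i < e"
  shows "y i = 0"
proof -
  define T' where "T' = T \<inter> p -` V"
  have T': "openin (Euclidean_space D) T'" unfolding T'_def by (rule T_chart_open[OF chart(1)[OF ch]])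
  have Lx: "L x \<in> T'" using x by (auto simp: W T'_def)
  define g where "g = (\<lambda>i j. partial (\<lambda>z. \<phi> (p z) i) j (L x))"
  define \<gamma> where "\<gamma> = (\<lambda>j. \<Sum>i<e. y i * g i j)"
  have line: "((\<lambda>t. \<phi> (p (z t)) i) has_real_derivative (\<Sum>j<D. g i j * v j)) (at t0)"
    if "i < e" "z t0 = L x" "\<And>t. z t \<in> Euc D" "\<And>j. j < D \<Longrightarrow> ((\<lambda>t. z t j) has_real_derivative v j) (at t0)"
    for i z v t0
    unfolding g_def that(2)[symmetric]
    by (rule chain_rule_curve[OF T' _ p_smooth[OF ch that(1), folded T'_def]])
       (use that Lx in auto)
  have Some0: "\<gamma> j = 0" if j: "j < D" "\<sigma> j = Some k" for j k
  proof -
    have k: "k < d" using \<sigma>(1) j by blast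
    have "partial (\<lambda>x. \<phi> (\<psi> x) i) k x = g i j" if i: "i < e" for i
    proof -
      have "((\<lambda>t. \<phi> (p (L (x(k := t)))) i) has_real_derivative (\<Sum>j'<D. g i j' * (if j' = j then 1 else 0))) (at (x k))"
      proof (rule line[OF i])
        fix j' assume j': "j' < D"
        show "((\<lambda>t. L (x(k := t)) j') has_real_derivative (if j' = j then 1 else 0)) (at (x k))"
        proof (cases "j' = j")
          case True
          then show ?thesis using j by (simp add: L_eq)
        next
          case False
          then have "\<sigma> j' \<noteq> Some k" using \<sigma>(2)[OF j' j(1) _ j(2)] by blast
          then have "(\<lambda>t. L (x(k := t)) j') = (\<lambda>t. L x j')"
            using j' by (auto simp: L_eq split: option.split)
          then show ?thesis using False by simp
        qed
      qed (auto simp: L_Euc)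
      then show ?thesis using j(1) by (simp add: partial_def DERIV_imp_deriv if_distrib cong: if_cong)
    qed
    then show ?thesis using y[OF k] by (simp add: \<gamma>_def)
  qed
  have None0: "\<gamma> j = 0" if j: "j < D" "\<sigma> j = None" for j
  proof -
    \<comment> \<open>The direction is prescribed as a unit vector on the fixed coordinates only.
      Its free coordinates are not controlled, but \<gamma> is already known to vanish
      there.\<close>
    obtain \<zeta> where \<zeta>: "\<forall>j'<D. \<sigma> j' = None \<longrightarrow> \<zeta> j' = (if j' = j then 1 else 0)" "\<forall>j'\<ge>D. \<zeta> j' = 0"
      "\<And>t. (\<lambda>j. L x j + t * \<zeta> j) \<in> T \<Longrightarrow> p (\<lambda>j. L x j + t * \<zeta> j) = p (L x)"
      using fill[OF x(1), of "\<lambda>j'. if j' = j then 1 else 0"] by blast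
    define z where "z = (\<lambda>t j. L x j + t * \<zeta> j)"
    have zE: "z t \<in> Euc D" for t using L_Euc[of x] \<zeta>(2) by (simp add: z_def Euc_iff)
    have zd: "((\<lambda>t. z t j) has_real_derivative \<zeta> j) (at 0)" for j
      unfolding z_def by (auto intro!: derivative_eq_intros)
    have "\<forall>\<^sub>F t in nhds 0. z t \<in> T'"
    proof (rule eventually_in_open_Euc(2)[OF T' Lx])
      show "\<forall>\<^sub>F t in nhds 0. z t \<in> Euc D" using zE by simp
      show "((\<lambda>t. z t i) \<longlongrightarrow> L x i) (nhds 0)" for i
        unfolding z_def by (auto intro!: tendsto_eq_intros filterlim_ident)
    qed
    then have ev: "\<forall>\<^sub>F t in nhds 0. \<phi> (p (z t)) i = \<phi> (p (L x)) i" for i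
      by eventually_elim (use \<zeta>(3) in \<open>auto simp: T'_def z_def\<close>)
    have "(\<Sum>j<D. g i j * \<zeta> j) = 0" if i: "i < e" for i
    proof -
      have "((\<lambda>t. \<phi> (p (z t)) i) has_real_derivative (\<Sum>j<D. g i j * \<zeta> j)) (at 0)"
        by (rule line[OF i]) (use zE zd in \<open>auto simp: z_def\<close>)
      moreover have "((\<lambda>t. \<phi> (p (z t)) i) has_real_derivative 0) (at 0)"
        using DERIV_cong_ev[OF refl ev refl] by simp
      ultimately show ?thesis by (rule DERIV_unique)
    qed
    then have "0 = (\<Sum>i<e. y i * (\<Sum>j<D. g i j * \<zeta> j))" by simp
    also have "\<dots> = (\<Sum>i<e. \<Sum>j<D. y i * g i j * \<zeta> j)"
      by (simp add: sum_distrib_left mult.assoc)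
    also have "\<dots> = (\<Sum>j<D. \<Sum>i<e. y i * g i j * \<zeta> j)" by (rule sum.swap)
    also have "\<dots> = (\<Sum>j'<D. \<gamma> j' * \<zeta> j')" by (simp add: \<gamma>_def sum_distrib_right)
    also have "\<dots> = (\<Sum>j'<D. if j' = j then \<gamma> j else 0)"
    proof (rule sum.cong)
      fix j' assume "j' \<in> {..<D}"
      then show "\<gamma> j' * \<zeta> j' = (if j' = j then \<gamma> j else 0)"
        using Some0[of j'] \<zeta>(1) j by (cases "\<sigma> j'") auto
    qed simp
    also have "\<dots> = \<gamma> j" using j by simp
    finally show ?thesis by simp
  qed
  have "\<gamma> j = 0" if "j < D" for j using Some0 None0 that by (cases "\<sigma> j") auto
  then show ?thesis
    using p_rank[OF ch, of "L x" y] Lx i by (auto simp: \<gamma>_def g_def T'_def)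
qed

section \<open>Equality of dimensions and openness of the image\<close>

lemma chart_psi_Euc: "(V, \<phi>) \<in> charts Q \<Longrightarrow> x \<in> \<psi> -` V \<Longrightarrow> \<phi> (\<psi> x) \<in> Euc e"
  using openin_subset[OF chart(2)] by blast

lemma chart_psi_cont:
  assumes ch: "(V, \<phi>) \<in> charts Q"
  shows "continuous_map (subtopology (Euclidean_space d) (W \<inter> \<psi> -` V)) (Euclidean_space e) (\<lambda>x. \<phi> (\<psi> x))"
proof -
  let ?W = "W \<inter> \<psi> -` V"
  have E: "?W \<subseteq> Euc d" using W_Euc by blast
  have "continuous_on ?W (\<lambda>x. \<phi> (\<psi> x))"
  proof (rule continuous_on_coordinatewise_then_product)
    fix i show "continuous_on ?W (\<lambda>x. \<phi> (\<psi> x) i)"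
    proof (cases "i < e")
      case True
      then show ?thesis using C_k_on_continuous[OF E psi_smooth[OF ch True]] by blast
    next
      case False
      then have "\<phi> (\<psi> x) i = 0" if "x \<in> ?W" for x
        using chart_psi_Euc[OF ch] that unfolding Euc_iff by (meson IntD2 not_le)
      then have "continuous_on ?W (\<lambda>x. \<phi> (\<psi> x) i) = continuous_on ?W (\<lambda>x. 0 :: real)"
        by (intro continuous_on_cong) auto
      then show ?thesis by simp
    qed
  qed
  then show ?thesis using cm_Euclidean_space_iff_continuous_on[of d ?W e "\<lambda>x. \<phi> (\<psi> x)"] E
    chart_psi_Euc[OF ch] by (auto simp: Int_absorb1)
qed

lemma chart_psi_inj: "(V, \<phi>) \<in> charts Q \<Longrightarrow> inj_on (\<lambda>x. \<phi> (\<psi> x)) (W \<inter> \<psi> -` V)"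
  using inj chart_inj unfolding inj_on_def by (metis IntE vimageE)

text \<open>A differential with trivial left kernel needs at least as many columns as rows.\<close>

lemma dim_le:
  assumes ch: "(V, \<phi>) \<in> charts Q" and x: "x \<in> W" "\<psi> x \<in> V"
  shows "e \<le> d"
proof (rule ccontr)
  assume "\<not> e \<le> d"
  then have de: "d < e" by simp
  \<comment> \<open>The Jacobian matrix is padded with zero columns to a square one. Column
    \<open>d\<close> is zero, so the unit vector at \<open>d\<close> lies in the kernel and the
    determinant vanishes; a left kernel vector of the padded matrix is one of the original.\<close>
  define J where "J = (\<lambda>i j. if j < d then partial (\<lambda>x. \<phi> (\<psi> x) i) j x else 0)"
  have "(\<Sum>j<e. J i j * (if j = d then 1 else 0)) = 0" for i
    by (rule sum.neutral) (simp add: J_def)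
  from fcof_cramer[of e J "\<lambda>j. if j = d then 1 else 0" "\<lambda>_. 0" d, OF this de]
  have "fdet e J = 0" by simp
  from fdet_zero_left_kernel[OF this]
  obtain y i where y: "i < e" "y i \<noteq> 0" "\<forall>j<e. (\<Sum>i<e. y i * J i j) = 0" by blast
  have "(\<Sum>i<e. y i * partial (\<lambda>x. \<phi> (\<psi> x) i) k x) = 0" if "k < d" for k
    using y(3)[rule_format, of k] that de by (simp add: J_def)
  from psi_left_kernel[OF ch x this y(1)] y(2) show False by contradiction
qed

text \<open>If \<open>e < d\<close>, the map in the chart is injective and continuous into
  \<open>d\<close>-space with values in the subspace where coordinate \<open>e\<close> is 0.
  Invariance of domain makes its image open in \<open>d\<close>-space, so coordinate
  \<open>e\<close> could be moved within the image, a contradiction.\<close>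

lemma dim_ge:
  assumes ch: "(V, \<phi>) \<in> charts Q" and x: "x \<in> W" "\<psi> x \<in> V"
  shows "d \<le> e"
proof (rule ccontr)
  assume "\<not> d \<le> e"
  then have ed: "e < d" by simp
  define f where "f = (\<lambda>x. \<phi> (\<psi> x))"
  define W' where "W' = W \<inter> \<psi> -` V"
  have cE: "continuous_map (subtopology (Euclidean_space d) W') (Euclidean_space e) f"
    unfolding f_def W'_def by (rule chart_psi_cont[OF ch])
  have fE: "f z \<in> Euc e" if "z \<in> W'" for z
    using that chart_psi_Euc[OF ch] unfolding f_def W'_def by blast
  have sub: "Euc e \<subseteq> Euc d" using ed by simp
  have "continuous_map (subtopology (Euclidean_space d) W') (Euclidean_space d) f"
    unfolding cm_Euclidean_space_iff_continuous_on
    using conjunct1[OF cE[unfolded cm_Euclidean_space_iff_continuous_on]]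
      subsetD[OF Pi_mono[OF sub] conjunct2[OF cE[unfolded cm_Euclidean_space_iff_continuous_on]]] by (rule conjI)
  moreover have "openin (Euclidean_space d) W'" unfolding W'_def by (rule W_chart_open[OF chart(1)[OF ch]])
  moreover have "inj_on f W'" unfolding f_def W'_def by (rule chart_psi_inj[OF ch])
  ultimately have op: "openin (Euclidean_space d) (f ` W')"
    using invariance_of_domain_Euclidean_space by blast
  have xW: "x \<in> W'" using x by (simp add: W'_def)
  have "\<forall>\<^sub>F t in nhds (f x e). (f x)(e := t) \<in> f ` W'"
    by (rule line_in_open[OF op imageI[OF xW] ed])
  then have "\<forall>\<^sub>F t in nhds (f x e). t = 0"
  proof eventually_elim
    case (elim t)
    have "f ` W' \<subseteq> Euc e" using fE by (rule image_subsetI)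
    from subsetD[OF this elim] have "(f x)(e := t) \<in> Euc e" .
    then have "\<forall>i\<ge>e. ((f x)(e := t)) i = 0" by (simp only: Euc_iff)
    from spec[OF this, of e] show ?case by simp
  qed
  moreover have "f x e = 0" using fE[OF xW] by (simp add: Euc_iff)
  ultimately have "\<forall>\<^sub>F t in nhds (0::real). t = 0" by simp
  then have "\<forall>\<^sub>F t in at (0::real). t = 0" by (rule filter_leD[OF at_within_le_nhds])
  moreover have "\<forall>\<^sub>F t in at (0::real). t \<noteq> 0" by (simp add: eventually_at_filter)
  ultimately have "\<forall>\<^sub>F t in at (0::real). False" by eventually_elim simp
  then show False by simp
qed


text \<open>Invariance of domain again, now with equal dimensions. Equality is available only when
  the chart meets the image, hence the separate empty case.\<close>

lemma chart_psi_embedding: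
  assumes ch: "(V, \<phi>) \<in> charts Q" and U: "openin (Euclidean_space d) U" "U \<subseteq> W"
  shows "openin (Euclidean_space e) ((\<lambda>x. \<phi> (\<psi> x)) ` (U \<inter> \<psi> -` V))"
proof (cases "U \<inter> \<psi> -` V = {}")
  case False
  then obtain x where "x \<in> U" "\<psi> x \<in> V" by auto
  then have "x \<in> W" "\<psi> x \<in> V" using U(2) by auto
  then have ed: "e = d" using dim_le[OF ch] dim_ge[OF ch] by (simp add: antisym)
  have sub: "U \<inter> \<psi> -` V \<subseteq> W \<inter> \<psi> -` V" using U(2) by blast
  have eq: "U \<inter> \<psi> -` V = U \<inter> (W \<inter> \<psi> -` V)" using U(2) by blast
  show ?thesis unfolding ed
  proof (rule invariance_of_domain_Euclidean_space)
    show "openin (Euclidean_space d) (U \<inter> \<psi> -` V)"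
      unfolding eq by (rule openin_Int[OF U(1) W_chart_open[OF chart(1)[OF ch]]])
    show "continuous_map (subtopology (Euclidean_space d) (U \<inter> \<psi> -` V)) (Euclidean_space d) (\<lambda>x. \<phi> (\<psi> x))"
      using continuous_map_from_subtopology_mono[OF chart_psi_cont[OF ch] sub] by (simp only: ed)
    show "inj_on (\<lambda>x. \<phi> (\<psi> x)) (U \<inter> \<psi> -` V)"
      by (rule inj_on_subset[OF chart_psi_inj[OF ch] sub])
  qed
qed simp

text \<open>Openness is local: near a point of the image, the open set found in a chart is pulled
  back by the chart map, and injectivity of the chart map keeps the preimage inside the
  image.\<close>

lemma psi_open:
  assumes U: "openin (Euclidean_space d) U" "U \<subseteq> W"
  shows "openin (mtop Q) (\<psi> ` U)"
proof (subst openin_subopen, intro ballI)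
  fix q assume "q \<in> \<psi> ` U"
  then obtain x where x: "x \<in> U" "q = \<psi> x" by (rule imageE)
  have "q \<in> topspace (mtop Q)"
    using continuous_map_image_subset_topspace[OF psi_cont] x U W_Euc by auto
  then obtain V \<phi> where ch: "(V, \<phi>) \<in> charts Q" "q \<in> V" using chart_cover by blast
  define O' where "O' = (\<lambda>x. \<phi> (\<psi> x)) ` (U \<inter> \<psi> -` V)"
  have O': "openin (Euclidean_space e) O'" unfolding O'_def by (rule chart_psi_embedding[OF ch(1) U])
  have cm: "continuous_map (subtopology (mtop Q) V) (Euclidean_space e) \<phi>"
    using homeomorphic_imp_continuous_map[OF chart(4)[OF ch(1)]]
    by (simp add: continuous_map_in_subtopology)
  have tV: "topspace (subtopology (mtop Q) V) = V" using chart(3)[OF ch(1)] by auto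
  have "openin (subtopology (mtop Q) V) {z \<in> V. \<phi> z \<in> O'}"
    using openin_continuous_map_preimage[OF cm O'] unfolding tV .
  then have "openin (mtop Q) {z \<in> V. \<phi> z \<in> O'}"
    using chart(1)[OF ch(1)] openin_trans_full by blast
  moreover have "q \<in> {z \<in> V. \<phi> z \<in> O'}" using x ch by (auto simp: O'_def)
  moreover have "{z \<in> V. \<phi> z \<in> O'} \<subseteq> \<psi> ` U"
  proof
    fix z assume z: "z \<in> {z \<in> V. \<phi> z \<in> O'}"
    then obtain u where u: "u \<in> U" "\<psi> u \<in> V" "\<phi> z = \<phi> (\<psi> u)" unfolding O'_def by auto
    then have "z = \<psi> u" using chart_inj[OF ch(1)] z unfolding inj_on_def by blast
    then show "z \<in> \<psi> ` U" using u by blast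
  qed
  ultimately show "\<exists>T. openin (mtop Q) T \<and> q \<in> T \<and> T \<subseteq> \<psi> ` U" by blast
qed

lemma image_open: "openin (mtop Q) (\<psi> ` W)"
  by (rule psi_open[OF W_open order_refl])

lemma image_subset: "\<psi> ` W \<subseteq> topspace (mtop Q)"
  by (rule openin_subset[OF image_open])

lemma psi_homeomorphic:
  "homeomorphic_map (subtopology (Euclidean_space d) W) (subtopology (mtop Q) (\<psi> ` W)) \<psi>"
proof (rule bijective_open_imp_homeomorphic_map)
  have tW: "topspace (subtopology (Euclidean_space d) W) = W" using W_Euc by auto
  have tV: "topspace (subtopology (mtop Q) (\<psi> ` W)) = \<psi> ` W" using image_subset by auto
  show "continuous_map (subtopology (Euclidean_space d) W) (subtopology (mtop Q) (\<psi> ` W)) \<psi>"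
    unfolding continuous_map_in_subtopology tW using psi_cont by blast
  show "open_map (subtopology (Euclidean_space d) W) (subtopology (mtop Q) (\<psi> ` W)) \<psi>"
    unfolding open_map_def
  proof (intro allI impI)
    fix U assume U: "openin (subtopology (Euclidean_space d) W) U"
    then have "openin (Euclidean_space d) U" "U \<subseteq> W"
      using W_open openin_trans_full openin_subset[OF U] unfolding tW by blast+
    then have "openin (mtop Q) (\<psi> ` U)" "\<psi> ` U \<subseteq> \<psi> ` W" using psi_open by blast+
    then show "openin (subtopology (mtop Q) (\<psi> ` W)) (\<psi> ` U)"
      using image_open by (simp only: openin_open_subtopology simp_thms)
  qed
  show "\<psi> ` topspace (subtopology (Euclidean_space d) W) = topspace (subtopology (mtop Q) (\<psi> ` W))"
    unfolding tW tV ..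
  show "inj_on \<psi> (topspace (subtopology (Euclidean_space d) W))"
    unfolding tW by (rule inj)
qed

lemma psi_inv_continuous:
  "continuous_map (subtopology (mtop Q) (\<psi> ` W)) (subtopology (Euclidean_space d) W) (inv_into W \<psi>)"
proof -
  have tV: "topspace (subtopology (mtop Q) (\<psi> ` W)) = \<psi> ` W" using image_subset by auto
  have tW: "topspace (subtopology (Euclidean_space d) W) = W" using W_Euc by auto
  obtain g where g: "homeomorphic_maps (subtopology (Euclidean_space d) W) (subtopology (mtop Q) (\<psi> ` W)) \<psi> g"
    using psi_homeomorphic unfolding homeomorphic_map_maps by blast
  show ?thesis
  proof (rule continuous_map_eq)
    show "continuous_map (subtopology (mtop Q) (\<psi> ` W)) (subtopology (Euclidean_space d) W) g"
      using g by (simp add: homeomorphic_maps_def)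
    fix q assume "q \<in> topspace (subtopology (mtop Q) (\<psi> ` W))"
    then obtain x where "x \<in> W" "q = \<psi> x" unfolding tV by (rule imageE)
    then show "g q = inv_into W \<psi> q"
      using g inv_into_f_f[OF inj] unfolding homeomorphic_maps_def tW by simp
  qed
qed

text \<open>In a chart meeting the image the dimensions agree, so the Jacobian matrix is square and
  its trivial left kernel makes the determinant nonzero. Continuity of the inverse, required by the
  inverse function theorem, comes from invariance of domain.\<close>

lemma psi_inv_smooth:
  assumes ch: "(V, \<phi>) \<in> charts Q" and j: "j < d"
  shows "C_k_on k e (\<phi> ` (V \<inter> \<psi> ` W)) (\<lambda>y. inv_into W \<psi> (inv_into (V \<inter> \<psi> ` W) \<phi> y) j)"
proof (cases "W \<inter> \<psi> -` V = {}")
  case True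
  then have "V \<inter> \<psi> ` W = {}" by auto
  \<comment> \<open>On the empty set any function may be exchanged for a constant one.\<close>
  moreover have "C_k_on k e {} f" for f
    using C_k_on_cong[of e "{}" f "\<lambda>_. 0" k] C_k_on_const[of e "{}" k 0] by simp
  ultimately show ?thesis by (simp only: image_empty)
next
  case False
  define W' where "W' = W \<inter> \<psi> -` V"
  define f where "f = (\<lambda>x. \<phi> (\<psi> x))"
  define G where "G = (\<lambda>y. inv_into W \<psi> (inv_into (V \<inter> \<psi> ` W) \<phi> y))"
  obtain x where "x \<in> W" "\<psi> x \<in> V" using False by auto
  then have ed: "e = d" using dim_le[OF ch] dim_ge[OF ch] by (simp add: antisym)
  have img: "\<phi> ` (V \<inter> \<psi> ` W) = f ` W'" unfolding f_def W'_def by auto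
  have W': "openin (Euclidean_space d) W'" unfolding W'_def by (rule W_chart_open[OF chart(1)[OF ch]])
  have GfW: "G (f x) = x" if "x \<in> W'" for x
  proof -
    have "inv_into (V \<inter> \<psi> ` W) \<phi> (f x) = \<psi> x" unfolding f_def
      by (rule inv_into_f_f[OF inj_on_subset[OF chart_inj[OF ch] Int_lower1]]) (use that in \<open>auto simp: W'_def\<close>)
    then show ?thesis using inv_into_f_f[OF inj, of x] that unfolding G_def W'_def by simp
  qed
  have op: "openin (Euclidean_space d) (f ` W')"
    using chart_psi_embedding[OF ch W_open order_refl] unfolding f_def W'_def ed .
  have "embedding_map (subtopology (Euclidean_space d) W') (Euclidean_space d) f"
    using invariance_of_domain_Euclidean_space_embedding_map[OF W', of f]
      chart_psi_cont[OF ch, folded W'_def f_def] chart_psi_inj[OF ch, folded W'_def f_def] by (simp only: ed)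
  moreover have tW: "topspace (subtopology (Euclidean_space d) W') = W'" using openin_subset[OF W'] by auto
  ultimately have "homeomorphic_map (subtopology (Euclidean_space d) W') (subtopology (Euclidean_space d) (f ` W')) f"
    unfolding embedding_map_def by simp
  then obtain g where g: "homeomorphic_maps (subtopology (Euclidean_space d) W') (subtopology (Euclidean_space d) (f ` W')) f g"
    unfolding homeomorphic_map_maps by blast
  then have "continuous_map (subtopology (Euclidean_space d) (f ` W')) (Euclidean_space d) g"
    by (simp add: homeomorphic_maps_def continuous_map_in_subtopology)
  then have "continuous_on (f ` W') g"
    unfolding cm_Euclidean_space_iff_continuous_on using openin_subset[OF op] by (simp add: Int_absorb1)
  moreover have "g (f x) = G (f x)" if "x \<in> W'" for x
    using g GfW[OF that] that tW unfolding homeomorphic_maps_def by simp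
  ultimately have contG: "continuous_on (f ` W') G"
    by (subst continuous_on_cong[OF refl, of _ G g]) auto
  have "C_k_on k d (f ` W') (\<lambda>y. G y j)"
  proof (rule smooth_inverse_function[OF W' op _ contG _ _ _ j])
    show "C_k_on k d W' (\<lambda>x. f x j)" if "j < d" for k j
      unfolding f_def W'_def by (rule psi_smooth[OF ch]) (simp add: ed that)
    show "G y \<in> W'" if "y \<in> f ` W'" for y using that GfW by auto
    show "f (G y) = y" if "y \<in> f ` W'" for y using that GfW by auto
    fix x assume x: "x \<in> W'"
    show "fdet d (\<lambda>i j. partial (\<lambda>x. f x i) j x) \<noteq> 0"
    proof
      assume "fdet d (\<lambda>i j. partial (\<lambda>x. f x i) j x) = 0"
      from fdet_zero_left_kernel[OF this] obtain y i where
        y: "i < d" "y i \<noteq> 0" "\<forall>j<d. (\<Sum>i<d. y i * partial (\<lambda>x. f x i) j x) = 0" by blast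
      have "y i = 0"
        by (rule psi_left_kernel[OF ch, of x]) (use x y ed in \<open>auto simp: W'_def f_def\<close>)
      then show False using y by simp
    qed
  qed
  then show ?thesis unfolding img ed G_def by simp
qed

lemma slice_diffeomorphism:
  "diffeomorphism (open_submanifold (Euclidean_mfd d) W) (open_submanifold Q (\<psi> ` W)) \<psi>"
proof -
  have tV: "topspace (subtopology (mtop Q) (\<psi> ` W)) = \<psi> ` W" using image_subset by auto
  have tW: "topspace (subtopology (Euclidean_space d) W) = W" using W_Euc by auto
  have EW: "Euc d \<inter> W = W" using W_Euc by blast
  have X: "mdim (open_submanifold (Euclidean_mfd d) W) = d"
    "mtop (open_submanifold (Euclidean_mfd d) W) = subtopology (Euclidean_space d) W"
    "charts (open_submanifold (Euclidean_mfd d) W) = {(W, \<lambda>x. x)}"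
    by (simp_all add: open_submanifold_def Euclidean_mfd_def EW)
  have Y: "mdim (open_submanifold Q (\<psi> ` W)) = e"
    "mtop (open_submanifold Q (\<psi> ` W)) = subtopology (mtop Q) (\<psi> ` W)"
    "charts (open_submanifold Q (\<psi> ` W)) = (\<lambda>(V, \<phi>). (V \<inter> \<psi> ` W, \<phi>)) ` charts Q"
    by (simp_all add: open_submanifold_def)
  have "smooth_map (open_submanifold (Euclidean_mfd d) W) (open_submanifold Q (\<psi> ` W)) \<psi>"
    unfolding smooth_map_def X Y
  proof (intro conjI ballI, goal_cases)
    case 1 show ?case by (rule homeomorphic_imp_continuous_map[OF psi_homeomorphic])
  next
    case (2 c1)
    have "smooth_on d e ((\<lambda>x. x) ` (W \<inter> \<psi> -` (V \<inter> \<psi> ` W))) (\<phi> \<circ> \<psi> \<circ> inv_into W (\<lambda>x. x))"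
      if ch: "(V, \<phi>) \<in> charts Q" for V \<phi>
    proof -
      have S: "(\<lambda>x. x) ` (W \<inter> \<psi> -` (V \<inter> \<psi> ` W)) = W \<inter> \<psi> -` V" by auto
      have inv: "inv_into W (\<lambda>x. x) x = x" if "x \<in> W" for x
        using inv_into_f_f[of "\<lambda>x. x" W x] that by simp
      have "(\<phi> \<circ> \<psi> \<circ> inv_into W (\<lambda>x. x)) x \<in> Euc e" if "x \<in> W \<inter> \<psi> -` V" for x
        using chart_psi_Euc[OF ch, of x] that inv[of x] by simp
      moreover have "C_k_on k d (W \<inter> \<psi> -` V) (\<lambda>x. (\<phi> \<circ> \<psi> \<circ> inv_into W (\<lambda>x. x)) x i)" if "i < e" for k i
        using psi_smooth[OF ch that, of k] inv
        by (subst C_k_on_cong[OF W_chart_open[OF chart(1)[OF ch]], where g = "\<lambda>x. \<phi> (\<psi> x) i"]) auto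
      ultimately show ?thesis unfolding smooth_on_def S by blast
    qed
    then show ?case using 2 by auto
  qed
  moreover have "smooth_map (open_submanifold Q (\<psi> ` W)) (open_submanifold (Euclidean_mfd d) W) (inv_into W \<psi>)"
    unfolding smooth_map_def X Y
  proof (intro conjI ballI, goal_cases)
    case 1 show ?case by (rule psi_inv_continuous)
  next
    case (2 c1)
    have "smooth_on e d (\<phi> ` ((V \<inter> \<psi> ` W) \<inter> inv_into W \<psi> -` W)) ((\<lambda>x. x) \<circ> inv_into W \<psi> \<circ> inv_into (V \<inter> \<psi> ` W) \<phi>)"
      if ch: "(V, \<phi>) \<in> charts Q" for V \<phi>
    proof -
      have S: "(V \<inter> \<psi> ` W) \<inter> inv_into W \<psi> -` W = V \<inter> \<psi> ` W"
        using inv_into_into[of _ \<psi> W] by blast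
      have "inv_into W \<psi> (inv_into (V \<inter> \<psi> ` W) \<phi> y) \<in> Euc d" if "y \<in> \<phi> ` (V \<inter> \<psi> ` W)" for y
        using inv_into_into[OF that] inv_into_into[of _ \<psi> W] W_Euc by blast
      then show ?thesis using psi_inv_smooth[OF ch] unfolding smooth_on_def S by (auto simp: o_def)
    qed
    then show ?case using 2 by auto
  qed
  moreover have "bij_betw \<psi> W (\<psi> ` W)" using inj by (rule inj_on_imp_bij_betw)
  ultimately show ?thesis unfolding diffeomorphism_def X Y tW tV by blast
qed

end

subsection \<open>The Weyr form and its centralizer\<close>

lemma offset_Suc: "j < length ws \<Longrightarrow> offset ws (Suc j) = offset ws j + ws ! j"
  by (simp add: offset_def take_Suc_conv_app_nth)

lemma offset_mono: "j \<le> j' \<Longrightarrow> offset ws j \<le> offset ws j'"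
proof (induction j' rule: dec_induct)
  case (step m)
  have "offset ws m \<le> offset ws (Suc m)"
    by (cases "m < length ws") (simp_all add: offset_Suc, simp add: offset_def)
  with step show ?case by simp
qed simp

lemma offset_Cons: "offset (x # ws) 0 = 0" "offset (x # ws) (Suc j) = x + offset ws j"
  by (simp_all add: offset_def)

lemma offset_length: "offset ws (length ws) = sum_list ws"
  by (simp add: offset_def)

lemma offset_less:
  assumes "j < length ws" "v < ws ! j"
  shows "offset ws j + v < sum_list ws"
  using offset_mono[of "Suc j" "length ws" ws] assms by (simp add: offset_Suc offset_length)

lemma block_no_offset:
  assumes "j < length ws" "v < ws ! j"
  shows "block_no ws (offset ws j + v) = j"
  unfolding block_no_def
proof (rule Least_equality)
  show "offset ws j + v < offset ws (Suc j)" using assms by (simp add: offset_Suc)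
  fix k assume "offset ws j + v < offset ws (Suc k)"
  then show "j \<le> k" using offset_mono[of "Suc k" j ws] by (cases "j \<le> k") auto
qed

lemma offset_inj:
  assumes "j < length ws" "v < ws ! j" "j' < length ws" "v' < ws ! j'"
  shows "offset ws j + v = offset ws j' + v' \<longleftrightarrow> j = j' \<and> v = v'"
  using block_no_offset[OF assms(1,2)] block_no_offset[OF assms(3,4)] by auto

lemma offset_cases:
  assumes "c < sum_list ws"
  obtains j v where "j < length ws" "v < ws ! j" "c = offset ws j + v"
proof -
  define j where "j = (LEAST j. c < offset ws (Suc j))"
  have ex: "c < offset ws (Suc (length ws))" using assms by (simp add: offset_def)
  have 1: "c < offset ws (Suc j)" unfolding j_def using ex by (rule LeastI)
  have 2: "offset ws j \<le> c"
  proof (cases j)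
    case (Suc k)
    then have "\<not> c < offset ws (Suc k)" unfolding j_def using not_less_Least by (metis lessI)
    then show ?thesis using Suc by simp
  qed (simp add: offset_def)
  have 3: "j < length ws"
  proof (rule ccontr)
    assume "\<not> j < length ws"
    then have "offset ws j = sum_list ws" by (simp add: offset_def)
    then show False using 2 assms by simp
  qed
  show thesis using that[of j "c - offset ws j"] 1 2 3 by (simp add: offset_Suc)
qed

lemma sum_lessThan_add: "(\<Sum>c<a + b. f c) = (\<Sum>c<a. f c) + (\<Sum>c<b. f (a + c))"
  for f :: "nat \<Rightarrow> 'a :: comm_monoid_add"
  by (induction b) (simp_all add: add.assoc)

lemma sum_offset:
  fixes f :: "nat \<Rightarrow> 'a :: comm_monoid_add"
  shows "(\<Sum>c<sum_list ws. f c) = (\<Sum>j<length ws. \<Sum>v<ws ! j. f (offset ws j + v))"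
proof (induction ws arbitrary: f)
  case (Cons x ws)
  have "(\<Sum>c<sum_list (x # ws). f c) = (\<Sum>c<x. f c) + (\<Sum>c<sum_list ws. f (x + c))"
    by (simp add: sum_lessThan_add)
  also have "\<dots> = (\<Sum>c<x. f c) + (\<Sum>j<length ws. \<Sum>v<ws ! j. f (x + (offset ws j + v)))"
    by (simp only: Cons)
  also have "\<dots> = (\<Sum>j<length (x # ws). \<Sum>v<(x # ws) ! j. f (offset (x # ws) j + v))"
    by (simp add: sum.lessThan_Suc_shift offset_Cons add.assoc del: sum.lessThan_Suc)
  finally show ?case .
qed simp

lemma offset_map_mult: "offset (map ((*) k) ws) j = k * offset ws j"
  by (simp add: offset_def take_map sum_list_const_mult)

lemma diag_block_mat_dim:
  "dim_row (diag_block_mat Ms) = sum_list (map dim_row Ms)"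
  "dim_col (diag_block_mat Ms) = sum_list (map dim_col Ms)"
  by (induction Ms) (auto simp: Let_def)

lemma diag_block_mat_entry:
  assumes "\<And>M. M \<in> set Ms \<Longrightarrow> dim_col M = dim_row M"
    and "i < length Ms" "a < dim_row (Ms ! i)" "j < length Ms" "b < dim_row (Ms ! j)"
  shows "diag_block_mat Ms $$ (offset (map dim_row Ms) i + a, offset (map dim_row Ms) j + b)
       = (if i = j then Ms ! i $$ (a, b) else 0)"
  using assms
proof (induction Ms arbitrary: i j)
  case (Cons M Ms)
  have sq: "map dim_col Ms = map dim_row Ms" using Cons.prems(1) by auto
  have dM: "dim_col M = dim_row M" using Cons.prems(1) by simp
  have less: "offset (map dim_row Ms) k + a < sum_list (map dim_row Ms)" if "k < length Ms" "a < dim_row (Ms ! k)" for k a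
    using offset_less[of k "map dim_row Ms" a] that by simp
  show ?case
  proof (cases i; cases j)
    fix i' j' assume ij: "i = Suc i'" "j = Suc j'"
    have "diag_block_mat Ms $$ (offset (map dim_row Ms) i' + a, offset (map dim_row Ms) j' + b)
       = (if i' = j' then Ms ! i' $$ (a, b) else 0)"
      using Cons.prems ij by (intro Cons.IH) auto
    then show ?thesis using less[of i' a] less[of j' b] Cons.prems ij dM
      by (simp add: offset_Cons diag_block_mat_dim sq Let_def)
  next
    fix j' assume ij: "i = 0" "j = Suc j'"
    then show ?thesis using less[of j' b] Cons.prems dM
      by (simp add: offset_Cons diag_block_mat_dim sq Let_def)
  next
    fix i' assume ij: "i = Suc i'" "j = 0"
    then show ?thesis using less[of i' a] Cons.prems dM
      by (simp add: offset_Cons diag_block_mat_dim sq Let_def)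
  next
    assume ij: "i = 0" "j = 0"
    then show ?thesis using Cons.prems dM
      by (simp add: offset_Cons diag_block_mat_dim Let_def)
  qed
qed simp

section \<open>Entries of the Weyr form\<close>

lemma assemble_entry:
  assumes "l < length ws" "v < ws ! l" "l' < length ws" "v' < ws ! l'"
  shows "assemble ws F $$ (offset ws l + v, offset ws l' + v') = F l l' $$ (v, v')"
  using assms by (simp add: assemble_def offset_less block_no_offset)

text \<open>The entries of the 2 by 2 block representing multiplication by \<open>z\<close>. For
  real \<open>z\<close> only the entry (0, 0) occurs, so one formula covers both kinds of
  blocks.\<close>

definition weyr_diag :: "complex \<Rightarrow> nat \<Rightarrow> nat \<Rightarrow> real" where
  "weyr_diag z e e' = (if e = e' then Re z else if e = 0 then Im z else - Im z)"

lemma eps_cases: obtains "z \<in> \<real>" "eps z = 1" | "z \<notin> \<real>" "eps z = 2"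
  by (auto simp: eps_def)

lemma weyr_block_carrier: "weyr_block z w \<in> carrier_mat (eps z * sum_list w) (eps z * sum_list w)"
  by (auto simp: weyr_block_def weyr_real_def weyr_nonreal_def assemble_def eps_def sum_list_const_mult)

text \<open>With columns numbered by level, chain and \<open>e\<close>, the off-diagonal identity
  blocks link equal \<open>v\<close> and equal \<open>e\<close> in consecutive levels. The real and
  the nonreal form thus get the same description.\<close>

lemma weyr_block_entry:
  assumes "l < length w" "v < w ! l" "l' < length w" "v' < w ! l'" "e < eps z" "e' < eps z"
  shows "weyr_block z w $$ (eps z * (offset w l + v) + e, eps z * (offset w l' + v') + e') =
    (if l = l' \<and> v = v' then weyr_diag z e e' else 0) +
    (if l' = Suc l \<and> v = v' \<and> e = e' then 1 else 0)"
proof (cases z rule: eps_cases)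
  case 1
  then show ?thesis using assms
    by (auto simp: weyr_block_def weyr_real_def assemble_entry I_rect_def weyr_diag_def)
next
  case 2
  have e: "e < 2" "e' < 2" using assms 2 by auto
  define B where "B = mat_of_rows_list 2 [[Re z, Im z], [- Im z, Re z]]"
  have B: "dim_row B = 2" "dim_col B = 2" by (auto simp: B_def mat_of_rows_list_def)
  have Be: "B $$ (e, e') = weyr_diag z e e'" if "e < 2" "e' < 2" for e e'
  proof -
    have "e = 0 \<or> e = 1" "e' = 0 \<or> e' = 1" using that by auto
    then show ?thesis by (auto simp: B_def mat_of_rows_list_def weyr_diag_def)
  qed
  have off: "offset (replicate k 2) i = 2 * i" if "i \<le> k" for i k
    using that by (simp add: offset_def take_map min_def sum_list_replicate)
  have diag: "diag_block_mat (replicate k B) $$ (2 * v + e, 2 * v' + e') = (if v = v' then weyr_diag z e e' else 0)"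
    if "v < k" "v' < k" "e < 2" "e' < 2" for k v v' e e'
    using diag_block_mat_entry[of "replicate k B" v e v' e'] that B Be by (simp add: off)
  have dimd: "dim_row (diag_block_mat (replicate k B)) = 2 * k" for k
    by (simp add: diag_block_mat_dim B sum_list_replicate)
  have idx: "eps z * (offset w l + v) + e = offset (map ((*) 2) w) l + (2 * v + e)" for l v e
    using 2 by (simp add: offset_map_mult algebra_simps)
  have "weyr_block z w $$ (offset (map ((*) 2) w) l + (2 * v + e), offset (map ((*) 2) w) l' + (2 * v' + e')) =
     (if l' = l then diag_block_mat (replicate (w ! l) B)
      else if l' = Suc l then I_rect (2 * w ! l) (2 * w ! l') else 0\<^sub>m (2 * w ! l) (2 * w ! l')) $$ (2 * v + e, 2 * v' + e')"
    using 2 assms e assemble_entry[of l "map ((*) 2) w" "2 * v + e" l' "2 * v' + e'"]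
    unfolding weyr_block_def weyr_nonreal_def B_def[symmetric] by auto
  also have "\<dots> = (if l = l' \<and> v = v' then weyr_diag z e e' else 0) +
    (if l' = Suc l \<and> v = v' \<and> e = e' then 1 else 0)"
  proof -
    have "2 * v + e = 2 * v' + e' \<longleftrightarrow> v = v' \<and> e = e'" using e by presburger
    then show ?thesis using assms e by (auto simp: diag I_rect_def)
  qed
  finally show ?thesis unfolding idx .
qed

lemma sum_lessThan_mult: "(\<Sum>c<k * m. f c) = (\<Sum>a<m. \<Sum>e<k. f (k * a + e))"
  for f :: "nat \<Rightarrow> 'a :: comm_monoid_add"
proof (induction m)
  case (Suc m)
  have "(\<Sum>c<k * Suc m. f c) = (\<Sum>c<k * m + k. f c)" by (simp add: add.commute)
  also have "\<dots> = (\<Sum>a<Suc m. \<Sum>e<k. f (k * a + e))" by (simp add: sum_lessThan_add Suc)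
  finally show ?case .
qed simp

lemma sum_eq_single:
  assumes "finite S" "a \<in> S" "\<And>x. x \<in> S \<Longrightarrow> x \<noteq> a \<Longrightarrow> f x = 0"
  shows "sum f S = (f a :: 'a :: comm_monoid_add)"
proof -
  have "sum f S = f a + sum f (S - {a})" using assms by (simp add: sum.remove)
  also have "sum f (S - {a}) = 0" using assms by (intro sum.neutral) auto
  finally show ?thesis by simp
qed

text \<open>A column of the Weyr form has the name \<open>(i, l, v, e)\<close>: block \<open>i\<close>, level \<open>l\<close> (the
  column block \<open>l + 1\<close> of the paper), chain \<open>v\<close>, and \<open>e < \<epsilon>\<^sub>i\<close>.  The vectors with fixed \<open>i\<close>
  and \<open>v\<close> form a Jordan chain.\<close>

locale weyr =
  fixes zs :: "complex list" and wc :: "complex \<Rightarrow> nat list"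
  assumes w_dec: "z \<in> set zs \<Longrightarrow> sorted_wrt (\<ge>) (wc z)"
    and zs_distinct: "i < length zs \<Longrightarrow> j < length zs \<Longrightarrow> i \<noteq> j \<Longrightarrow> zs ! i \<noteq> zs ! j"
      "i < length zs \<Longrightarrow> j < length zs \<Longrightarrow> i \<noteq> j \<Longrightarrow> zs ! i \<noteq> cnj (zs ! j)"
begin

abbreviation "q \<equiv> length zs"
abbreviation "w i \<equiv> wc (zs ! i)"
abbreviation "ep i \<equiv> eps (zs ! i)"
abbreviation "ds \<equiv> map (\<lambda>z. eps z * sum_list (wc z)) zs"
abbreviation "n \<equiv> sum_list ds"
abbreviation "A \<equiv> diag_block_mat (map (\<lambda>z. weyr_block z (wc z)) zs)"

definition gc :: "nat \<Rightarrow> nat \<Rightarrow> nat \<Rightarrow> nat \<Rightarrow> nat" where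
  "gc i l v e = offset ds i + (ep i * (offset (w i) l + v) + e)"

definition ok :: "nat \<Rightarrow> nat \<Rightarrow> nat \<Rightarrow> bool" where
  "ok i l v \<longleftrightarrow> i < q \<and> l < length (w i) \<and> v < w i ! l"

lemma okD: "ok i l v \<Longrightarrow> i < q" "ok i l v \<Longrightarrow> l < length (w i)" "ok i l v \<Longrightarrow> v < w i ! l"
  by (auto simp: ok_def)

lemma ep_pos: "0 < ep i" and ep_le: "ep i \<le> 2"
  by (auto simp: eps_def)

text \<open>The block sizes do not increase with the level, so the levels at which a chain exists
  form an initial segment.\<close>

lemma ok_mono:
  assumes "ok i l v" "l' \<le> l" shows "ok i l' v"
proof -
  have "w i ! l \<le> w i ! l'"
    using assms w_dec[of "zs ! i"] sorted_wrt_nth_less[of "(\<ge>)" "w i" l' l]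
    by (cases "l' = l") (auto simp: ok_def)
  then show ?thesis using assms by (auto simp: ok_def)
qed

lemma local_less:
  assumes "ok i l v" "e < ep i"
  shows "ep i * (offset (w i) l + v) + e < ep i * sum_list (w i)"
proof -
  have "Suc (offset (w i) l + v) \<le> sum_list (w i)" using assms offset_less by (auto simp: ok_def Suc_le_eq)
  then have "ep i * Suc (offset (w i) l + v) \<le> ep i * sum_list (w i)" by (rule mult_le_mono2)
  then show ?thesis using assms by simp
qed

lemma gc_less: "ok i l v \<Longrightarrow> e < ep i \<Longrightarrow> gc i l v e < n"
  unfolding gc_def using local_less by (intro offset_less) (auto simp: ok_def)

lemma local_inj:
  assumes "ok i l v" "e < ep i" "ok i l' v'" "e' < ep i"
  shows "ep i * (offset (w i) l + v) + e = ep i * (offset (w i) l' + v') + e' \<longleftrightarrow> l = l' \<and> v = v' \<and> e = e'"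
proof
  assume eq: "ep i * (offset (w i) l + v) + e = ep i * (offset (w i) l' + v') + e'"
  have "offset (w i) l + v = (ep i * (offset (w i) l + v) + e) div ep i"
    "offset (w i) l' + v' = (ep i * (offset (w i) l' + v') + e') div ep i" using assms by auto
  then have "offset (w i) l + v = offset (w i) l' + v'" using eq by simp
  then show "l = l' \<and> v = v' \<and> e = e'"
    using assms eq offset_inj[of l "w i" v l' v'] by (auto simp: ok_def)
qed auto

lemma gc_inj:
  assumes "ok i l v" "e < ep i" "ok i' l' v'" "e' < ep i'"
  shows "gc i l v e = gc i' l' v' e' \<longleftrightarrow> i = i' \<and> l = l' \<and> v = v' \<and> e = e'"
proof -
  have "gc i l v e = gc i' l' v' e' \<longleftrightarrow> i = i' \<and>
    ep i * (offset (w i) l + v) + e = ep i' * (offset (w i') l' + v') + e'"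
    unfolding gc_def by (rule offset_inj) (use assms local_less in \<open>auto simp: ok_def\<close>)
  then show ?thesis using local_inj assms by blast
qed

lemma local_cases:
  assumes "i < q" "a < ep i * sum_list (w i)"
  obtains l v e where "ok i l v" "e < ep i" "a = ep i * (offset (w i) l + v) + e"
proof -
  have "a div ep i < sum_list (w i)" using assms ep_pos[of i]
    by (simp add: div_less_iff_less_mult mult.commute)
  then obtain l v where "l < length (w i)" "v < w i ! l" "a div ep i = offset (w i) l + v"
    by (rule offset_cases)
  moreover have "a = ep i * (a div ep i) + a mod ep i" by simp
  ultimately show thesis using that[of l v "a mod ep i"] assms(1) ep_pos[of i] by (simp add: ok_def)
qed

lemma gc_cases:
  assumes "c < n"
  obtains i l v e where "ok i l v" "e < ep i" "c = gc i l v e"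
proof -
  from offset_cases[OF assms] obtain i a where ia: "i < length ds" "a < ds ! i" "c = offset ds i + a" .
  then have "i < q" "a < ep i * sum_list (w i)" by auto
  then show thesis
    by (rule local_cases) (rule that, auto simp: gc_def ia(3))
qed

lemma sum_gc:
  "(\<Sum>c<n. f c) = (\<Sum>i<q. \<Sum>l<length (w i). \<Sum>v<w i ! l. \<Sum>e<ep i. f (gc i l v e))"
  for f :: "nat \<Rightarrow> 'a :: comm_monoid_add"
proof -
  have "(\<Sum>c<n. f c) = (\<Sum>i<q. \<Sum>a<ep i * sum_list (w i). f (offset ds i + a))"
    by (simp add: sum_offset)
  also have "\<dots> = (\<Sum>i<q. \<Sum>l<length (w i). \<Sum>v<w i ! l. \<Sum>e<ep i. f (gc i l v e))"
    by (simp only: sum_lessThan_mult sum_offset[of _ "w _"] gc_def)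
  finally show ?thesis .
qed

lemma sum_gc_block:
  fixes f :: "nat \<Rightarrow> 'a :: comm_monoid_add"
  assumes "i < q" "\<And>i' l v e. ok i' l v \<Longrightarrow> e < ep i' \<Longrightarrow> i' \<noteq> i \<Longrightarrow> f (gc i' l v e) = 0"
  shows "(\<Sum>c<n. f c) = (\<Sum>l<length (w i). \<Sum>v<w i ! l. \<Sum>e<ep i. f (gc i l v e))"
  unfolding sum_gc by (rule sum_eq_single) (use assms in \<open>auto intro!: sum.neutral simp: ok_def\<close>)

lemma sum_gc_cell:
  fixes f :: "nat \<Rightarrow> 'a :: comm_monoid_add"
  assumes ok: "ok i l v"
    and z: "\<And>i' l' v' e. ok i' l' v' \<Longrightarrow> e < ep i' \<Longrightarrow> (i', l', v') \<noteq> (i, l, v) \<Longrightarrow> f (gc i' l' v' e) = 0"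
  shows "(\<Sum>c<n. f c) = (\<Sum>e<ep i. f (gc i l v e))"
proof -
  have "(\<Sum>c<n. f c) = (\<Sum>l<length (w i). \<Sum>v<w i ! l. \<Sum>e<ep i. f (gc i l v e))"
    by (rule sum_gc_block) (use assms in \<open>auto simp: ok_def\<close>)
  also have "\<dots> = (\<Sum>v<w i ! l. \<Sum>e<ep i. f (gc i l v e))"
    by (rule sum_eq_single) (use assms in \<open>auto intro!: sum.neutral simp: ok_def\<close>)
  also have "\<dots> = (\<Sum>e<ep i. f (gc i l v e))"
    by (rule sum_eq_single) (use assms in \<open>auto intro!: sum.neutral simp: ok_def\<close>)
  finally show ?thesis .
qed

lemma A_carrier: "A \<in> carrier_mat n n"
proof -
  have "map dim_row (map (\<lambda>z. weyr_block z (wc z)) zs) = ds" "map dim_col (map (\<lambda>z. weyr_block z (wc z)) zs) = ds"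
    using weyr_block_carrier by auto
  then show ?thesis by (intro carrier_matI) (simp_all only: diag_block_mat_dim)
qed

lemma A_block_entry:
  assumes "i < q" "a < ep i * sum_list (w i)" "j < q" "b < ep j * sum_list (w j)"
  shows "A $$ (offset ds i + a, offset ds j + b) = (if i = j then weyr_block (zs ! i) (w i) $$ (a, b) else 0)"
proof -
  have rows: "map dim_row (map (\<lambda>z. weyr_block z (wc z)) zs) = ds"
    using weyr_block_carrier by auto
  have "dim_row (weyr_block z (wc z)) = eps z * sum_list (wc z)" "dim_col (weyr_block z (wc z)) = eps z * sum_list (wc z)" for z
    using weyr_block_carrier[of z "wc z"] by auto
  note dims = this
  have sq: "dim_col M = dim_row M" if "M \<in> set (map (\<lambda>z. weyr_block z (wc z)) zs)" for M
    using that dims by auto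
  from diag_block_mat_entry[of "map (\<lambda>z. weyr_block z (wc z)) zs" i a j b, OF sq, unfolded rows]
  show ?thesis using assms dims by simp
qed

lemma A_entry:
  assumes "ok i l v" "e < ep i" "ok i' l' v'" "e' < ep i'"
  shows "A $$ (gc i l v e, gc i' l' v' e') =
    (if (i', l', v') = (i, l, v) then weyr_diag (zs ! i) e e' else 0) +
    (if (i', l', v') = (i, Suc l, v) \<and> e = e' then 1 else 0)"
  using A_block_entry[of i "ep i * (offset (w i) l + v) + e" i' "ep i' * (offset (w i') l' + v') + e'"]
    assms local_less[OF assms(1,2)] local_less[OF assms(3,4)]
    weyr_block_entry[of l "w i" v l' v' e "zs ! i" e']
  by (cases "i = i'") (auto simp: gc_def ok_def)

definition row_act :: "(nat \<Rightarrow> real) \<Rightarrow> nat \<Rightarrow> real" where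
  "row_act f c = (\<Sum>b<n. f b * A $$ (b, c))"

definition col_act :: "(nat \<Rightarrow> complex) \<Rightarrow> nat \<Rightarrow> complex" where
  "col_act y b = (\<Sum>c<n. of_real (A $$ (b, c)) * y c)"

lemma row_act_gc:
  assumes ok: "ok i l v" and e: "e < ep i"
  shows "row_act f (gc i l v e) = (\<Sum>e'<ep i. f (gc i l v e') * weyr_diag (zs ! i) e' e) +
    (if l > 0 then f (gc i (l - 1) v e) else 0)"
proof -
  \<comment> \<open>Column (i, l, v, e) of \<open>A\<close> is split into its diagonal cell
    \<open>D\<close> and the superdiagonal entry \<open>S\<close>, which sits one level lower in the
    same chain.\<close>
  define D where "D = (\<lambda>c. if \<exists>e'<ep i. c = gc i l v e' then A $$ (c, gc i l v e) else 0)"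
  define S where "S = (\<lambda>c. if l > 0 \<and> c = gc i (l - 1) v e then 1 else 0 :: real)"
  have "row_act f (gc i l v e) = (\<Sum>c<n. f c * D c + f c * S c)"
    unfolding row_act_def
  proof (rule sum.cong[OF refl])
    fix c assume "c \<in> {..<n}"
    then obtain i' l' v' e' where c: "ok i' l' v'" "e' < ep i'" "c = gc i' l' v' e'"
      using gc_cases by blast
    have "(\<exists>e'<ep i. c = gc i l v e') \<longleftrightarrow> (i', l', v') = (i, l, v)"
      using gc_inj[OF c(1,2) ok] c by auto
    moreover have "(l > 0 \<and> c = gc i (l - 1) v e) \<longleftrightarrow> (i, l, v) = (i', Suc l', v') \<and> e' = e"
      using gc_inj[OF c(1,2) ok_mono[OF ok, of "l - 1"] e] c by auto
    ultimately have "A $$ (c, gc i l v e) = D c + S c"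
      using A_entry[OF c(1,2) ok e] unfolding D_def S_def c(3) by auto
    then show "f c * A $$ (c, gc i l v e) = f c * D c + f c * S c" by (simp add: distrib_left)
  qed
  also have "\<dots> = (\<Sum>c<n. f c * D c) + (\<Sum>c<n. f c * S c)" by (rule sum.distrib)
  also have "(\<Sum>c<n. f c * D c) = (\<Sum>e'<ep i. f (gc i l v e') * D (gc i l v e'))"
    by (rule sum_gc_cell[OF ok]) (use gc_inj ok in \<open>auto simp: D_def\<close>)
  also have "\<dots> = (\<Sum>e'<ep i. f (gc i l v e') * weyr_diag (zs ! i) e' e)"
    by (rule sum.cong) (use A_entry[OF ok _ ok e] in \<open>auto simp: D_def\<close>)
  also have "(\<Sum>c<n. f c * S c) = (if l > 0 then f (gc i (l - 1) v e) else 0)"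
  proof (cases "l > 0")
    case True
    then have "(\<Sum>c<n. f c * S c) = f (gc i (l - 1) v e) * S (gc i (l - 1) v e)"
      by (intro sum_eq_single) (use gc_less[OF ok_mono[OF ok] e, of "l - 1"] in \<open>auto simp: S_def\<close>)
    then show ?thesis using True by (simp add: S_def)
  qed (simp add: S_def)
  finally show ?thesis .
qed

lemma col_act_gc:
  assumes ok: "ok i l v" and e: "e < ep i"
  shows "col_act y (gc i l v e) = (\<Sum>e'<ep i. of_real (weyr_diag (zs ! i) e e') * y (gc i l v e')) +
    (if ok i (Suc l) v then y (gc i (Suc l) v e) else 0)"
proof -
  define D where "D = (\<lambda>c. if \<exists>e'<ep i. c = gc i l v e' then A $$ (gc i l v e, c) else 0)"
  define S where "S = (\<lambda>c. if ok i (Suc l) v \<and> c = gc i (Suc l) v e then 1 else 0 :: real)"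
  have "col_act y (gc i l v e) = (\<Sum>c<n. of_real (D c) * y c + of_real (S c) * y c)"
    unfolding col_act_def
  proof (rule sum.cong[OF refl])
    fix c assume "c \<in> {..<n}"
    then obtain i' l' v' e' where c: "ok i' l' v'" "e' < ep i'" "c = gc i' l' v' e'"
      using gc_cases by blast
    have p1: "(\<exists>e'<ep i. c = gc i l v e') \<longleftrightarrow> (i', l', v') = (i, l, v)"
      using gc_inj[OF c(1,2) ok] c by auto
    have p2: "(ok i (Suc l) v \<and> c = gc i (Suc l) v e) \<longleftrightarrow> (i', l', v') = (i, Suc l, v) \<and> e' = e"
    proof (cases "ok i (Suc l) v")
      case True
      then show ?thesis using gc_inj[OF c(1,2) True e] c(3) by auto
    next
      case False
      then show ?thesis using c(1) by auto
    qed
    have "A $$ (gc i l v e, c) = D c + S c"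
      unfolding D_def S_def p1 p2 using A_entry[OF ok e c(1,2)] c(3)
      by (cases "(i', l', v') = (i, l, v)") auto
    then show "of_real (A $$ (gc i l v e, c)) * y c = of_real (D c) * y c + of_real (S c) * y c"
      by (simp add: distrib_right)
  qed
  also have "\<dots> = (\<Sum>c<n. of_real (D c) * y c) + (\<Sum>c<n. of_real (S c) * y c)" by (rule sum.distrib)
  also have "(\<Sum>c<n. of_real (D c) * y c) = (\<Sum>e'<ep i. of_real (D (gc i l v e')) * y (gc i l v e'))"
    by (rule sum_gc_cell[OF ok]) (use gc_inj ok in \<open>auto simp: D_def\<close>)
  also have "\<dots> = (\<Sum>e'<ep i. of_real (weyr_diag (zs ! i) e e') * y (gc i l v e'))"
    by (rule sum.cong) (use A_entry[OF ok e ok] in \<open>auto simp: D_def\<close>)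
  also have "(\<Sum>c<n. of_real (S c) * y c) = (if ok i (Suc l) v then y (gc i (Suc l) v e) else 0)"
  proof (cases "ok i (Suc l) v")
    case True
    then have "(\<Sum>c<n. of_real (S c) * y c) = of_real (S (gc i (Suc l) v e)) * y (gc i (Suc l) v e)"
      by (intro sum_eq_single) (use gc_less[OF True e] in \<open>auto simp: S_def\<close>)
    then show ?thesis using True by (simp add: S_def)
  qed (simp add: S_def)
  finally show ?thesis .
qed

end

section \<open>Complex coordinates and commuting matrices\<close>

definition om :: "complex \<Rightarrow> nat \<Rightarrow> complex" where
  "om \<sigma> e = (if e = 0 then 1 else \<sigma>)"

lemma sum_eps: "(\<Sum>e<eps z. f e) = (if z \<in> \<real> then f 0 else f 0 + f 1)"
  for f :: "nat \<Rightarrow> 'a :: comm_monoid_add"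
  by (auto simp: eps_def numeral_2_eq_2)

lemma less_eps_cases: "e < eps z \<Longrightarrow> e = 0 \<or> (e = 1 \<and> z \<notin> \<real>)"
  by (auto simp: eps_def split: if_splits)

text \<open>The column (1, \<i>) is an eigenvector of the 2 by 2 block for the eigenvalue
  \<open>z\<close>. Weighting by \<open>om \<i>\<close> therefore turns a pair of real coordinates
  into one complex coordinate.\<close>

lemma weyr_diag_om:
  assumes "e < eps z"
  shows "(\<Sum>e'<eps z. of_real (weyr_diag z e e') * om \<i> e') = z * om \<i> e"
  using less_eps_cases[OF assms]
  by (auto simp: sum_eps om_def weyr_diag_def complex_eq_iff complex_is_Real_iff)

text \<open>The rows (1, -\<i>) and (1, \<i>) are left eigenvectors of the block for
  \<open>z\<close> and for its conjugate. Together they separate the two coordinates.\<close>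

lemma weyr_diag_om_dual:
  assumes "e' < eps z"
  shows "(\<Sum>e<eps z. of_real (weyr_diag z e e') * om (-\<i>) e) = z * om (-\<i>) e'"
    and "(\<Sum>e<eps z. of_real (weyr_diag z e e') * om \<i> e) = cnj z * om \<i> e'"
  using less_eps_cases[OF assms]
  by (auto simp: sum_eps om_def weyr_diag_def complex_eq_iff complex_is_Real_iff)

context weyr
begin

text \<open>\<open>hat\<close> intertwines the right action of \<open>A\<close> with a lower shift plus multiplication by the
  eigenvalue; \<open>dh (- \<i>)\<close> and \<open>dh \<i>\<close> are the corresponding functionals on complex column vectors for
  the eigenvalue and its conjugate.\<close>

definition hat :: "(nat \<Rightarrow> real) \<Rightarrow> nat \<Rightarrow> nat \<Rightarrow> nat \<Rightarrow> complex" where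
  "hat f i l v = (\<Sum>e<ep i. of_real (f (gc i l v e)) * om \<i> e)"

definition dh :: "complex \<Rightarrow> (nat \<Rightarrow> complex) \<Rightarrow> nat \<Rightarrow> nat \<Rightarrow> nat \<Rightarrow> complex" where
  "dh \<sigma> y i l v = (\<Sum>e<ep i. y (gc i l v e) * om \<sigma> e)"

definition commutes :: "(nat \<Rightarrow> nat \<Rightarrow> real) \<Rightarrow> bool" where
  "commutes X \<longleftrightarrow> (\<forall>c<n. \<forall>c'<n. (\<Sum>b<n. A $$ (c, b) * X b c') = (\<Sum>b<n. X c b * A $$ (b, c')))"

lemma hat_row_act:
  assumes ok: "ok i l v"
  shows "hat (row_act f) i l v = zs ! i * hat f i l v + (if l > 0 then hat f i (l - 1) v else 0)"
proof -
  let ?S = "if l > 0 then hat f i (l - 1) v else 0"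
  have "hat (row_act f) i l v = (\<Sum>e<ep i. (\<Sum>e'<ep i. of_real (f (gc i l v e')) * (of_real (weyr_diag (zs ! i) e' e) * om \<i> e)) +
     (if l > 0 then of_real (f (gc i (l - 1) v e)) * om \<i> e else 0))"
    unfolding hat_def
    by (rule sum.cong) (auto simp: row_act_gc[OF ok] sum_distrib_right sum_distrib_left distrib_right distrib_left mult_ac)
  also have "\<dots> = (\<Sum>e<ep i. \<Sum>e'<ep i. of_real (f (gc i l v e')) * (of_real (weyr_diag (zs ! i) e' e) * om \<i> e)) + ?S"
    by (simp add: sum.distrib hat_def)
  also have "(\<Sum>e<ep i. \<Sum>e'<ep i. of_real (f (gc i l v e')) * (of_real (weyr_diag (zs ! i) e' e) * om \<i> e))
    = (\<Sum>e'<ep i. of_real (f (gc i l v e')) * (\<Sum>e<ep i. of_real (weyr_diag (zs ! i) e' e) * om \<i> e))"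
    by (subst sum.swap) (simp add: sum_distrib_left)
  also have "\<dots> = (\<Sum>e'<ep i. of_real (f (gc i l v e')) * (zs ! i * om \<i> e'))"
    by (rule sum.cong) (simp_all add: weyr_diag_om)
  also have "\<dots> = zs ! i * hat f i l v"
    by (simp add: hat_def sum_distrib_left mult_ac)
  finally show ?thesis .
qed

lemma hat_eqD:
  assumes "hat f i l v = hat g i l v" "e < ep i"
  shows "f (gc i l v e) = g (gc i l v e)"
  using assms(1) less_eps_cases[OF assms(2)]
  by (auto simp: hat_def sum_eps om_def complex_eq_iff split: if_splits)

lemma hat_cong:
  assumes "ok i l v" "\<And>c. c < n \<Longrightarrow> f c = g c"
  shows "hat f i l v = hat g i l v"
  unfolding hat_def by (rule sum.cong) (use assms gc_less in auto)

lemma hat_sum: "hat (\<lambda>c. \<Sum>b\<in>S. g b * F b c) i l v = (\<Sum>b\<in>S. of_real (g b) * hat (F b) i l v)"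
  unfolding hat_def by (simp add: sum_distrib_right sum_distrib_left mult.assoc) (rule sum.swap)

lemma dh_col_act:
  assumes ok: "ok i l v" and \<sigma>: "\<sigma> = -\<i> \<and> \<mu> = zs ! i \<or> \<sigma> = \<i> \<and> \<mu> = cnj (zs ! i)"
  shows "dh \<sigma> (col_act y) i l v = \<mu> * dh \<sigma> y i l v + (if ok i (Suc l) v then dh \<sigma> y i (Suc l) v else 0)"
proof -
  let ?S = "if ok i (Suc l) v then dh \<sigma> y i (Suc l) v else 0"
  have diag: "(\<Sum>e<ep i. of_real (weyr_diag (zs ! i) e e') * om \<sigma> e) = \<mu> * om \<sigma> e'" if "e' < ep i" for e'
    using \<sigma> weyr_diag_om_dual[OF that] by auto
  have "dh \<sigma> (col_act y) i l v = (\<Sum>e<ep i. (\<Sum>e'<ep i. y (gc i l v e') * (of_real (weyr_diag (zs ! i) e e') * om \<sigma> e)) +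
     (if ok i (Suc l) v then y (gc i (Suc l) v e) * om \<sigma> e else 0))"
    unfolding dh_def
    by (rule sum.cong) (auto simp: col_act_gc[OF ok] sum_distrib_right sum_distrib_left distrib_right distrib_left mult_ac)
  also have "\<dots> = (\<Sum>e<ep i. \<Sum>e'<ep i. y (gc i l v e') * (of_real (weyr_diag (zs ! i) e e') * om \<sigma> e)) + ?S"
    by (simp add: sum.distrib dh_def)
  also have "(\<Sum>e<ep i. \<Sum>e'<ep i. y (gc i l v e') * (of_real (weyr_diag (zs ! i) e e') * om \<sigma> e))
    = (\<Sum>e'<ep i. y (gc i l v e') * (\<Sum>e<ep i. of_real (weyr_diag (zs ! i) e e') * om \<sigma> e))"
    by (subst sum.swap) (simp add: sum_distrib_left)
  also have "\<dots> = (\<Sum>e'<ep i. y (gc i l v e') * (\<mu> * om \<sigma> e'))"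
    by (rule sum.cong) (simp_all add: diag)
  also have "\<dots> = \<mu> * dh \<sigma> y i l v"
    by (simp add: dh_def sum_distrib_left mult_ac)
  finally show ?thesis .
qed

text \<open>The complex combination of the columns (i, l, v, e) of \<open>X\<close> over
  \<open>e\<close>, viewed as a complex column vector.\<close>

definition Y :: "(nat \<Rightarrow> nat \<Rightarrow> real) \<Rightarrow> nat \<Rightarrow> nat \<Rightarrow> nat \<Rightarrow> nat \<Rightarrow> complex" where
  "Y X i l v c = hat (X c) i l v"

text \<open>The equation AX = XA read on this combination of columns: for growing \<open>l\<close>
  the vectors \<open>Y X i l v\<close> satisfy the relations of a Jordan chain of
  \<open>A\<close>.\<close>

lemma col_act_Y:
  assumes X: "commutes X" and ok: "ok i l v" and c: "c < n"
  shows "col_act (Y X i l v) c = zs ! i * Y X i l v c + (if l > 0 then Y X i (l - 1) v c else 0)"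
proof -
  have "col_act (Y X i l v) c = hat (\<lambda>c'. \<Sum>b<n. A $$ (c, b) * X b c') i l v"
    by (simp add: col_act_def Y_def hat_sum)
  also have "\<dots> = hat (row_act (X c)) i l v"
    by (rule hat_cong[OF ok]) (use X c in \<open>auto simp: commutes_def row_act_def\<close>)
  also have "\<dots> = zs ! i * Y X i l v c + (if l > 0 then Y X i (l - 1) v c else 0)"
    by (simp add: hat_row_act[OF ok] Y_def)
  finally show ?thesis .
qed

text \<open>Evaluating the functional on A times \<open>Y\<close> in two ways gives factors \<mu>
  and \<open>zs ! i\<close>, up to terms that are already 0. One such term lies one step lower in
  the chain of \<open>Y\<close>, the other one level higher in the target, hence an upward induction
  on \<open>l\<close> around a downward one on \<open>l'\<close>.\<close>

lemma dh_Y_zero: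
  assumes X: "commutes X" and \<sigma>: "\<sigma> = -\<i> \<and> \<mu> = zs ! i' \<or> \<sigma> = \<i> \<and> \<mu> = cnj (zs ! i')"
    and ne: "\<mu> \<noteq> zs ! i"
  shows "ok i l v \<Longrightarrow> ok i' l' v' \<Longrightarrow> dh \<sigma> (Y X i l v) i' l' v' = 0"
proof (induction l arbitrary: l')
  have step: "dh \<sigma> (Y X i l v) i' l' v' = 0"
    if ok: "ok i l v" and ok': "ok i' l' v'"
      and IH: "\<And>l'. l > 0 \<Longrightarrow> ok i' l' v' \<Longrightarrow> dh \<sigma> (Y X i (l - 1) v) i' l' v' = 0" for l l'
    using ok'
  proof (induction "length (w i') - l'" arbitrary: l' rule: less_induct)
    case less
    have succ: "dh \<sigma> (Y X i l v) i' (Suc l') v' = 0" if "ok i' (Suc l') v'"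
      by (rule less.hyps[OF _ that]) (use okD(2)[OF that] in simp)
    have colY: "col_act (Y X i l v) (gc i' l' v' e) =
       zs ! i * Y X i l v (gc i' l' v' e) + (if l > 0 then Y X i (l - 1) v (gc i' l' v' e) else 0)" if "e < ep i'" for e
      by (rule col_act_Y[OF X ok gc_less[OF less.prems that]])
    have "dh \<sigma> (col_act (Y X i l v)) i' l' v' =
       (\<Sum>e<ep i'. (zs ! i * Y X i l v (gc i' l' v' e) + (if l > 0 then Y X i (l - 1) v (gc i' l' v' e) else 0)) * om \<sigma> e)"
      unfolding dh_def
      by (rule sum.cong) (simp_all add: colY)
    also have "\<dots> = zs ! i * dh \<sigma> (Y X i l v) i' l' v' + (if l > 0 then dh \<sigma> (Y X i (l - 1) v) i' l' v' else 0)"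
      by (simp add: dh_def distrib_right sum.distrib sum_distrib_left mult.assoc)
    also have "(if l > 0 then dh \<sigma> (Y X i (l - 1) v) i' l' v' else 0) = 0"
      using IH[OF _ less.prems] by (cases "l > 0") auto
    also have "dh \<sigma> (col_act (Y X i l v)) i' l' v' =
        \<mu> * dh \<sigma> (Y X i l v) i' l' v' + (if ok i' (Suc l') v' then dh \<sigma> (Y X i l v) i' (Suc l') v' else 0)"
      by (rule dh_col_act[OF less.prems \<sigma>])
    also have "(if ok i' (Suc l') v' then dh \<sigma> (Y X i l v) i' (Suc l') v' else 0) = 0"
      using succ by (cases "ok i' (Suc l') v'") auto
    finally have "\<mu> * dh \<sigma> (Y X i l v) i' l' v' = zs ! i * dh \<sigma> (Y X i l v) i' l' v'"
      by simp
    then show ?case using ne by simp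
  qed
  {
    case 0
    show ?case by (rule step[OF 0]) simp
  next
    case (Suc l)
    have "ok i l v" using ok_mono[OF Suc.prems(1), of l] by simp
    then show ?case using Suc.IH by (intro step[OF Suc.prems]) simp
  }
qed

text \<open>Both functionals vanish since \<open>zs ! i\<close> differs from \<open>zs ! i'\<close>
  and from its conjugate; this uses that only one root of each conjugate pair is listed. For a
  nonreal block both combinations of the coordinate pair are then 0, hence so is the pair.\<close>

lemma Y_other:
  assumes X: "commutes X" and ok: "ok i l v" "ok i' l' v'" and e: "e < ep i'" and ne: "i' \<noteq> i"
  shows "Y X i l v (gc i' l' v' e) = 0"
proof -
  have z: "zs ! i' \<noteq> zs ! i" "cnj (zs ! i') \<noteq> zs ! i"
    using zs_distinct(1)[OF okD(1)[OF ok(2)] okD(1)[OF ok(1)] ne]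
      zs_distinct(2)[OF okD(1)[OF ok(1)] okD(1)[OF ok(2)] ne[symmetric]] by auto
  have "dh (-\<i>) (Y X i l v) i' l' v' = 0" by (rule dh_Y_zero[OF X _ z(1) ok]) simp
  moreover have "dh \<i> (Y X i l v) i' l' v' = 0" by (rule dh_Y_zero[OF X _ z(2) ok]) simp
  ultimately show ?thesis using less_eps_cases[OF e]
    by (auto simp: dh_def sum_eps om_def split: if_splits)
qed

definition xi :: "(nat \<Rightarrow> nat \<Rightarrow> real) \<Rightarrow> nat \<Rightarrow> nat \<Rightarrow> nat \<Rightarrow> nat \<Rightarrow> nat \<Rightarrow> complex" where
  "xi X i l' v' l v = Y X i l v (gc i l' v' 0)"

text \<open>Within a nonreal block the functional for the conjugate eigenvalue still vanishes, which
  forces the coordinate pair to be a multiple of (1, \<i>): a commuting matrix acts complex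
  linearly.\<close>

lemma Y_same:
  assumes X: "commutes X" and ok: "ok i l v" "ok i l' v'" and e: "e < ep i"
  shows "Y X i l v (gc i l' v' e) = xi X i l' v' l v * om \<i> e"
proof (cases "e = 0")
  case False
  then have e1: "e = 1" "zs ! i \<notin> \<real>" using less_eps_cases[OF e] by auto
  then have z: "cnj (zs ! i) \<noteq> zs ! i" by (simp add: Reals_cnj_iff)
  have "dh \<i> (Y X i l v) i l' v' = 0" by (rule dh_Y_zero[OF X _ z ok]) simp
  then have "Y X i l v (gc i l' v' 0) + Y X i l v (gc i l' v' 1) * \<i> = 0"
    using e1 by (simp add: dh_def sum_eps om_def)
  then have "Y X i l v (gc i l' v' 1) = \<i> * Y X i l v (gc i l' v' 0)"
    by (auto simp: complex_eq_iff)
  then show ?thesis using e1 by (simp add: xi_def om_def)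
qed (simp add: xi_def om_def)

text \<open>After the eigenvalue cancels, commutation compares the two shifts. The coefficients are
  constant along diagonals and vanish where exactly one of the two shifts leaves the chain.\<close>

lemma xi_toeplitz:
  assumes X: "commutes X" and ok: "ok i l v" "ok i l' v'"
  shows "(if ok i (Suc l') v' then xi X i (Suc l') v' l v else 0) = (if l > 0 then xi X i l' v' (l - 1) v else 0)"
proof -
  have "col_act (Y X i l v) (gc i l' v' 0) =
     (\<Sum>e'<ep i. of_real (weyr_diag (zs ! i) 0 e') * (xi X i l' v' l v * om \<i> e')) +
     (if ok i (Suc l') v' then xi X i (Suc l') v' l v else 0)"
    unfolding col_act_gc[OF ok(2) ep_pos] by (simp add: Y_same[OF X ok] flip: xi_def)
  also have "(\<Sum>e'<ep i. of_real (weyr_diag (zs ! i) 0 e') * (xi X i l' v' l v * om \<i> e'))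
     = xi X i l' v' l v * (\<Sum>e'<ep i. of_real (weyr_diag (zs ! i) 0 e') * om \<i> e')"
    by (simp add: sum_distrib_left mult_ac)
  also have "(\<Sum>e'<ep i. of_real (weyr_diag (zs ! i) 0 e') * om \<i> e') = zs ! i"
    by (simp only: weyr_diag_om[OF ep_pos]) (simp add: om_def)
  finally show ?thesis
    using col_act_Y[OF X ok(1) gc_less[OF ok(2) ep_pos]]
    by (cases l) (simp_all flip: xi_def)
qed

text \<open>In complex coordinates, right multiplication by a commuting matrix is multiplication by
  the complex matrix \<open>xi\<close> inside each block, with no mixing of blocks.\<close>

lemma hat_times:
  assumes X: "commutes X" and ok: "ok i l v"
  shows "hat (\<lambda>c. \<Sum>b<n. p b * X b c) i l v =
    (\<Sum>l'<length (w i). \<Sum>v'<w i ! l'. hat p i l' v' * xi X i l' v' l v)"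
proof -
  have "hat (\<lambda>c. \<Sum>b<n. p b * X b c) i l v = (\<Sum>b<n. of_real (p b) * Y X i l v b)"
    by (simp add: hat_sum Y_def)
  also have "\<dots> = (\<Sum>l'<length (w i). \<Sum>v'<w i ! l'. \<Sum>e<ep i. of_real (p (gc i l' v' e)) * Y X i l v (gc i l' v' e))"
    by (rule sum_gc_block[OF okD(1)[OF ok]]) (simp add: Y_other[OF X ok])
  also have "\<dots> = (\<Sum>l'<length (w i). \<Sum>v'<w i ! l'. hat p i l' v' * xi X i l' v' l v)"
  proof (intro sum.cong refl)
    fix l' v' assume "l' \<in> {..<length (w i)}" "v' \<in> {..<w i ! l'}"
    then have ok': "ok i l' v'" using okD(1)[OF ok] by (simp add: ok_def)
    show "(\<Sum>e<ep i. of_real (p (gc i l' v' e)) * Y X i l v (gc i l' v' e)) = hat p i l' v' * xi X i l' v' l v"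
      by (simp add: Y_same[OF X ok ok'] hat_def sum_distrib_right sum_distrib_left mult_ac)
  qed
  finally show ?thesis .
qed

end

section \<open>The triangular system along a Jordan chain\<close>

lemma square_system_solvable:
  fixes S :: "nat \<Rightarrow> nat \<Rightarrow> 'a :: field"
  assumes inj: "\<And>t. (\<forall>u<m. (\<Sum>u'<m. S u u' * t u') = 0) \<Longrightarrow> \<forall>u'<m. t u' = 0"
  shows "\<exists>t. \<forall>u<m. (\<Sum>u'<m. S u u' * t u') = g u"
proof -
  define M where "M = mat m m (\<lambda>(u, u'). S u u')"
  have M: "M \<in> carrier_mat m m" by (simp add: M_def)
  have mult: "(M *\<^sub>v v) $ u = (\<Sum>u'<m. S u u' * v $ u')" if "u < m" "v \<in> carrier_vec m" for u v
    using that by (simp add: M_def scalar_prod_def atLeast0LessThan)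
  have "Determinant.det M \<noteq> 0"
  proof
    assume "Determinant.det M = 0"
    then obtain v where v: "v \<in> carrier_vec m" "v \<noteq> 0\<^sub>v m" "M *\<^sub>v v = 0\<^sub>v m"
      using det_0_iff_vec_prod_zero[OF M] by blast
    have "\<forall>u<m. (\<Sum>u'<m. S u u' * v $ u') = 0" using mult[OF _ v(1)] v(3) by simp
    from inj[OF this] have "v = 0\<^sub>v m" using v(1) by (intro eq_vecI) auto
    then show False using v(2) by simp
  qed
  define t where "t = (adj_mat M *\<^sub>v vec m (\<lambda>u. g u / Determinant.det M))"
  have t: "t \<in> carrier_vec m" using adj_mat(1)[OF M] by (simp add: t_def)
  have "M *\<^sub>v t = (M * adj_mat M) *\<^sub>v vec m (\<lambda>u. g u / Determinant.det M)"
    unfolding t_def by (rule assoc_mult_mat_vec[symmetric, OF M adj_mat(1)[OF M]]) simp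
  also have "\<dots> = vec m g"
    using \<open>Determinant.det M \<noteq> 0\<close>
    by (intro eq_vecI) (simp_all add: adj_mat(2)[OF M] scalar_prod_def if_distrib[of "\<lambda>x. x * _"] if_distrib[of "\<lambda>x. x / _"] if_distrib[of "\<lambda>x. _ * x"] cong: if_cong)
  finally have "\<forall>u<m. (\<Sum>u'<m. S u u' * t $ u') = g u" using mult[OF _ t] by (metis index_vec)
  then show ?thesis by blast
qed

lemma down_closed_eq_lessThan:
  fixes S :: "nat set"
  assumes "finite S" "\<And>l l'. l \<in> S \<Longrightarrow> l' \<le> l \<Longrightarrow> l' \<in> S"
  shows "S = {..<card S}"
proof (cases "S = {}")
  case False
  then have "Max S \<in> S" using assms(1) by simp
  then have "S = {..Max S}" using assms(2) Max_ge[OF assms(1)] by blast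
  then have "S = {..<Suc (Max S)}" by (simp add: lessThan_Suc_atMost)
  then show ?thesis by (metis card_lessThan)
qed simp

context weyr
begin

text \<open>The length of the Jordan chain \<open>(i, v)\<close>; its levels are those below this
  number.\<close>

definition hgt :: "nat \<Rightarrow> nat \<Rightarrow> nat" where
  "hgt i v = card {l. ok i l v}"

lemma ok_iff_hgt: "ok i l v \<longleftrightarrow> l < hgt i v"
proof -
  have "finite {l. ok i l v}" by (rule finite_subset[of _ "{..<length (w i)}"]) (auto simp: ok_def)
  then have "{l. ok i l v} = {..<hgt i v}"
    unfolding hgt_def by (rule down_closed_eq_lessThan) (auto intro: ok_mono)
  then show ?thesis by auto
qed

lemma hgt_le: "i < q \<Longrightarrow> hgt i v \<le> length (w i)"
  using card_mono[of "{..<length (w i)}" "{l. ok i l v}"] by (auto simp: hgt_def ok_def)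

text \<open>Nonsingularity of the complex corners of sizes \<open>w i ! s\<close> in level 0. This
  is all that the chart conditions contribute to the linear system.\<close>

definition row_inj :: "(nat \<Rightarrow> nat \<Rightarrow> real) \<Rightarrow> (nat \<Rightarrow> nat \<Rightarrow> nat) \<Rightarrow> bool" where
  "row_inj P I \<longleftrightarrow> (\<forall>i<q. \<forall>s<length (w i). \<forall>t.
     (\<forall>u<w i ! s. (\<Sum>u'<w i ! s. hat (P (I i u)) i 0 u' * t u') = 0) \<longrightarrow> (\<forall>u'<w i ! s. t u' = 0))"

text \<open>If \<open>x\<close> describes the image of the top vector of a chain under X, this is
  the complex entry of PX in row \<open>I i u\<close> and in the column \<open>s\<close> steps below
  the top of that chain.\<close>

definition chain_eq :: "(nat \<Rightarrow> nat \<Rightarrow> real) \<Rightarrow> (nat \<Rightarrow> nat \<Rightarrow> nat) \<Rightarrow> nat \<Rightarrow> (nat \<Rightarrow> nat \<Rightarrow> complex) \<Rightarrow> nat \<Rightarrow> nat \<Rightarrow> complex" where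
  "chain_eq P I i x s u = (\<Sum>l'<length (w i). \<Sum>u'<w i ! l'. hat (P (I i u)) i l' u' * x (l' + s) u')"

text \<open>Block triangularity: when \<open>x\<close> vanishes above level \<open>s\<close>,
  equation \<open>s\<close> retains only the summand \<open>l' = 0\<close>, whose matrix is the
  corner of size \<open>w i ! s\<close>.\<close>

lemma level_sum:
  assumes ok: "i < q" "s < length (w i)"
    and x: "\<And>l u. \<not> ok i l u \<Longrightarrow> x l u = 0" "\<And>l u. s < l \<Longrightarrow> x l u = 0"
  shows "chain_eq P I i x s u = (\<Sum>u'<w i ! s. hat (P (I i u)) i 0 u' * x s u')"
proof -
  have le: "w i ! s \<le> w i ! 0"
  proof (cases "w i ! s")
    case (Suc k)
    then have "ok i s k" using ok by (simp add: ok_def)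
    then have "ok i 0 k" by (rule ok_mono) simp
    then show ?thesis using Suc by (simp add: ok_def)
  qed simp
  have "chain_eq P I i x s u = (\<Sum>u'<w i ! 0. hat (P (I i u)) i 0 u' * x (0 + s) u')"
    unfolding chain_eq_def by (rule sum_eq_single) (use ok x in auto)
  also have "\<dots> = (\<Sum>u'<w i ! s. hat (P (I i u)) i 0 u' * x s u')"
    unfolding add_0 by (rule sum.mono_neutral_right) (use le x(1)[of s] in \<open>auto simp: ok_def\<close>)
  finally show ?thesis .
qed

text \<open>Back substitution from the highest level downwards; at each level the remaining system
  is a nonsingular corner.\<close>

lemma chain_unique:
  assumes P: "row_inj P I" and i: "i < q" and h: "h \<le> length (w i)"
    and x: "\<And>l u. \<not> (ok i l u \<and> l < h) \<Longrightarrow> x l u = 0"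
    and eq: "\<And>s u. s < h \<Longrightarrow> u < w i ! s \<Longrightarrow> chain_eq P I i x s u = 0"
  shows "x l u = 0"
proof (induction "h - l" arbitrary: l u rule: less_induct)
  case less
  show ?case
  proof (cases "ok i l u \<and> l < h")
    case True
    have hi: "x l' u' = 0" if "l < l'" for l' u'
      using less[of l' u'] x[of l' u'] that True by (cases "l' < h") auto
    have "\<forall>u<w i ! l. (\<Sum>u'<w i ! l. hat (P (I i u)) i 0 u' * x l u') = 0"
    proof (intro allI impI)
      fix u assume u: "u < w i ! l"
      have "chain_eq P I i x l u = (\<Sum>u'<w i ! l. hat (P (I i u)) i 0 u' * x l u')"
        by (rule level_sum[OF i]) (use True h x hi in auto)
      then show "(\<Sum>u'<w i ! l. hat (P (I i u)) i 0 u' * x l u') = 0" using eq[of l u] u True by simp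
    qed
    moreover have "l < length (w i)" using True by (simp add: ok_def)
    ultimately have "\<forall>u'<w i ! l. x l u' = 0"
      using P[unfolded row_inj_def, rule_format, OF i, of l "x l"] by blast
    then show ?thesis using True okD(3) by blast
  qed (rule x)
qed

text \<open>The same back substitution, now constructing the solution. The auxiliary statement for
  \<open>m\<close> says that the top \<open>m\<close> levels are solved and the lower ones are still
  0.\<close>

lemma chain_exists:
  assumes P: "row_inj P I" and i: "i < q" and h: "h \<le> length (w i)"
  shows "\<exists>x. (\<forall>l u. \<not> (ok i l u \<and> l < h) \<longrightarrow> x l u = 0) \<and>
    (\<forall>s u. s < h \<longrightarrow> u < w i ! s \<longrightarrow> chain_eq P I i x s u = g s u)"
proof -
  have "\<exists>x. (\<forall>l u. \<not> (ok i l u \<and> h - m \<le> l \<and> l < h) \<longrightarrow> x l u = 0) \<and>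
    (\<forall>s u. h - m \<le> s \<longrightarrow> s < h \<longrightarrow> u < w i ! s \<longrightarrow> chain_eq P I i x s u = g s u)" if "m \<le> h" for m
    using that
  proof (induction m)
    case 0
    show ?case by (rule exI[of _ "\<lambda>_ _. 0"]) auto
  next
    case (Suc m)
    then have "m \<le> h" by simp
    from Suc.IH[OF this] obtain x where x0: "\<forall>l u. \<not> (ok i l u \<and> h - m \<le> l \<and> l < h) \<longrightarrow> x l u = 0"
      "\<forall>s u. h - m \<le> s \<longrightarrow> s < h \<longrightarrow> u < w i ! s \<longrightarrow> chain_eq P I i x s u = g s u" by blast
    note x = x0[rule_format]
    define s where "s = h - Suc m"
    have s: "s < h" "s < length (w i)" "h - m = Suc s" using Suc.prems h by (auto simp: s_def)
    have "\<exists>t. \<forall>u<w i ! s. (\<Sum>u'<w i ! s. hat (P (I i u)) i 0 u' * t u') = g s u - chain_eq P I i x s u"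
    proof (rule square_system_solvable)
      fix t assume "\<forall>u<w i ! s. (\<Sum>u'<w i ! s. hat (P (I i u)) i 0 u' * t u') = 0"
      with P[unfolded row_inj_def, THEN spec[of _ i]] i s(2) show "\<forall>u'<w i ! s. t u' = 0" by blast
    qed
    then obtain t where t: "\<And>u. u < w i ! s \<Longrightarrow> (\<Sum>u'<w i ! s. hat (P (I i u)) i 0 u' * t u') = g s u - chain_eq P I i x s u"
      by blast
    \<comment> \<open>A correction supported in level \<open>s\<close>. It leaves the equations with
      larger index untouched, because those only see levels above \<open>s\<close>.\<close>
    define d where "d = (\<lambda>l u. if l = s \<and> ok i l u then t u else 0)"
    define y where "y = (\<lambda>l u. x l u + d l u)"
    have add: "chain_eq P I i y s' u = chain_eq P I i x s' u + chain_eq P I i d s' u" for s' u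
      by (simp add: chain_eq_def y_def distrib_left sum.distrib)
    have "\<forall>l u. \<not> (ok i l u \<and> h - Suc m \<le> l \<and> l < h) \<longrightarrow> y l u = 0"
    proof (intro allI impI)
      fix l u assume *: "\<not> (ok i l u \<and> h - Suc m \<le> l \<and> l < h)"
      then have "x l u = 0" using x(1)[of l u] by auto
      moreover have "d l u = 0" using * s unfolding d_def s_def by auto
      ultimately show "y l u = 0" by (simp add: y_def)
    qed
    moreover have "chain_eq P I i y s' u = g s' u" if "h - Suc m \<le> s'" "s' < h" "u < w i ! s'" for s' u
    proof (cases "s' = s")
      case True
      have "chain_eq P I i d s u = (\<Sum>u'<w i ! s. hat (P (I i u)) i 0 u' * d s u')"
        by (rule level_sum[OF i s(2)]) (auto simp: d_def)
      also have "\<dots> = (\<Sum>u'<w i ! s. hat (P (I i u)) i 0 u' * t u')"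
        by (rule sum.cong) (use i s in \<open>auto simp: d_def ok_def\<close>)
      finally show ?thesis using t that True by (simp add: add)
    next
      case False
      then have "s < s'" using that(1) by (simp add: s_def)
      then have "chain_eq P I i d s' u = 0" unfolding chain_eq_def d_def by simp
      then show ?thesis using x(2)[of s' u] that \<open>s < s'\<close> s by (simp add: add)
    qed
    ultimately show ?case by blast
  qed
  from this[of h] show ?thesis by auto
qed

text \<open>The Toeplitz relation determines all columns of a chain from the one at its top. The
  second part records that a chain of length h maps only into levels below h.\<close>

lemma xi_shift:
  fixes i v :: nat
  assumes X: "commutes X"
  defines "x \<equiv> (\<lambda>l u. if ok i l u then xi X i l u (hgt i v - 1) v else 0)"
  shows "s < hgt i v \<Longrightarrow> ok i l u \<Longrightarrow> xi X i l u (hgt i v - 1 - s) v = x (l + s) u"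
    and "hgt i v \<le> l \<Longrightarrow> 0 < hgt i v \<Longrightarrow> x l u = 0"
proof -
  have A: "xi X i l u (hgt i v - 1 - s) v = x (l + s) u" if "s < hgt i v" "ok i l u" for s l
    using that
  proof (induction s arbitrary: l)
    case (Suc s)
    have ok: "ok i (hgt i v - 1 - s) v" using Suc.prems by (simp add: ok_iff_hgt)
    have "xi X i l u (hgt i v - 1 - s - 1) v = (if ok i (Suc l) u then xi X i (Suc l) u (hgt i v - 1 - s) v else 0)"
      using xi_toeplitz[OF X ok Suc.prems(2)] Suc.prems(1) by simp
    also have "\<dots> = x (l + Suc s) u"
    proof (cases "ok i (Suc l) u")
      case True
      then show ?thesis using Suc.IH[OF _ True] Suc.prems(1) by simp
    next
      case False
      then have "\<not> ok i (l + Suc s) u" using ok_mono[of i "l + Suc s" u "Suc l"] by auto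
      then show ?thesis using False by (simp add: x_def)
    qed
    finally show ?case by simp
  qed (simp add: x_def)
  then show "s < hgt i v \<Longrightarrow> ok i l u \<Longrightarrow> xi X i l u (hgt i v - 1 - s) v = x (l + s) u" .
  assume h: "hgt i v \<le> l" "0 < hgt i v"
  show "x l u = 0"
  proof (cases "ok i l u")
    case True
    define l' where "l' = l - hgt i v"
    have ok': "ok i l' u" "ok i (Suc l') u" using ok_mono[OF True] h by (auto simp: l'_def)
    \<comment> \<open>At the bottom of the source chain nothing can be shifted in, so every
      coefficient of positive target level is 0. Moving \<open>hgt i v - 1\<close> steps along the
      diagonal carries this to level \<open>l\<close>.\<close>
    have "ok i 0 v" using h by (simp add: ok_iff_hgt)
    from xi_toeplitz[OF X this ok'(1)] have "xi X i (Suc l') u 0 v = 0" using ok'(2) by simp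
    then show ?thesis using A[of "hgt i v - 1" "Suc l'"] ok' h by (simp add: l'_def)
  qed (simp add: x_def)
qed

text \<open>The entries assumed zero in level \<open>l\<close> of a chain are the equations with
  \<open>s = hgt i v - 1 - l\<close>. Over all levels of the chain they form the complete
  homogeneous triangular system for the image of its top vector.\<close>

theorem commutant_unique:
  fixes P :: "nat \<Rightarrow> nat \<Rightarrow> real"
  assumes P: "row_inj P I" and X: "commutes X"
    and z: "\<And>i l v u. ok i l v \<Longrightarrow> u < w i ! (hgt i v - 1 - l) \<Longrightarrow> hat (\<lambda>c. \<Sum>b<n. P (I i u) b * X b c) i l v = 0"
    and c: "c < n" "c' < n"
  shows "X c c' = 0"
proof -
  from c(2) obtain i l v e where k: "ok i l v" "e < ep i" "c' = gc i l v e" by (rule gc_cases)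
  note i = okD(1)[OF k(1)]
  define h where "h = hgt i v"
  have lh: "l < h" using k(1) by (simp add: ok_iff_hgt h_def)
  define x where "x = (\<lambda>l u. if ok i l u then xi X i l u (hgt i v - 1) v else 0)"
  have shift: "xi X i l u (h - 1 - s) v = x (l + s) u" if "s < h" "ok i l u" for l u s
    using xi_shift(1)[OF X, where i = i and v = v and s = s and l = l and u = u] that
    by (simp add: x_def h_def)
  have high: "x l u = 0" if "h \<le> l" for l u
    using xi_shift(2)[OF X, where i = i and v = v and l = l and u = u] that lh
    by (simp add: x_def h_def)
  have "x l' u' = 0" for l' u'
  proof (rule chain_unique[OF P i hgt_le[OF i, of v]])
    fix l u assume "\<not> (ok i l u \<and> l < hgt i v)"
    then show "x l u = 0" using high[of l u] by (auto simp: x_def h_def)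
  next
    fix s u assume s: "s < hgt i v" "u < w i ! s"
    have ok: "ok i (h - 1 - s) v" using s by (simp add: ok_iff_hgt h_def)
    have "h - 1 - (h - 1 - s) = s" using s by (simp add: h_def)
    then have "0 = hat (\<lambda>c. \<Sum>b<n. P (I i u) b * X b c) i (h - 1 - s) v"
      using z[OF ok, of u] s by (simp add: h_def)
    also have "\<dots> = chain_eq P I i x s u"
      unfolding hat_times[OF X ok] chain_eq_def
      by (intro sum.cong refl) (use s shift i in \<open>auto simp: h_def ok_def\<close>)
    finally show "chain_eq P I i x s u = 0" by simp
  qed
  then have xi0: "xi X i l' u' l v = 0" if "ok i l' u'" for l' u'
    using shift[of "h - 1 - l" l' u'] that lh by simp
  from c(1) obtain i' l' v' e' where k': "ok i' l' v'" "e' < ep i'" "c = gc i' l' v' e'" by (rule gc_cases)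
  have "Y X i l v c = 0"
    using Y_other[OF X k(1) k'(1,2)] Y_same[OF X k(1), of l' v' e'] xi0 k' by (cases "i' = i") auto
  then have "hat (X c) i l v = hat (\<lambda>_. 0) i l v" by (simp add: Y_def hat_def)
  from hat_eqD[OF this k(2)] show ?thesis by (simp add: k(3))
qed


definition key :: "nat \<Rightarrow> nat \<times> nat \<times> nat \<times> nat" where
  "key c = (SOME (i, l, v, e). ok i l v \<and> e < ep i \<and> c = gc i l v e)"

lemma key_gc:
  assumes "ok i l v" "e < ep i"
  shows "key (gc i l v e) = (i, l, v, e)"
  unfolding key_def
proof (rule some_equality)
  show "case (i, l, v, e) of (i', l', v', e') \<Rightarrow> ok i' l' v' \<and> e' < ep i' \<and> gc i l v e = gc i' l' v' e'"
    using assms by simp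
  fix k assume "case k of (i', l', v', e') \<Rightarrow> ok i' l' v' \<and> e' < ep i' \<and> gc i l v e = gc i' l' v' e'"
  then show "k = (i, l, v, e)" using gc_inj[OF assms] by (auto split: prod.splits)
qed

text \<open>\<open>x i v\<close> is the image of the top vector of the chain \<open>(i, v)\<close>; the images of the other
  vectors of the chain are obtained by lowering the level.\<close>

definition chain_mat :: "(nat \<Rightarrow> nat \<Rightarrow> nat \<Rightarrow> nat \<Rightarrow> complex) \<Rightarrow> nat \<Rightarrow> nat \<Rightarrow> real" where
  "chain_mat x b c = (case key b of (i', l', u, e') \<Rightarrow> case key c of (i, l, v, e) \<Rightarrow>
     if i' = i then
       let z = x i v (l' + (hgt i v - 1 - l)) u * om \<i> e' in if e = 0 then Re z else Im z
     else 0)"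

text \<open>A real block stores only real parts, so reading the complex coefficient back requires it
  to be real; in a nonreal block real and imaginary part occupy the two columns.\<close>

lemma Y_chain_mat:
  assumes real: "\<forall>l u. zs ! i \<in> \<real> \<longrightarrow> x i v l u \<in> \<real>"
    and ok: "ok i l v" "ok i' l' u" and e: "e < ep i'"
  shows "Y (chain_mat x) i l v (gc i' l' u e) =
    (if i' = i then x i v (l' + (hgt i v - 1 - l)) u * om \<i> e else 0)"
proof (cases "i' = i")
  case False
  then show ?thesis using ok e
    by (simp add: Y_def hat_def chain_mat_def key_gc)
next
  case True
  define z where "z = x i v (l' + (hgt i v - 1 - l)) u * om \<i> e"
  have "Y (chain_mat x) i l v (gc i' l' u e) = (\<Sum>e'<ep i. of_real (if e' = 0 then Re z else Im z) * om \<i> e')"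
    unfolding Y_def hat_def
    by (rule sum.cong) (use True ok e in \<open>auto simp: chain_mat_def key_gc z_def Let_def\<close>)
  also have "\<dots> = z"
  proof (cases "zs ! i \<in> \<real>")
    case real': True
    then have "z \<in> \<real>" using real real' less_eps_cases[OF e] True by (auto simp: z_def om_def)
    then show ?thesis using real' by (simp add: sum_eps om_def)
  next
    case False
    then show ?thesis by (simp add: sum_eps om_def complex_eq_iff)
  qed
  finally show ?thesis using True by (simp add: z_def)
qed

lemma commutes_chain_mat:
  assumes real: "\<And>i v. \<forall>l u. zs ! i \<in> \<real> \<longrightarrow> x i v l u \<in> \<real>"
    and supp: "\<And>i v l u. i < q \<Longrightarrow> \<not> (ok i l u \<and> l < hgt i v) \<Longrightarrow> x i v l u = 0"
  shows "commutes (chain_mat x)"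
  unfolding commutes_def
proof (intro allI impI)
  let ?X = "chain_mat x"
  fix c c' assume "c < n" "c' < n"
  from \<open>c' < n\<close> obtain i l v e where k: "ok i l v" "e < ep i" "c' = gc i l v e" by (rule gc_cases)
  from \<open>c < n\<close> obtain i' l' u e' where k': "ok i' l' u" "e' < ep i'" "c = gc i' l' u e'" by (rule gc_cases)
  note YX = Y_chain_mat[of i x v, OF real]
  have lh: "l < hgt i v" using k(1) by (simp add: ok_iff_hgt)
  have "hat (\<lambda>c'. \<Sum>b<n. A $$ (c, b) * ?X b c') i l v = col_act (Y ?X i l v) c"
    by (simp add: col_act_def Y_def hat_sum)
  also have "\<dots> = zs ! i * Y ?X i l v c + (if l > 0 then Y ?X i (l - 1) v c else 0)"
  proof (cases "i' = i")
    case False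
    have "Y ?X i (l - 1) v c = 0" if "l > 0"
      unfolding k'(3) by (subst YX[OF ok_mono[OF k(1)] k'(1,2)]) (use False in auto)
    moreover have "col_act (Y ?X i l v) c = 0"
      unfolding k'(3) col_act_gc[OF k'(1,2)] using False k'
      by (auto simp: YX[OF k(1) k'(1)] YX[OF k(1)])
    ultimately show ?thesis using False by (simp add: k'(3) YX[OF k(1) k'(1,2)])
  next
    case True
    define s where "s = hgt i v - 1 - l"
    have k'': "ok i l' u" "e' < ep i" using k' True by auto
    have col: "col_act (Y ?X i l v) c = (\<Sum>e''<ep i. of_real (weyr_diag (zs ! i) e' e'') * (x i v (l' + s) u * om \<i> e''))
      + (if ok i (Suc l') u then x i v (Suc l' + s) u * om \<i> e' else 0)"
      unfolding k'(3) True col_act_gc[OF k''] using k''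
      by (simp add: YX[OF k(1) k''(1)] YX[OF k(1)] s_def)
    have d: "(\<Sum>e''<ep i. of_real (weyr_diag (zs ! i) e' e'') * (x i v (l' + s) u * om \<i> e'')) = zs ! i * (x i v (l' + s) u * om \<i> e')"
    proof -
      have "(\<Sum>e''<ep i. of_real (weyr_diag (zs ! i) e' e'') * (x i v (l' + s) u * om \<i> e''))
        = x i v (l' + s) u * (\<Sum>e''<ep i. of_real (weyr_diag (zs ! i) e' e'') * om \<i> e'')"
        by (simp add: sum_distrib_left mult_ac)
      then show ?thesis by (simp add: weyr_diag_om[OF k''(2)])
    qed
    \<comment> \<open>The boundary cases agree by the support condition: beyond the target chain,
      and at the bottom \<open>l = 0\<close> of the source chain, where the shifted level would
      reach \<open>hgt i v\<close>.\<close>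
    have sh: "(if ok i (Suc l') u then x i v (Suc l' + s) u * om \<i> e' else 0) = (if l > 0 then Y ?X i (l - 1) v c else 0)"
    proof (cases "l > 0")
      case l: True
      have "l' + (hgt i v - 1 - (l - 1)) = Suc l' + s" using l lh by (simp add: s_def)
      then have "Y ?X i (l - 1) v c = x i v (Suc l' + s) u * om \<i> e'"
        unfolding k'(3) True using YX[OF ok_mono[OF k(1), of "l - 1"] k''] by simp
      moreover have "x i v (Suc l' + s) u = 0" if "\<not> ok i (Suc l') u"
        using supp[OF okD(1)[OF k(1)], of "Suc l' + s" u v] that ok_mono[of i "Suc l' + s" u "Suc l'"] by auto
      ultimately show ?thesis using l by auto
    next
      case False
      then have "hgt i v \<le> Suc l' + s" using lh by (simp add: s_def)
      then show ?thesis using supp[OF okD(1)[OF k(1)], of "Suc l' + s" u v] False by auto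
    qed
    show ?thesis unfolding col d sh by (simp add: k'(3) True YX[OF k(1) k''] s_def)
  qed
  also have "\<dots> = hat (row_act (?X c)) i l v"
    by (simp add: hat_row_act[OF k(1)] Y_def)
  finally have "hat (\<lambda>c'. \<Sum>b<n. A $$ (c, b) * ?X b c') i l v = hat (row_act (?X c)) i l v" .
  from hat_eqD[OF this k(2)] show "(\<Sum>b<n. A $$ (c, b) * ?X b c') = (\<Sum>b<n. ?X c b * A $$ (b, c'))"
    by (simp add: k(3) row_act_def)
qed

text \<open>The triangular systems for different chains are independent, so their solutions assemble
  into one commuting matrix.\<close>

theorem commutant_exists:
  fixes P G :: "nat \<Rightarrow> nat \<Rightarrow> real"
  assumes P: "row_inj P I"
  shows "\<exists>X. commutes X \<and> (\<forall>i l v u. ok i l v \<longrightarrow> u < w i ! (hgt i v - 1 - l) \<longrightarrow>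
    hat (\<lambda>c. \<Sum>b<n. P (I i u) b * X b c) i l v = hat (G (I i u)) i l v)"
proof -
  define g where "g = (\<lambda>i v s u. hat (G (I i u)) i (hgt i v - 1 - s) v)"
  have "\<exists>x. (\<forall>l u. \<not> (ok i l u \<and> l < hgt i v) \<longrightarrow> x l u = 0) \<and> (zs ! i \<in> \<real> \<longrightarrow> (\<forall>l u. x l u \<in> \<real>)) \<and>
    (\<forall>s u. s < hgt i v \<longrightarrow> u < w i ! s \<longrightarrow> chain_eq P I i x s u = g i v s u)" if i: "i < q" for i v
  proof -
    obtain x0 where x0: "\<forall>l u. \<not> (ok i l u \<and> l < hgt i v) \<longrightarrow> x0 l u = 0"
      "\<forall>s u. s < hgt i v \<longrightarrow> u < w i ! s \<longrightarrow> chain_eq P I i x0 s u = g i v s u"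
      using chain_exists[OF P i hgt_le[OF i, of v], of "g i v"] by blast
    show ?thesis
    proof (cases "zs ! i \<in> \<real>")
      case False
      then show ?thesis using x0 by blast
    next
      case True
      have hatR: "hat f i l u = of_real (Re (hat f i l u))" for f l u
        using True by (simp add: hat_def sum_eps om_def)
      \<comment> \<open>For a real eigenvalue all data of the system are real, so the real part of a
        solution is again a solution. Only real coefficients can be stored in a real block.\<close>
      define x where "x = (\<lambda>l u. complex_of_real (Re (x0 l u)))"
      have "chain_eq P I i x s u = of_real (Re (chain_eq P I i x0 s u))" for s u
        unfolding chain_eq_def
        by (subst (1 2) hatR) (simp add: x_def)
      then have "chain_eq P I i x s u = g i v s u" if "s < hgt i v" "u < w i ! s" for s u
        using x0(2) that hatR[of "G (I i u)" "hgt i v - 1 - s" v] by (simp add: g_def)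
      moreover have "\<not> (ok i l u \<and> l < hgt i v) \<longrightarrow> x l u = 0" for l u using x0(1) by (auto simp: x_def)
      moreover have "x l u \<in> \<real>" for l u by (simp add: x_def)
      ultimately show ?thesis by blast
    qed
  qed
  then obtain x1 where x1: "\<And>i v. i < q \<Longrightarrow> (\<forall>l u. \<not> (ok i l u \<and> l < hgt i v) \<longrightarrow> x1 i v l u = 0) \<and> (zs ! i \<in> \<real> \<longrightarrow> (\<forall>l u. x1 i v l u \<in> \<real>)) \<and>
    (\<forall>s u. s < hgt i v \<longrightarrow> u < w i ! s \<longrightarrow> chain_eq P I i (x1 i v) s u = g i v s u)"
    by metis
  \<comment> \<open>The default 0 for block numbers out of range makes the realness condition hold
    for every \<open>i\<close>.\<close>
  define x where "x = (\<lambda>i. if i < q then x1 i else (\<lambda>_ _ _. 0))"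
  have real: "\<forall>l u. zs ! i \<in> \<real> \<longrightarrow> x i v l u \<in> \<real>" for i v using x1 by (simp add: x_def)
  have supp: "i < q \<Longrightarrow> \<not> (ok i l u \<and> l < hgt i v) \<Longrightarrow> x i v l u = 0" for i v l u using x1 by (simp add: x_def)
  have X: "commutes (chain_mat x)" by (rule commutes_chain_mat[OF real supp])
  have "hat (\<lambda>c. \<Sum>b<n. P (I i u) b * chain_mat x b c) i l v = hat (G (I i u)) i l v"
    if ok: "ok i l v" and u: "u < w i ! (hgt i v - 1 - l)" for i l v u
  proof -
    note i = okD(1)[OF ok]
    have lh: "l < hgt i v" using ok by (simp add: ok_iff_hgt)
    have "hat (\<lambda>c. \<Sum>b<n. P (I i u) b * chain_mat x b c) i l v = chain_eq P I i (x i v) (hgt i v - 1 - l) u"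
      unfolding hat_times[OF X ok] chain_eq_def
    proof (intro sum.cong refl)
      fix l' u' assume "l' \<in> {..<length (w i)}" "u' \<in> {..<w i ! l'}"
      then have ok': "ok i l' u'" using i by (simp add: ok_def)
      show "hat (P (I i u)) i l' u' * xi (chain_mat x) i l' u' l v =
        hat (P (I i u)) i l' u' * x i v (l' + (hgt i v - 1 - l)) u'"
        by (simp add: xi_def Y_chain_mat[of i x v, OF real ok ok' ep_pos] om_def)
    qed
    also have "\<dots> = g i v (hgt i v - 1 - l) u"
      using x1[OF i] u lh i by (simp add: x_def)
    also have "\<dots> = hat (G (I i u)) i l v" using lh by (simp add: g_def)
    finally show ?thesis .
  qed
  with X show ?thesis by blast
qed

end

subsection \<open>Matrices of reduced shape\<close>

text \<open>The pairs \<open>(u, c)\<close> such that the entry in row \<open>I ! u\<close> and column \<open>c\<close> is prescribed,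
  where \<open>I\<close> is the longest index sequence.\<close>

definition prescribed_idx :: "complex \<Rightarrow> nat list \<Rightarrow> (nat \<times> nat) set" where
  "prescribed_idx z w = {(u, eps z * offset w (j - 1) + v) | j a b u v.
        j \<in> {1..length w} \<and> a \<in> {1..length w} \<and> b \<in> {1..length w - j + 1} \<and> a \<le> b + j - 1 \<and>
        u \<in> {tau w (a - 1)..<tau w a} \<and> v \<in> {eps z * tau w (b - 1)..<eps z * tau w b}}"

text \<open>For \<open>j = 1\<close> and for \<open>j \<ge> 2\<close> the two bounds on
  \<open>b\<close> are the same inequality \<open>a \<le> b + j - 1\<close> once
  \<open>b \<ge> 1\<close>.\<close>

lemma prescribed_pos_eq:
  "prescribed_pos z w Is = (\<lambda>(u, c). (idx Is (length w) ! u, c)) ` prescribed_idx z w"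
proof -
  have iff: "(if j = 1 then a \<le> b else max (a + 1 - j) 1 \<le> b) \<longleftrightarrow> a \<le> b + j - 1"
    if "j \<ge> 1" "b \<ge> 1" for a b j :: nat using that by auto
  show ?thesis
  proof (rule subset_antisym; rule subsetI)
    fix p assume "p \<in> prescribed_pos z w Is"
    then obtain j a b u v where p: "p = (idx Is (length w) ! u, eps z * offset w (j - 1) + v)"
      "j \<in> {1..length w}" "a \<in> {1..length w}" "b \<in> {1..length w - j + 1}"
      "if j = 1 then a \<le> b else max (a + 1 - j) 1 \<le> b"
      "u \<in> {tau w (a - 1)..<tau w a}" "v \<in> {eps z * tau w (b - 1)..<eps z * tau w b}"
      unfolding prescribed_pos_def by blast
    then have "a \<le> b + j - 1" using iff[of j b a] by (simp only: atLeastAtMost_iff)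
    with p have "(u, eps z * offset w (j - 1) + v) \<in> prescribed_idx z w"
      unfolding prescribed_idx_def by blast
    then show "p \<in> (\<lambda>(u, c). (idx Is (length w) ! u, c)) ` prescribed_idx z w"
      by (rule rev_image_eqI) (simp add: p(1))
  next
    fix p assume "p \<in> (\<lambda>(u, c). (idx Is (length w) ! u, c)) ` prescribed_idx z w"
    then obtain u c where p: "p = (idx Is (length w) ! u, c)" "(u, c) \<in> prescribed_idx z w" by auto
    then obtain j a b v where *: "c = eps z * offset w (j - 1) + v"
      "j \<in> {1..length w}" "a \<in> {1..length w}" "b \<in> {1..length w - j + 1}" "a \<le> b + j - 1"
      "u \<in> {tau w (a - 1)..<tau w a}" "v \<in> {eps z * tau w (b - 1)..<eps z * tau w b}"
      unfolding prescribed_idx_def by blast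
    then have "if j = 1 then a \<le> b else max (a + 1 - j) 1 \<le> b" using iff[of j b a] by (simp only: atLeastAtMost_iff)
    with * show "p \<in> prescribed_pos z w Is" unfolding p(1) *(1) prescribed_pos_def by blast
  qed
qed

lemma tau_0: "tau w 0 = 0" by (simp add: tau_def)

lemma tau_level: "l < length w \<Longrightarrow> tau w (length w - l) = w ! l"
  by (auto simp: tau_def)

lemma tau_mono:
  assumes "sorted_wrt (\<ge>) w" "j \<le> j'" "j' \<le> length w"
  shows "tau w j \<le> tau w j'"
  using assms sorted_wrt_nth_less[OF assms(1), of "length w - j'" "length w - j"]
  by (cases "j = j'") (auto simp: tau_def)

lemma tau_bracket:
  assumes "u < tau w k"
  obtains a where "1 \<le> a" "a \<le> k" "tau w (a - 1) \<le> u" "u < tau w a"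
proof -
  define a where "a = (LEAST a. u < tau w a)"
  have 1: "u < tau w a" unfolding a_def using assms by (rule LeastI)
  have 2: "a \<le> k" unfolding a_def using assms by (rule Least_le)
  have 3: "a \<noteq> 0"
  proof
    assume "a = 0"
    then show False using 1 by (simp add: tau_0)
  qed
  then have "\<not> u < tau w (a - 1)" unfolding a_def by (intro not_less_Least) simp
  then show thesis using that[of a] 1 2 3 by simp
qed

context weyr
begin

lemma dec: "i < q \<Longrightarrow> sorted_wrt (\<ge>) (w i)" using w_dec by simp

lemma w_le_0: "i < q \<Longrightarrow> l < length (w i) \<Longrightarrow> w i ! l \<le> w i ! 0"
  using sorted_wrt_nth_less[OF dec, of i 0 l] by (cases "l = 0") auto

text \<open>The column groups indexed by \<open>b\<close> collect the chains of equal length, the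
  longest first.\<close>

lemma hgt_bracket:
  assumes i: "i < q" and b: "1 \<le> b" "b \<le> length (w i)" and v: "tau (w i) (b - 1) \<le> v" "v < tau (w i) b"
  shows "hgt i v = length (w i) - b + 1"
proof -
  have "ok i (length (w i) - b) v" using i b v by (auto simp: ok_def tau_def)
  moreover have "\<not> ok i (length (w i) - b + 1) v"
  proof
    assume ok: "ok i (length (w i) - b + 1) v"
    then have "b \<noteq> 1" using b by (auto simp: ok_def)
    then have "tau (w i) (b - 1) = w i ! (length (w i) - b + 1)" using b by (auto simp: tau_def Suc_diff_le)
    then show False using ok v by (simp add: ok_def)
  qed
  ultimately show ?thesis by (simp add: ok_iff_hgt)
qed

text \<open>The translation from blocks to chains. With \<open>l = j - 1\<close> and
  \<open>v\<close> in group \<open>b\<close>, the row groups \<open>a \<le> b + j - 1\<close>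
  together are the rows below \<open>tau (w i) (b + j - 1)\<close>, and this number is the block
  size at level \<open>hgt i v - 1 - l\<close>.\<close>

lemma prescribed_idx_iff:
  assumes i: "i < q"
  shows "(u, c) \<in> prescribed_idx (zs ! i) (w i) \<longleftrightarrow>
    (\<exists>l v e. ok i l v \<and> e < ep i \<and> u < w i ! (hgt i v - 1 - l) \<and> c = ep i * (offset (w i) l + v) + e)"
    (is "?L \<longleftrightarrow> ?R")
proof
  assume ?L
  then obtain j a b v where *: "j \<in> {1..length (w i)}" "a \<in> {1..length (w i)}" "b \<in> {1..length (w i) - j + 1}"
    "a \<le> b + j - 1" "u \<in> {tau (w i) (a - 1)..<tau (w i) a}"
    "v \<in> {ep i * tau (w i) (b - 1)..<ep i * tau (w i) b}" "c = ep i * offset (w i) (j - 1) + v"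
    unfolding prescribed_idx_def by blast
  define v' where "v' = v div ep i"
  define e where "e = v mod ep i"
  have v: "v = ep i * v' + e" "e < ep i" using ep_pos[of i] by (simp_all add: v'_def e_def)
  have br: "tau (w i) (b - 1) \<le> v'" "v' < tau (w i) b"
    using *(6) ep_pos[of i] by (simp_all add: v'_def less_eq_div_iff_mult_less_eq div_less_iff_less_mult mult.commute)
  have h: "hgt i v' = length (w i) - b + 1" using hgt_bracket[OF i _ _ br] * by auto
  have ok: "ok i (j - 1) v'" using * by (auto simp: ok_iff_hgt h)
  have "u < tau (w i) (b + j - 1)"
  proof -
    have "b + j - 1 \<le> length (w i)" using *(1,3) by auto
    from tau_mono[OF dec[OF i] *(4) this] show ?thesis using *(5) by simp
  qed
  also have "b + j - 1 = length (w i) - (hgt i v' - 1 - (j - 1))" using * h by auto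
  also have "tau (w i) \<dots> = w i ! (hgt i v' - 1 - (j - 1))"
    by (rule tau_level) (use * h in auto)
  finally have "u < w i ! (hgt i v' - 1 - (j - 1))" .
  moreover have "c = ep i * (offset (w i) (j - 1) + v') + e" using *(7) v(1) by (simp add: distrib_left)
  ultimately show ?R using ok v(2) by blast
next
  assume ?R
  then obtain l v e where *: "ok i l v" "e < ep i" "u < w i ! (hgt i v - 1 - l)"
    "c = ep i * (offset (w i) l + v) + e" by blast
  have lh: "l < hgt i v" using *(1) by (simp add: ok_iff_hgt)
  note hl = hgt_le[OF i, of v]
  have "ok i (hgt i v - 1) v" using lh by (simp add: ok_iff_hgt)
  then have "v < tau (w i) (length (w i) - (hgt i v - 1))" by (simp add: tau_level ok_def)
  then obtain b where b: "1 \<le> b" "b \<le> length (w i) - (hgt i v - 1)" "tau (w i) (b - 1) \<le> v" "v < tau (w i) b"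
    by (rule tau_bracket)
  have hb: "hgt i v = length (w i) - b + 1" by (rule hgt_bracket[OF i _ _ b(3,4)]) (use b in auto)
  have "u < tau (w i) (length (w i) - (hgt i v - 1 - l))"
    using *(3) lh hl by (subst tau_level) auto
  then obtain a where a: "1 \<le> a" "a \<le> length (w i) - (hgt i v - 1 - l)" "tau (w i) (a - 1) \<le> u" "u < tau (w i) a"
    by (rule tau_bracket)
  have f1: "ep i * tau (w i) (b - 1) \<le> ep i * v + e" using b(3) by (simp add: trans_le_add1)
  have f2: "ep i * v + e < ep i * tau (w i) b"
  proof -
    have "ep i * Suc v \<le> ep i * tau (w i) b" using b(4) by (intro mult_le_mono2) simp
    then show ?thesis using *(2) by simp
  qed
  have f3: "c = ep i * offset (w i) (Suc l - 1) + (ep i * v + e)" using *(4) by (simp add: distrib_left)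
  have f4: "Suc l \<in> {1..length (w i)}" "a \<in> {1..length (w i)}" "b \<in> {1..length (w i) - Suc l + 1}" "a \<le> b + Suc l - 1"
    using a b lh hl hb by auto
  show ?L unfolding prescribed_idx_def mem_Collect_eq
    by (rule exI[of _ "Suc l"], rule exI[of _ a], rule exI[of _ b], rule exI[of _ u], rule exI[of _ "ep i * v + e"])
       (use a f1 f2 f3 f4 in simp)
qed

lemma prescribed_idx_less:
  assumes "i < q" "(u, c) \<in> prescribed_idx (zs ! i) (w i)"
  shows "u < w i ! 0" "c < ep i * sum_list (w i)"
proof -
  obtain l v e where *: "ok i l v" "e < ep i" "u < w i ! (hgt i v - 1 - l)"
    "c = ep i * (offset (w i) l + v) + e" using assms prescribed_idx_iff by blast
  have "hgt i v - 1 - l < length (w i)" using hgt_le[OF assms(1), of v] * by (auto simp: ok_iff_hgt)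
  then have "ok i (hgt i v - 1 - l) u" using * assms(1) by (simp add: ok_def)
  then have "ok i 0 u" by (rule ok_mono) simp
  then show "u < w i ! 0" by (simp add: ok_def)
  show "c < ep i * sum_list (w i)" using local_less[OF *(1,2)] *(4) by simp
qed

text \<open>Summing chain by chain allows the levels of each chain to be reversed, which replaces
  \<open>w i ! (hgt i v - 1 - l)\<close> by \<open>w i ! l\<close>. Summing level by level again
  gives squares.\<close>

lemma card_prescribed_idx:
  assumes i: "i < q"
  shows "card (prescribed_idx (zs ! i) (w i)) = ep i * (\<Sum>l<length (w i). (w i ! l)\<^sup>2)"
proof -
  define S where "S = (SIGMA l:{..<length (w i)}. SIGMA v:{..<w i ! l}. {..<ep i} \<times> {..<w i ! (hgt i v - 1 - l)})"
  define F where "F = (\<lambda>(l, v, e, u :: nat). (u, ep i * (offset (w i) l + v) + e))"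
  have ok: "ok i l v" if "l < length (w i)" "v < w i ! l" for l v using that i by (simp add: ok_def)
  have "prescribed_idx (zs ! i) (w i) = F ` S"
  proof (intro Set.set_eqI iffI)
    fix p assume "p \<in> prescribed_idx (zs ! i) (w i)"
    then obtain u c l v e where "p = (u, c)" "ok i l v" "e < ep i" "u < w i ! (hgt i v - 1 - l)"
      "c = ep i * (offset (w i) l + v) + e" using prescribed_idx_iff[OF i] by (metis surj_pair)
    then show "p \<in> F ` S" by (intro image_eqI[of _ _ "(l, v, e, u)"]) (auto simp: F_def S_def ok_def)
  next
    fix p assume "p \<in> F ` S"
    then obtain l v e u where "p = (u, ep i * (offset (w i) l + v) + e)" "ok i l v" "e < ep i"
      "u < w i ! (hgt i v - 1 - l)" using ok by (auto simp: F_def S_def)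
    then show "p \<in> prescribed_idx (zs ! i) (w i)" using prescribed_idx_iff[OF i] by blast
  qed
  moreover have "inj_on F S"
  proof (rule inj_onI)
    fix p p' assume pp: "p \<in> S" "p' \<in> S" "F p = F p'"
    obtain l v e u l' v' e' u' where p: "p = (l, v, e, u)" "p' = (l', v', e', u')" by (metis surj_pair)
    have "ok i l v" "ok i l' v'" "e < ep i" "e' < ep i" using pp p ok by (auto simp: S_def)
    then show "p = p'" using local_inj[of i l v e l' v' e'] pp(3) p by (auto simp: F_def)
  qed
  ultimately have "card (prescribed_idx (zs ! i) (w i)) = card S" by (simp add: card_image)
  also have "\<dots> = (\<Sum>l<length (w i). \<Sum>v<w i ! l. ep i * w i ! (hgt i v - 1 - l))"
    unfolding S_def by (simp add: card_SigmaI)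
  also have "\<dots> = (\<Sum>l<length (w i). \<Sum>v<w i ! 0. if ok i l v then ep i * w i ! (hgt i v - 1 - l) else 0)"
  proof (rule sum.cong[OF refl])
    fix l assume l: "l \<in> {..<length (w i)}"
    then show "(\<Sum>v<w i ! l. ep i * w i ! (hgt i v - 1 - l)) =
      (\<Sum>v<w i ! 0. if ok i l v then ep i * w i ! (hgt i v - 1 - l) else 0)"
      using w_le_0[OF i, of l] i by (intro sum.mono_neutral_cong_left) (auto simp: ok_def)
  qed
  also have "\<dots> = (\<Sum>v<w i ! 0. \<Sum>l<length (w i). if ok i l v then ep i * w i ! (hgt i v - 1 - l) else 0)"
    by (rule sum.swap)
  also have "\<dots> = (\<Sum>v<w i ! 0. \<Sum>l<length (w i). if ok i l v then ep i * w i ! l else 0)"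
  proof (rule sum.cong[OF refl])
    fix v
    have A: "(\<Sum>l<length (w i). if ok i l v then f l else 0) = (\<Sum>l<hgt i v. f l)" for f :: "nat \<Rightarrow> nat"
      using hgt_le[OF i, of v] by (intro sum.mono_neutral_cong_right) (auto simp: ok_iff_hgt)
    have "(\<Sum>l<hgt i v. ep i * w i ! (hgt i v - 1 - l)) = (\<Sum>l<hgt i v. ep i * w i ! l)"
      using sum.nat_diff_reindex[of "\<lambda>l. ep i * w i ! l" "hgt i v"] by simp
    then show "(\<Sum>l<length (w i). if ok i l v then ep i * w i ! (hgt i v - 1 - l) else 0) =
      (\<Sum>l<length (w i). if ok i l v then ep i * w i ! l else 0)" unfolding A .
  qed
  also have "\<dots> = (\<Sum>l<length (w i). \<Sum>v<w i ! 0. if ok i l v then ep i * w i ! l else 0)"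
    by (rule sum.swap)
  also have "\<dots> = (\<Sum>l<length (w i). ep i * (w i ! l)\<^sup>2)"
  proof (rule sum.cong[OF refl])
    fix l assume l: "l \<in> {..<length (w i)}"
    then have "(\<Sum>v<w i ! 0. if ok i l v then ep i * w i ! l else 0) = (\<Sum>v<w i ! l. ep i * w i ! l)"
      using w_le_0[OF i, of l] i by (intro sum.mono_neutral_cong_right) (auto simp: ok_def)
    then show "(\<Sum>v<w i ! 0. if ok i l v then ep i * w i ! l else 0) = ep i * (w i ! l)\<^sup>2"
      by (simp add: power2_eq_square)
  qed
  finally show ?thesis by (simp add: sum_distrib_left)
qed

end

section \<open>Invertibility, kernels and rank of matrices\<close>

lemma index_mult_mat_sum:
  assumes "P \<in> carrier_mat a b" "Q \<in> carrier_mat b c" "i < a" "j < c"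
  shows "(P * Q) $$ (i, j) = (\<Sum>k<b. P $$ (i, k) * Q $$ (k, j))"
  using assms by (simp add: scalar_prod_def atLeast0LessThan)

lemma invertible_mat_iff_det:
  fixes M :: "'a :: field mat"
  assumes M: "M \<in> carrier_mat m m"
  shows "invertible_mat M \<longleftrightarrow> Determinant.det M \<noteq> 0"
proof
  assume "invertible_mat M"
  then obtain B where B: "M * B = 1\<^sub>m (dim_row M)" "B * M = 1\<^sub>m (dim_row B)"
    unfolding invertible_mat_def inverts_mat_def by blast
  have "dim_col B = m" using arg_cong[OF B(1), of dim_col] M by simp
  moreover have "dim_row B = m" using arg_cong[OF B(2), of dim_col] M by simp
  ultimately have Bc: "B \<in> carrier_mat m m" by (intro carrier_matI)
  have "Determinant.det M * Determinant.det B = 1"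
    unfolding det_mult[OF M Bc, symmetric] B(1) using M by simp
  then show "Determinant.det M \<noteq> 0" by auto
next
  assume nz: "Determinant.det M \<noteq> 0"
  define B where "B = (1 / Determinant.det M) \<cdot>\<^sub>m adj_mat M"
  have B: "B \<in> carrier_mat m m" using adj_mat(1)[OF M] by (simp add: B_def)
  have "M * B = 1\<^sub>m m"
    unfolding B_def mult_smult_distrib[OF M adj_mat(1)[OF M]] adj_mat(2)[OF M] using nz
    by (intro eq_matI) auto
  moreover from mat_mult_left_right_inverse[OF M B this] have "B * M = 1\<^sub>m m" .
  ultimately show "invertible_mat M"
    unfolding invertible_mat_def inverts_mat_def using M B by auto
qed

lemma invertible_mat_kernel:
  fixes M :: "'a :: field mat"
  assumes M: "M \<in> carrier_mat m m" and "invertible_mat M"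
    and y: "\<And>i. i < m \<Longrightarrow> (\<Sum>j<m. M $$ (i, j) * y j) = 0" and j: "j < m"
  shows "y j = 0"
proof -
  have "M *\<^sub>v vec m y = 0\<^sub>v m"
    by (rule eq_vecI) (use M y in \<open>auto simp: scalar_prod_def atLeast0LessThan\<close>)
  moreover have "Determinant.det M \<noteq> 0" using assms invertible_mat_iff_det by blast
  ultimately have "vec m y = 0\<^sub>v m"
    using det_0_iff_vec_prod_zero[OF M] by (metis vec_carrier)
  then show ?thesis using j by (metis index_vec index_zero_vec(1))
qed

lemma trivial_kernel_rank:
  fixes M :: "'a :: field mat"
  assumes M: "M \<in> carrier_mat m k" and inj: "\<And>v. v \<in> carrier_vec k \<Longrightarrow> M *\<^sub>v v = 0\<^sub>v m \<Longrightarrow> v = 0\<^sub>v k"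
  shows "vec_space.rank m M = k"
proof -
  interpret vec_space "TYPE('a)" m .
  have dist: "distinct (cols M)"
  proof (subst distinct_conv_nth, intro allI impI notI)
    fix a b assume ab: "a < length (cols M)" "b < length (cols M)" "a \<noteq> b" "cols M ! a = cols M ! b"
    \<comment> \<open>Two equal columns would put a difference of unit vectors into the kernel.
      Distinctness is needed first because the rank criterion speaks of the set of columns.\<close>
    define v where "v = vec k (\<lambda>j. (if j = a then 1 else 0) - (if j = b then 1 else 0 :: 'a))"
    have "M *\<^sub>v v = 0\<^sub>v m"
    proof (rule eq_vecI)
      fix i assume i: "i < dim_vec (0\<^sub>v m)"
      have "(M *\<^sub>v v) $ i = (\<Sum>j<k. M $$ (i, j) * ((if j = a then 1 else 0) - (if j = b then 1 else 0)))"
        using M i by (simp add: v_def scalar_prod_def atLeast0LessThan)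
      also have "\<dots> = M $$ (i, a) - M $$ (i, b)"
        using ab M by (simp add: right_diff_distrib sum_subtractf if_distrib[of "\<lambda>x. _ * x"] cong: if_cong)
      also have "\<dots> = col M a $ i - col M b $ i" using ab(1,2) M i by simp
      also have "col M a = col M b" using ab by simp
      also have "col M b $ i - col M b $ i = 0" by simp
      finally show "(M *\<^sub>v v) $ i = 0\<^sub>v m $ i" using i by simp
    qed (use M in simp)
    then have "v = 0\<^sub>v k" by (intro inj) (simp add: v_def)
    then have "v $ a = 0" using ab M by simp
    then show False using ab M by (simp add: v_def)
  qed
  have "lin_indpt (set (cols M))"
  proof
    assume "lin_dep (set (cols M))"
    then show False using lin_depE[OF M _ dist] inj by metis
  qed
  then show ?thesis by (rule lin_indpt_full_rank[OF M dist])
qed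

section \<open>Stacked matrices and their first block\<close>

definition rebuild :: "real mat \<Rightarrow> nat list \<Rightarrow> real mat \<Rightarrow> real mat" where
  "rebuild M rs F = mat (sum_list rs) (dim_row M)
     (\<lambda>(a, c). (F * M ^\<^sub>m block_no rs a) $$ (a - offset rs (block_no rs a), c))"

locale row_partition =
  fixes rs :: "nat list"
  assumes rs: "rs \<noteq> []" "sorted_wrt (\<ge>) rs" "\<forall>x\<in>set rs. x > 0"
begin

lemma rs_le: "l < length rs \<Longrightarrow> rs ! l \<le> hd rs"
  using rs sorted_wrt_nth_less[OF rs(2), of 0 l] by (cases "l = 0") (auto simp: hd_conv_nth)

lemma hd_le: "hd rs \<le> sum_list rs"
  using rs(1) by (cases rs) auto

definition first :: "real mat \<Rightarrow> real mat" where
  "first P = block P 0 (hd rs) 0 (dim_col P)"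

lemma first_index: "u < hd rs \<Longrightarrow> c < dim_col P \<Longrightarrow> first P $$ (u, c) = P $$ (u, c)"
  by (simp add: first_def block_def)

lemma first_carrier: "first P \<in> carrier_mat (hd rs) (dim_col P)"
  by (simp add: first_def block_def)

lemma stacked_iff:
  assumes M: "M \<in> carrier_mat d d"
  shows "stacked M rs P \<longleftrightarrow> P \<in> carrier_mat (sum_list rs) d \<and>
    (\<forall>l<length rs. \<forall>u<rs ! l. \<forall>c<d. P $$ (offset rs l + u, c) = (first P * M ^\<^sub>m l) $$ (u, c))"
proof -
  have "block P (offset rs l) (rs ! l) 0 d = block (block P 0 (hd rs) 0 d * M ^\<^sub>m l) 0 (rs ! l) 0 d \<longleftrightarrow>
    (\<forall>u<rs ! l. \<forall>c<d. P $$ (offset rs l + u, c) = (first P * M ^\<^sub>m l) $$ (u, c))"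
    if "P \<in> carrier_mat (sum_list rs) d" "l < length rs" for l
  proof -
    have fP: "block P 0 (hd rs) 0 d = first P" using that by (simp add: first_def)
    have "dim_row (first P) = hd rs" "dim_col (M ^\<^sub>m l) = d" using M by (simp_all add: first_def block_def)
    then have "block (first P * M ^\<^sub>m l) 0 (rs ! l) 0 d = mat (rs ! l) d (\<lambda>(u, c). (first P * M ^\<^sub>m l) $$ (u, c))"
      by (simp add: block_def)
    moreover have "block P (offset rs l) (rs ! l) 0 d = mat (rs ! l) d (\<lambda>(u, c). P $$ (offset rs l + u, c))"
      by (simp add: block_def)
    ultimately show ?thesis unfolding fP by (auto simp: mat_eq_iff simp del: index_mult_mat)
  qed
  then show ?thesis unfolding stacked_def using M by auto
qed

lemma rebuild_carrier: "M \<in> carrier_mat d d \<Longrightarrow> rebuild M rs F \<in> carrier_mat (sum_list rs) d"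
  by (simp add: rebuild_def)

lemma rebuild_index:
  assumes "M \<in> carrier_mat d d" "l < length rs" "u < rs ! l" "c < d"
  shows "rebuild M rs F $$ (offset rs l + u, c) = (F * M ^\<^sub>m l) $$ (u, c)"
  using assms by (simp add: rebuild_def offset_less block_no_offset)

lemma first_rebuild:
  assumes M: "M \<in> carrier_mat d d" and F: "F \<in> carrier_mat (hd rs) d"
  shows "first (rebuild M rs F) = F"
proof (rule eq_matI)
  show dims: "dim_row (first (rebuild M rs F)) = dim_row F" "dim_col (first (rebuild M rs F)) = dim_col F"
    using F M by (simp_all add: first_def block_def rebuild_def)
  fix u c assume uc: "u < dim_row F" "c < dim_col F"
  have "rebuild M rs F $$ (offset rs 0 + u, c) = (F * M ^\<^sub>m 0) $$ (u, c)"
    by (rule rebuild_index[OF M]) (use rs uc F in \<open>auto simp: hd_conv_nth\<close>)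
  also have "F * M ^\<^sub>m 0 = F" using F M by simp
  finally show "first (rebuild M rs F) $$ (u, c) = F $$ (u, c)"
    using uc F M by (simp add: first_index rebuild_def offset_def)
qed

lemma stacked_rebuild:
  assumes M: "M \<in> carrier_mat d d" and F: "F \<in> carrier_mat (hd rs) d"
  shows "stacked M rs (rebuild M rs F)"
  unfolding stacked_iff[OF M] first_rebuild[OF assms]
  using rebuild_carrier[OF M] rebuild_index[OF M] by blast

lemma stacked_eqI:
  assumes M: "M \<in> carrier_mat d d" and P: "stacked M rs P" "stacked M rs P'"
    and first: "first P = first P'"
  shows "P = P'"
proof (rule eq_matI)
  have c: "P \<in> carrier_mat (sum_list rs) d" "P' \<in> carrier_mat (sum_list rs) d"
    using P stacked_iff[OF M] by auto
  then show "dim_row P = dim_row P'" "dim_col P = dim_col P'" by auto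
  fix a b assume ab: "a < dim_row P'" "b < dim_col P'"
  then have "a < sum_list rs" "b < d" using c by auto
  from this(1) obtain l u where "l < length rs" "u < rs ! l" "a = offset rs l + u" by (rule offset_cases)
  then show "P $$ (a, b) = P' $$ (a, b)"
    using P[unfolded stacked_iff[OF M]] \<open>b < d\<close> first by simp
qed

lemma first_mult:
  assumes "P \<in> carrier_mat (sum_list rs) d" "X \<in> carrier_mat d d"
  shows "first (P * X) = first P * X"
proof (rule eq_matI)
  show "dim_row (first (P * X)) = dim_row (first P * X)" "dim_col (first (P * X)) = dim_col (first P * X)"
    using assms by (simp_all add: first_def block_def)
  fix u c assume "u < dim_row (first P * X)" "c < dim_col (first P * X)"
  then have uc: "u < hd rs" "c < d" using assms by (simp_all add: first_def block_def)
  have "u < sum_list rs" using uc(1) hd_le by simp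
  then show "first (P * X) $$ (u, c) = (first P * X) $$ (u, c)"
    using uc assms by (simp add: first_index first_def block_def scalar_prod_def)
qed

lemma pow_commute:
  assumes M: "M \<in> carrier_mat d d" and X: "X \<in> carrier_mat d d" "X * M = M * X"
  shows "X * M ^\<^sub>m l = M ^\<^sub>m l * X"
proof (induction l)
  case (Suc l)
  have Ml: "M ^\<^sub>m l \<in> carrier_mat d d" using M by simp
  have "X * M ^\<^sub>m Suc l = (X * M ^\<^sub>m l) * M" using assoc_mult_mat[OF X(1) Ml M] by simp
  also have "\<dots> = M ^\<^sub>m l * (X * M)" using Suc assoc_mult_mat[OF Ml X(1) M] by simp
  also have "\<dots> = M ^\<^sub>m Suc l * X" using X(2) assoc_mult_mat[OF Ml M X(1)] by simp
  finally show ?case .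
qed (use M X in simp)

text \<open>X commutes with the powers of M, so it can be moved to the right of each of them; block
  \<open>l\<close> of PX is then block \<open>l\<close> of P times X.\<close>

lemma stacked_mult:
  assumes M: "M \<in> carrier_mat d d" and P: "stacked M rs P"
    and X: "X \<in> carrier_mat d d" "X * M = M * X"
  shows "stacked M rs (P * X)"
proof -
  have c: "P \<in> carrier_mat (sum_list rs) d" using P stacked_iff[OF M] by auto
  have fc: "first P \<in> carrier_mat (hd rs) d" using first_carrier[of P] c by simp
  have "(P * X) $$ (offset rs l + u, b) = (first (P * X) * M ^\<^sub>m l) $$ (u, b)"
    if "l < length rs" "u < rs ! l" "b < d" for l u b
  proof -
    have Ml: "M ^\<^sub>m l \<in> carrier_mat d d" using M by simp
    have u: "u < hd rs" using rs_le[OF that(1)] that(2) by simp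
    have a: "offset rs l + u < sum_list rs" using that offset_less by blast
    have "first (P * X) * M ^\<^sub>m l = first P * (X * M ^\<^sub>m l)"
      using first_mult[OF c X(1)] assoc_mult_mat[OF fc X(1) Ml] by simp
    also have "\<dots> = (first P * M ^\<^sub>m l) * X"
      using pow_commute[OF M X] assoc_mult_mat[OF fc Ml X(1)] by simp
    finally have "(first (P * X) * M ^\<^sub>m l) $$ (u, b) = (\<Sum>j<d. (first P * M ^\<^sub>m l) $$ (u, j) * X $$ (j, b))"
      using index_mult_mat_sum[OF mult_carrier_mat[OF fc Ml] X(1) u that(3)] by simp
    also have "\<dots> = (\<Sum>j<d. P $$ (offset rs l + u, j) * X $$ (j, b))"
      using P[unfolded stacked_iff[OF M]] that by simp
    also have "\<dots> = (P * X) $$ (offset rs l + u, b)"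
      using index_mult_mat_sum[OF c X(1) a that(3)] by simp
    finally show ?thesis by simp
  qed
  then show ?thesis unfolding stacked_iff[OF M] using c X by auto
qed

end

context weyr
begin

lemma mult_A_block:
  assumes F: "F \<in> carrier_mat r n" and i: "i < q" and u: "u < r" and b: "b < ds ! i"
  shows "(F * A ^\<^sub>m l) $$ (u, offset ds i + b) =
    (block F 0 r (offset ds i) (ds ! i) * weyr_block (zs ! i) (w i) ^\<^sub>m l) $$ (u, b)"
  using b
proof (induction l arbitrary: b)
  let ?M = "weyr_block (zs ! i) (w i)" and ?F = "block F 0 r (offset ds i) (ds ! i)"
  have M: "?M \<in> carrier_mat (ds ! i) (ds ! i)" using weyr_block_carrier i by simp
  have Fi: "?F \<in> carrier_mat r (ds ! i)" by (simp add: block_def)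
  have col: "offset ds i + b < n" if "b < ds ! i" for b using offset_less[of i ds b] i that by simp
  {
    case 0
    have "F * A ^\<^sub>m 0 = F" "?F * ?M ^\<^sub>m 0 = ?F" using F A_carrier Fi M by simp_all
    then show ?case using 0 u col by (simp add: block_def)
  next
    case (Suc l)
    have Al: "A ^\<^sub>m l \<in> carrier_mat n n" using A_carrier by simp
    have Ml: "?M ^\<^sub>m l \<in> carrier_mat (ds ! i) (ds ! i)" using M by simp
    have "F * A ^\<^sub>m Suc l = (F * A ^\<^sub>m l) * A" using assoc_mult_mat[OF F Al A_carrier] by simp
    then have "(F * A ^\<^sub>m Suc l) $$ (u, offset ds i + b) =
        (\<Sum>c<n. (F * A ^\<^sub>m l) $$ (u, c) * A $$ (c, offset ds i + b))"
      using index_mult_mat_sum[OF mult_carrier_mat[OF F Al] A_carrier u col[OF Suc.prems]] by simp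
    also have "\<dots> = (\<Sum>j<length ds. \<Sum>a<ds ! j. (F * A ^\<^sub>m l) $$ (u, offset ds j + a) * A $$ (offset ds j + a, offset ds i + b))"
      by (rule sum_offset)
    also have "\<dots> = (\<Sum>a<ds ! i. (F * A ^\<^sub>m l) $$ (u, offset ds i + a) * A $$ (offset ds i + a, offset ds i + b))"
    proof (rule sum_eq_single)
      fix j assume "j \<in> {..<length ds}" "j \<noteq> i"
      then show "(\<Sum>a<ds ! j. (F * A ^\<^sub>m l) $$ (u, offset ds j + a) * A $$ (offset ds j + a, offset ds i + b)) = 0"
        using A_block_entry[of j _ i b] i Suc.prems by (intro sum.neutral) auto
    qed (use i in auto)
    also have "\<dots> = (\<Sum>a<ds ! i. (?F * ?M ^\<^sub>m l) $$ (u, a) * ?M $$ (a, b))"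
      using A_block_entry[of i _ i b] i Suc by (intro sum.cong) auto
    also have "\<dots> = ((?F * ?M ^\<^sub>m l) * ?M) $$ (u, b)"
      using index_mult_mat_sum[OF mult_carrier_mat[OF Fi Ml] M u Suc.prems] by simp
    also have "(?F * ?M ^\<^sub>m l) * ?M = ?F * ?M ^\<^sub>m Suc l" using assoc_mult_mat[OF Fi Ml M] by simp
    finally show ?case .
  }
qed

definition cblock :: "nat \<Rightarrow> real mat \<Rightarrow> real mat" where
  "cblock i P = block P 0 (dim_row P) (offset ds i) (ds ! i)"

lemma cblock_index: "u < dim_row P \<Longrightarrow> b < ds ! i \<Longrightarrow> cblock i P $$ (u, b) = P $$ (u, offset ds i + b)"
  by (simp add: cblock_def block_def)

end

locale weyr_rows = weyr + row_partition
begin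

text \<open>Reduced shape is imposed on column blocks with their own Weyr blocks, while membership
  in \<open>P_set\<close> concerns \<open>A\<close>. Since \<open>A\<close> is block diagonal, the
  power conditions split by columns.\<close>

lemma stacked_blocks:
  assumes P: "P \<in> carrier_mat (sum_list rs) n"
  shows "stacked A rs P \<longleftrightarrow> (\<forall>i<q. stacked (weyr_block (zs ! i) (w i)) rs (cblock i P))"
proof -
  have M: "weyr_block (zs ! i) (w i) \<in> carrier_mat (ds ! i) (ds ! i)" if "i < q" for i
    using weyr_block_carrier that by simp
  have first: "first (cblock i P) = block (first P) 0 (hd rs) (offset ds i) (ds ! i)" if i: "i < q" for i
  proof (rule eq_matI)
    show "dim_row (first (cblock i P)) = dim_row (block (first P) 0 (hd rs) (offset ds i) (ds ! i))"
      "dim_col (first (cblock i P)) = dim_col (block (first P) 0 (hd rs) (offset ds i) (ds ! i))"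
      by (simp_all add: first_def block_def cblock_def)
    fix u b assume "u < dim_row (block (first P) 0 (hd rs) (offset ds i) (ds ! i))"
      "b < dim_col (block (first P) 0 (hd rs) (offset ds i) (ds ! i))"
    then have ub: "u < hd rs" "b < ds ! i" by (simp_all add: block_def)
    moreover have "offset ds i + b < n" using offset_less[of i ds b] i ub by simp
    moreover have "u < sum_list rs" using ub hd_le by simp
    ultimately show "first (cblock i P) $$ (u, b) = block (first P) 0 (hd rs) (offset ds i) (ds ! i) $$ (u, b)"
      using P by (simp add: first_def block_def cblock_def)
  qed
  have fP: "first P \<in> carrier_mat (hd rs) n" using first_carrier[of P] P by simp
  have iff: "cblock i P $$ (offset rs l + u, b) = (first (cblock i P) * weyr_block (zs ! i) (w i) ^\<^sub>m l) $$ (u, b) \<longleftrightarrow>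
      P $$ (offset rs l + u, offset ds i + b) = (first P * A ^\<^sub>m l) $$ (u, offset ds i + b)"
    if "i < q" "l < length rs" "u < rs ! l" "b < ds ! i" for i l u b
  proof -
    have "u < hd rs" using rs_le[OF that(2)] that(3) by simp
    moreover have "offset rs l + u < sum_list rs" using that offset_less by blast
    ultimately show ?thesis
      using mult_A_block[OF fP that(1) _ that(4), of u l] first[OF that(1)] cblock_index[of "offset rs l + u" P b i] P that
      by simp
  qed
  show ?thesis
  proof
    assume S: "stacked A rs P"
    show "\<forall>i<q. stacked (weyr_block (zs ! i) (w i)) rs (cblock i P)"
    proof (intro allI impI)
      fix i assume i: "i < q"
      have "cblock i P $$ (offset rs l + u, b) = (first (cblock i P) * weyr_block (zs ! i) (w i) ^\<^sub>m l) $$ (u, b)"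
        if "l < length rs" "u < rs ! l" "b < ds ! i" for l u b
        unfolding iff[OF i that] using S[unfolded stacked_iff[OF A_carrier]] that offset_less[of i ds b] i by simp
      moreover have "cblock i P \<in> carrier_mat (sum_list rs) (ds ! i)" using P by (simp add: cblock_def block_def)
      ultimately show "stacked (weyr_block (zs ! i) (w i)) rs (cblock i P)"
        unfolding stacked_iff[OF M[OF i]] by blast
    qed
  next
    assume S: "\<forall>i<q. stacked (weyr_block (zs ! i) (w i)) rs (cblock i P)"
    have "P $$ (offset rs l + u, c) = (first P * A ^\<^sub>m l) $$ (u, c)"
      if "l < length rs" "u < rs ! l" "c < n" for l u c
    proof -
      from that(3) obtain i b where ib: "i < length ds" "b < ds ! i" "c = offset ds i + b" by (rule offset_cases)
      then have i: "i < q" by simp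
      show ?thesis unfolding ib(3) iff[OF i that(1,2) ib(2), symmetric]
        using conjunct2[OF S[rule_format, OF i, unfolded stacked_iff[OF M[OF i]]]] that(1,2) ib(2) by simp
    qed
    then show "stacked A rs P" unfolding stacked_iff[OF A_carrier] using P by blast
  qed
qed

end

section \<open>Reduced shape as a condition on single entries\<close>

lemma diamond_eq_one_iff:
  assumes "Z \<in> carrier_mat t (2 * t)"
  shows "diamond Z = 1\<^sub>m (2 * t) \<longleftrightarrow> (\<forall>u<t. \<forall>v<2 * t. Z $$ (u, v) = (if v = 2 * u then 1 else 0))"
proof
  assume D: "diamond Z = 1\<^sub>m (2 * t)"
  show "\<forall>u<t. \<forall>v<2 * t. Z $$ (u, v) = (if v = 2 * u then 1 else 0)"
  proof (intro allI impI)
    fix u v assume uv: "u < t" "v < 2 * t"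
    \<comment> \<open>The even rows of \<open>diamond Z\<close> are the rows of \<open>Z\<close>;
      the odd rows only repeat their content.\<close>
    have "diamond Z $$ (2 * u, v) = (if 2 * u = v then 1 else 0)" using D uv by simp
    moreover have "diamond Z $$ (2 * u, v) = Z $$ (u, v)"
      using uv assms by (auto simp: diamond_def Let_def elim!: evenE oddE)
    ultimately show "Z $$ (u, v) = (if v = 2 * u then 1 else 0)" by auto
  qed
next
  assume Z: "\<forall>u<t. \<forall>v<2 * t. Z $$ (u, v) = (if v = 2 * u then 1 else 0)"
  show "diamond Z = 1\<^sub>m (2 * t)"
  proof (rule eq_matI)
    fix x y assume "x < dim_row (1\<^sub>m (2 * t))" "y < dim_col (1\<^sub>m (2 * t))"
    then have xy: "x < 2 * t" "y < 2 * t" by auto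
    have h: "x div 2 < t" "2 * (y div 2) < 2 * t" "2 * (y div 2) + 1 < 2 * t" using xy by presburger+
    have "Z $$ (x div 2, 2 * (y div 2)) = (if y div 2 = x div 2 then 1 else 0)"
      using Z h by auto
    moreover have "Z $$ (x div 2, 2 * (y div 2) + 1) = 0"
      using Z h by (metis even_add even_mult_iff even_numeral odd_one)
    moreover have "x = y \<longleftrightarrow> x div 2 = y div 2 \<and> (even x \<longleftrightarrow> even y)"
      by (metis bit_eq_rec)
    ultimately show "diamond Z $$ (x, y) = 1\<^sub>m (2 * t) $$ (x, y)"
      using xy assms by (auto simp: diamond_def Let_def)
  qed (use assms in \<open>auto simp: diamond_def\<close>)
qed

lemma zero_mat_iff:
  assumes "Z \<in> carrier_mat a b"
  shows "Z = 0\<^sub>m a b \<longleftrightarrow> (\<forall>u<a. \<forall>v<b. Z $$ (u, v) = 0)"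
  using assms by (auto simp: mat_eq_iff)

lemma one_mat_iff:
  assumes "Z \<in> carrier_mat a a"
  shows "Z = 1\<^sub>m a \<longleftrightarrow> (\<forall>u<a. \<forall>v<a. Z $$ (u, v) = (if v = u then 1 else 0))"
  using assms by (auto simp: mat_eq_iff)

context
  fixes z :: complex and w :: "nat list" and Is :: "nat list list" and R :: "real mat" and N :: nat
  assumes dec: "sorted_wrt (\<ge>) w" and len: "length (idx Is (length w)) = tau w (length w)"
    and R: "R \<in> carrier_mat N (eps z * sum_list w)"
begin

lemma sub_R_carrier:
  "sub_R z w Is R j a b \<in> carrier_mat (tau w a - tau w (a - 1)) (eps z * (tau w b - tau w (b - 1)))"
  by (simp add: sub_R_def block_def)

lemma sub_R_index:
  assumes j: "j \<in> {1..length w}" and a: "a \<in> {1..length w}" and b: "b \<in> {1..length w - j + 1}"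
    and u: "u < tau w a - tau w (a - 1)" and v: "v < eps z * (tau w b - tau w (b - 1))"
  shows "sub_R z w Is R j a b $$ (u, v) =
    R $$ (idx Is (length w) ! (tau w (a - 1) + u), eps z * offset w (j - 1) + (eps z * tau w (b - 1) + v))"
proof -
  have "tau w a \<le> tau w (length w)" using tau_mono[OF dec, of a] a by simp
  then have row: "tau w (a - 1) + u < length (idx Is (length w))" using u len by simp
  have bm: "b \<le> length w" using b j by auto
  have "b \<le> length w - (j - 1)" using b j by auto
  then have "tau w b \<le> tau w (length w - (j - 1))" by (rule tau_mono[OF dec]) simp
  also have "\<dots> = w ! (j - 1)" by (rule tau_level) (use j in auto)
  finally have "offset w (j - 1) + tau w b \<le> offset w (Suc (j - 1))"
    using j by (subst offset_Suc) auto
  also have "\<dots> \<le> sum_list w" using offset_mono[of "Suc (j - 1)" "length w" w] j by (simp add: offset_length)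
  finally have "eps z * (offset w (j - 1) + tau w b) \<le> eps z * sum_list w" by (rule mult_le_mono2)
  moreover have "tau w (b - 1) \<le> tau w b" using tau_mono[OF dec, of "b - 1" b] bm by simp
  then have "eps z * tau w (b - 1) + v < eps z * tau w b"
    using v by (simp add: diff_mult_distrib2 mult_le_mono2 less_diff_conv add.commute)
  ultimately have col: "eps z * offset w (j - 1) + (eps z * tau w (b - 1) + v) < eps z * sum_list w"
    by (simp add: distrib_left)
  show ?thesis
    using row col u v R by (simp add: sub_R_def block_def rows_at_def add.assoc)
qed

text \<open>Makes one rule cover identity and zero blocks: the value is 1 exactly when the local
  column equals \<open>eps z\<close> times the row index. For \<open>a < b\<close> the columns of
  the block start beyond that position, and for \<open>j \<ge> 2\<close> they lie outside level 0
  altogether.\<close>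

lemma prescribed_value:
  assumes "j \<in> {1..length w}" "a \<in> {1..length w}" "b \<in> {1..length w - j + 1}" "a \<le> b + j - 1"
    "u < tau w a - tau w (a - 1)" "v < eps z * (tau w b - tau w (b - 1))"
  shows "eps z * offset w (j - 1) + (eps z * tau w (b - 1) + v) = eps z * (tau w (a - 1) + u) \<longleftrightarrow>
    j = 1 \<and> a = b \<and> v = eps z * u"
proof -
  have ep: "eps z > 0" by (simp add: eps_def)
  show ?thesis
  proof (cases "j = 1")
    case True
    show ?thesis
    proof (cases "a = b")
      case True
      then show ?thesis using \<open>j = 1\<close> by (auto simp: offset_def distrib_left)
    next
      case False
      then have "a \<le> b - 1" "b - 1 \<le> length w" using assms True by auto
      then have "tau w a \<le> tau w (b - 1)" by (rule tau_mono[OF dec])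
      moreover have "tau w (a - 1) + u < tau w a" using assms(5) by simp
      ultimately have "tau w (a - 1) + u < tau w (b - 1)" by simp
      from mult_less_mono2[OF this ep]
      have "eps z * offset w (j - 1) + (eps z * tau w (b - 1) + v) \<noteq> eps z * (tau w (a - 1) + u)" by linarith
      then show ?thesis using False by blast
    qed
  next
    case False
    have w: "w \<noteq> []" using assms(1) by auto
    have "tau w (a - 1) + u < tau w a" using assms(5) by simp
    also have "\<dots> \<le> tau w (length w)" using tau_mono[OF dec, of a] assms(2) by simp
    also have "\<dots> = w ! 0" using tau_level[of 0 w] w by simp
    also have "\<dots> = offset w (Suc 0)" using offset_Suc[of 0 w] w by (simp add: offset_def)
    also have "\<dots> \<le> offset w (j - 1)" using False assms(1) by (intro offset_mono) auto
    finally have "tau w (a - 1) + u < offset w (j - 1)" .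
    from mult_less_mono2[OF this ep]
    have "eps z * offset w (j - 1) + (eps z * tau w (b - 1) + v) \<noteq> eps z * (tau w (a - 1) + u)" by linarith
    then show ?thesis using False by blast
  qed
qed

lemma reduced_shape_iff:
  "reduced_shape z w rs Is R \<longleftrightarrow> stacked (weyr_block z w) rs R \<and>
    (\<forall>(u, c)\<in>prescribed_idx z w. R $$ (idx Is (length w) ! u, c) = (if c = eps z * u then 1 else 0))"
proof -
  define t where "t = (\<lambda>a. tau w a - tau w (a - 1))"
  define m where "m = length w"
  \<comment> \<open>The common entrywise form of all requirements on the block (j, a, b); the
    indicator distinguishes identity from zero.\<close>
  define val where "val = (\<lambda>j a b. \<forall>u<t a. \<forall>v<eps z * t b.
     R $$ (idx Is m ! (tau w (a - 1) + u), eps z * offset w (j - 1) + (eps z * tau w (b - 1) + v)) =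
     (if j = 1 \<and> a = b \<and> v = eps z * u then 1 else 0))"
  have sub: "sub_R z w Is R j a b \<in> carrier_mat (t a) (eps z * t b)" for j a b
    unfolding t_def by (rule sub_R_carrier)
  have one: "(if z \<in> \<real> then sub_R z w Is R 1 a a = 1\<^sub>m (t a) else diamond (sub_R z w Is R 1 a a) = 1\<^sub>m (2 * t a)) \<longleftrightarrow> val 1 a a"
    if "a \<in> {1..m}" for a
  proof -
    have "(if z \<in> \<real> then sub_R z w Is R 1 a a = 1\<^sub>m (t a) else diamond (sub_R z w Is R 1 a a) = 1\<^sub>m (2 * t a))
      \<longleftrightarrow> (\<forall>u<t a. \<forall>v<eps z * t a. sub_R z w Is R 1 a a $$ (u, v) = (if v = eps z * u then 1 else 0))"
      using one_mat_iff[of "sub_R z w Is R 1 a a" "t a"] diamond_eq_one_iff[of "sub_R z w Is R 1 a a" "t a"] sub[of 1 a a]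
      by (cases z rule: eps_cases) simp_all
    also have "\<dots> \<longleftrightarrow> val 1 a a"
    proof -
      have "sub_R z w Is R 1 a a $$ (u, v) =
          R $$ (idx Is m ! (tau w (a - 1) + u), eps z * offset w (1 - 1) + (eps z * tau w (a - 1) + v))"
        if "u < t a" "v < eps z * t a" for u v
        unfolding m_def by (rule sub_R_index) (use that \<open>a \<in> {1..m}\<close> in \<open>auto simp: t_def m_def\<close>)
      then show ?thesis unfolding val_def by (simp del: One_nat_def split del: if_split)
    qed
    finally show ?thesis .
  qed
  have zero: "sub_R z w Is R j a b = 0\<^sub>m (t a) (eps z * t b) \<longleftrightarrow> val j a b"
    if "j \<in> {1..m}" "a \<in> {1..m}" "b \<in> {1..m - j + 1}" "j \<noteq> 1 \<or> a \<noteq> b" for j a b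
    unfolding zero_mat_iff[OF sub] val_def
    using that sub_R_index[of j a b] by (auto simp: t_def m_def)
  have "reduced_shape z w rs Is R \<longleftrightarrow> stacked (weyr_block z w) rs R \<and>
    ((\<forall>a\<in>{1..m}. val 1 a a) \<and>
     (\<forall>a\<in>{1..m}. \<forall>b\<in>{1..m}. a < b \<longrightarrow> val 1 a b) \<and>
     (\<forall>j\<in>{2..m}. \<forall>a\<in>{1..m}. \<forall>b\<in>{max (a + 1 - j) 1..m - j + 1}. val j a b))"
  proof -
    have "(\<forall>a\<in>{1..m}. \<forall>b\<in>{1..m}. a < b \<longrightarrow> sub_R z w Is R 1 a b = 0\<^sub>m (t a) (eps z * t b)) \<longleftrightarrow>
       (\<forall>a\<in>{1..m}. \<forall>b\<in>{1..m}. a < b \<longrightarrow> val 1 a b)"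
      by (intro ball_cong refl imp_cong zero) auto
    moreover have "(\<forall>j\<in>{2..m}. \<forall>a\<in>{1..m}. \<forall>b\<in>{max (a + 1 - j) 1..m - j + 1}. sub_R z w Is R j a b = 0\<^sub>m (t a) (eps z * t b)) \<longleftrightarrow>
       (\<forall>j\<in>{2..m}. \<forall>a\<in>{1..m}. \<forall>b\<in>{max (a + 1 - j) 1..m - j + 1}. val j a b)"
      by (intro ball_cong refl zero) auto
    ultimately show ?thesis
      unfolding reduced_shape_def Let_def m_def[symmetric] t_def[symmetric] using one by simp
  qed
  also have "((\<forall>a\<in>{1..m}. val 1 a a) \<and>
     (\<forall>a\<in>{1..m}. \<forall>b\<in>{1..m}. a < b \<longrightarrow> val 1 a b) \<and>
     (\<forall>j\<in>{2..m}. \<forall>a\<in>{1..m}. \<forall>b\<in>{max (a + 1 - j) 1..m - j + 1}. val j a b)) \<longleftrightarrow>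
     (\<forall>j\<in>{1..m}. \<forall>a\<in>{1..m}. \<forall>b\<in>{1..m - j + 1}. a \<le> b + j - 1 \<longrightarrow> val j a b)" (is "?L \<longleftrightarrow> ?M")
  proof
    assume L: ?L
    show ?M
    proof (intro ballI impI)
      fix j a b assume *: "j \<in> {1..m}" "a \<in> {1..m}" "b \<in> {1..m - j + 1}" "a \<le> b + j - 1"
      show "val j a b"
      proof (cases "j = 1")
        case True
        then show ?thesis using L * by (cases "a = b") auto
      next
        case False
        then have "j \<in> {2..m}" "b \<in> {max (a + 1 - j) 1..m - j + 1}" using * by auto
        then show ?thesis using L *(2) by blast
      qed
    qed
  next
    assume M: ?M
    have "val 1 a b" if "a \<in> {1..m}" "b \<in> {1..m}" "a \<le> b" for a b
      using M[rule_format, of 1 a b] that by auto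
    moreover have "val j a b" if "j \<in> {2..m}" "a \<in> {1..m}" "b \<in> {max (a + 1 - j) 1..m - j + 1}" for j a b
      using M[rule_format, of j a b] that by auto
    ultimately show ?L by simp
  qed
  also have "\<dots> \<longleftrightarrow> (\<forall>(u, c)\<in>prescribed_idx z w. R $$ (idx Is (length w) ! u, c) = (if c = eps z * u then 1 else 0))"
    (is "_ \<longleftrightarrow> ?R")
  proof
    assume M: ?M
    show ?R
    proof (clarify)
      fix u c assume "(u, c) \<in> prescribed_idx z w"
      then obtain j a b v where *: "c = eps z * offset w (j - 1) + v"
        "j \<in> {1..m}" "a \<in> {1..m}" "b \<in> {1..m - j + 1}" "a \<le> b + j - 1"
        "u \<in> {tau w (a - 1)..<tau w a}" "v \<in> {eps z * tau w (b - 1)..<eps z * tau w b}"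
        unfolding prescribed_idx_def m_def by blast
      define u' where "u' = u - tau w (a - 1)"
      define v' where "v' = v - eps z * tau w (b - 1)"
      have u: "u = tau w (a - 1) + u'" "u' < t a" using *(6) by (auto simp: u'_def t_def)
      have v: "v = eps z * tau w (b - 1) + v'" "v' < eps z * t b"
        using *(7) by (auto simp: v'_def t_def diff_mult_distrib2)
      have V: "val j a b" using M *(2-5) by blast
      show "R $$ (idx Is (length w) ! u, c) = (if c = eps z * u then 1 else 0)"
        using V[unfolded val_def, rule_format, OF u(2) v(2)]
          prescribed_value[of j a b u' v'] u v *(1-5) by (simp add: t_def m_def)
    qed
  next
    assume A: ?R
    show ?M
    proof (intro ballI impI)
      fix j a b assume *: "j \<in> {1..m}" "a \<in> {1..m}" "b \<in> {1..m - j + 1}" "a \<le> b + j - 1"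
      show "val j a b"
        unfolding val_def
      proof (intro allI impI)
        fix u v assume uv: "u < t a" "v < eps z * t b"
        define u' where "u' = tau w (a - 1) + u"
        define v' where "v' = eps z * tau w (b - 1) + v"
        have "u' \<in> {tau w (a - 1)..<tau w a}" using uv(1) by (auto simp: u'_def t_def)
        moreover have "v' \<in> {eps z * tau w (b - 1)..<eps z * tau w b}"
          using uv(2) by (auto simp: v'_def t_def diff_mult_distrib2)
        ultimately have "(u', eps z * offset w (j - 1) + v') \<in> prescribed_idx z w"
          using * unfolding prescribed_idx_def m_def by blast
        from bspec[OF A this]
        show "R $$ (idx Is m ! (tau w (a - 1) + u), eps z * offset w (j - 1) + (eps z * tau w (b - 1) + v)) =
           (if j = 1 \<and> a = b \<and> v = eps z * u then 1 else 0)"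
          using prescribed_value[of j a b u v] * uv by (simp add: u'_def v'_def t_def m_def)
      qed
    qed
  qed
  finally show ?thesis .
qed

end

section \<open>Corners and the reduced representative of an orbit\<close>

lemma sum_lessThan_2: "(\<Sum>e<2. f e) = f 0 + f (1 :: nat)" for f :: "nat \<Rightarrow> 'a :: comm_monoid_add"
  by (simp add: numeral_2_eq_2)

locale weyr_index = weyr_rows zs "weyr_chars alphas" rs for alphas zs rs +
  fixes Iss :: "nat list list list"
  assumes Iss: "i < length zs \<Longrightarrow> Iss ! i \<in> index_tuples (hd rs) (weyr_chars alphas (zs ! i))"
    and size: "sum_list rs = sum_list (map (\<lambda>z. eps z * sum_list (weyr_chars alphas z)) zs)"
begin

definition I :: "nat \<Rightarrow> nat \<Rightarrow> nat" where
  "I i u = idx (Iss ! i) (length (w i)) ! u"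

definition reduced :: "real mat \<Rightarrow> bool" where
  "reduced P \<longleftrightarrow> (\<forall>i<q. \<forall>(u, c)\<in>prescribed_idx (zs ! i) (w i).
     P $$ (I i u, offset ds i + c) = (if c = ep i * u then 1 else 0))"

definition corner :: "nat \<Rightarrow> nat \<Rightarrow> real mat \<Rightarrow> real mat" where
  "corner i j P = block (rows_at (cblock i P) (idx (Iss ! i) j)) 0 (tau (w i) j) 0 (ep i * tau (w i) j)"

definition corners_invertible :: "real mat \<Rightarrow> bool" where
  "corners_invertible P \<longleftrightarrow> (\<forall>i<q. \<forall>j\<in>{1..length (w i)}.
     if zs ! i \<in> \<real> then invertible_mat (corner i j P) else invertible_mat (diamond (corner i j P)))"

lemma weyr_form_eq: "weyr_form alphas zs = A"
  by (simp add: weyr_form_def)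

lemma col_block_eq: "col_block alphas zs i P = cblock i P"
  by (simp add: col_block_def cblock_def Let_def)

lemma idx_props:
  assumes "i < q" "j \<in> {1..length (w i)}"
  shows "length (idx (Iss ! i) j) = tau (w i) j" "distinct (idx (Iss ! i) j)"
    "set (idx (Iss ! i) j) \<subseteq> {..<hd rs}" "take (tau (w i) (j - 1)) (idx (Iss ! i) j) = idx (Iss ! i) (j - 1)"
  using Iss[OF assms(1)] assms(2) by (auto simp: index_tuples_def)

text \<open>All index sequences of a block are prefixes of the longest one, so a single row function
  \<open>I\<close> serves the corners of every size.\<close>

lemma idx_take:
  assumes i: "i < q" and j: "j \<le> length (w i)"
  shows "idx (Iss ! i) j = take (tau (w i) j) (idx (Iss ! i) (length (w i)))"
  using j
proof (induction j rule: inc_induct)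
  case base
  show ?case
  proof (cases "length (w i) = 0")
    case False
    then have "length (w i) \<in> {1..length (w i)}" by (simp add: Suc_le_eq)
    then show ?thesis using idx_props(1)[OF i] by simp
  qed (simp add: idx_def)
next
  case (step j)
  have "idx (Iss ! i) j = take (tau (w i) j) (idx (Iss ! i) (Suc j))"
    using idx_props(4)[OF i, of "Suc j"] step.hyps by simp
  also have "\<dots> = take (tau (w i) j) (take (tau (w i) (Suc j)) (idx (Iss ! i) (length (w i))))"
    by (simp only: step.IH)
  also have "\<dots> = take (tau (w i) j) (idx (Iss ! i) (length (w i)))"
    using tau_mono[OF dec[OF i], of j "Suc j"] step.hyps by (simp add: min_absorb1)
  finally show ?case .
qed

lemma idx_length:
  assumes i: "i < q" shows "length (idx (Iss ! i) (length (w i))) = tau (w i) (length (w i))"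
  using idx_props(1)[OF i, of "length (w i)"] by (cases "length (w i) = 0") (auto simp: idx_def tau_0)

lemma tau_length: "w i \<noteq> [] \<Longrightarrow> tau (w i) (length (w i)) = w i ! 0"
  using tau_level[of 0 "w i"] by simp

lemma prescribed_row:
  assumes "i < q" "(u, c) \<in> prescribed_idx (zs ! i) (w i)"
  shows "u < tau (w i) (length (w i))" "I i u < hd rs" "c < ds ! i"
proof -
  note less = prescribed_idx_less[OF assms]
  have "w i \<noteq> []" using assms(2) unfolding prescribed_idx_def by auto
  then show u: "u < tau (w i) (length (w i))" using less(1) tau_length by simp
  have "length (w i) \<in> {1..length (w i)}" using \<open>w i \<noteq> []\<close> by (cases "w i") auto
  moreover have "I i u \<in> set (idx (Iss ! i) (length (w i)))"
    unfolding I_def by (rule nth_mem) (use u idx_length[OF assms(1)] in simp)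
  ultimately show "I i u < hd rs" using idx_props(3)[OF assms(1)] by blast
  show "c < ds ! i" using less(2) assms(1) by simp
qed

lemma row_less: "u < hd rs \<Longrightarrow> u < n"
  using hd_le size by simp

lemma corner_index:
  assumes i: "i < q" and j: "j \<in> {1..length (w i)}" and P: "P \<in> carrier_mat n n"
    and u: "u < tau (w i) j" and c: "c < ep i * tau (w i) j"
  shows "corner i j P $$ (u, c) = P $$ (I i u, offset ds i + c)"
proof -
  have idxj: "idx (Iss ! i) j ! u = I i u"
    using idx_take[OF i, of j] j u unfolding I_def by simp
  have "idx (Iss ! i) j ! u \<in> set (idx (Iss ! i) j)"
    by (rule nth_mem) (use u idx_props(1)[OF i j] in simp)
  then have "idx (Iss ! i) j ! u < hd rs" using idx_props(3)[OF i j] by blast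
  then have row: "I i u < n" using row_less idxj by simp
  have "tau (w i) j = w i ! (length (w i) - j)" using j by (auto simp: tau_def)
  also have "\<dots> \<le> sum_list (w i)" using j by (intro elem_le_sum_list) auto
  finally have "ep i * tau (w i) j \<le> ds ! i" using i by (simp add: mult_le_mono2)
  then have "c < ds ! i" using c by simp
  then show ?thesis
    using row idxj u c P idx_props(1)[OF i j]
    by (simp add: corner_def block_def rows_at_def cblock_def)
qed

lemma corner_carrier: "corner i j P \<in> carrier_mat (tau (w i) j) (ep i * tau (w i) j)"
  by (simp add: corner_def block_def)

text \<open>A real corner has trivial kernel on real and imaginary parts separately; for a nonreal
  root the diamond matrix is a real form of the complex corner.\<close>

lemma corners_row_inj:
  assumes P: "P \<in> carrier_mat n n" and inv: "corners_invertible P"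
  shows "row_inj (\<lambda>u c. P $$ (u, c)) I"
  unfolding row_inj_def
proof (intro allI impI)
  fix i s t u'
  assume i: "i < q" and s: "s < length (w i)"
    and eq: "\<forall>u<w i ! s. (\<Sum>u'<w i ! s. hat (\<lambda>c. P $$ (I i u, c)) i 0 u' * t u') = 0"
    and u': "u' < w i ! s"
  define j where "j = length (w i) - s"
  define k where "k = tau (w i) j"
  have j: "j \<in> {1..length (w i)}" using s by (auto simp: j_def)
  have k: "w i ! s = k" using tau_level[OF s] by (simp add: k_def j_def)
  define S where "S = corner i j P"
  have S: "S \<in> carrier_mat k (ep i * k)" unfolding S_def k_def by (rule corner_carrier)
  have hat: "hat (\<lambda>c. P $$ (I i u, c)) i 0 v = (\<Sum>e<ep i. of_real (S $$ (u, ep i * v + e)) * om \<i> e)"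
    if "u < k" "v < k" for u v
    unfolding hat_def
  proof (intro sum.cong refl)
    fix e assume e: "e \<in> {..<ep i}"
    have "ep i * Suc v \<le> ep i * k" using that(2) by (intro mult_le_mono2) simp
    then have "ep i * v + e < ep i * k" using e by simp
    then have "S $$ (u, ep i * v + e) = P $$ (I i u, offset ds i + (ep i * v + e))"
      unfolding S_def using corner_index[OF i j P] that(1) k_def by simp
    then show "complex_of_real (P $$ (I i u, gc i 0 v e)) * om \<i> e = complex_of_real (S $$ (u, ep i * v + e)) * om \<i> e"
      by (simp add: gc_def offset_def)
  qed
  show "t u' = 0"
  proof (cases "zs ! i \<in> \<real>")
    case True
    then have ep: "ep i = 1" by (simp add: eps_def)
    have Sk: "S \<in> carrier_mat k k" "invertible_mat S"
      using S ep inv i j True by (auto simp: corners_invertible_def S_def)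
    have eqS: "(\<Sum>v<k. of_real (S $$ (u, v)) * t v) = 0" if "u < k" for u
      using eq that hat k ep by (simp add: om_def)
    have "Re (t u') = 0"
    proof (rule invertible_mat_kernel[OF Sk])
      fix u assume "u < k"
      from arg_cong[OF eqS[OF this], of Re] show "(\<Sum>j<k. S $$ (u, j) * Re (t j)) = 0" by simp
    qed (use u' k in simp)
    moreover have "Im (t u') = 0"
    proof (rule invertible_mat_kernel[OF Sk])
      fix u assume "u < k"
      from arg_cong[OF eqS[OF this], of Im] show "(\<Sum>j<k. S $$ (u, j) * Im (t j)) = 0" by simp
    qed (use u' k in simp)
    ultimately show ?thesis by (simp add: complex_eq_iff)
  next
    case False
    then have ep: "ep i = 2" by (simp add: eps_def)
    define D where "D = diamond S"
    have D: "D \<in> carrier_mat (2 * k) (2 * k)" using S ep by (simp add: diamond_def D_def)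
    have Dinv: "invertible_mat D" using inv i j False by (auto simp: corners_invertible_def S_def D_def)
    have dim: "dim_row S = k" "dim_col S = 2 * k" using S ep by auto
    have De: "D $$ (2 * u, 2 * v) = S $$ (u, 2 * v)" "D $$ (2 * u, Suc (2 * v)) = S $$ (u, Suc (2 * v))"
      "D $$ (Suc (2 * u), 2 * v) = - S $$ (u, Suc (2 * v))" "D $$ (Suc (2 * u), Suc (2 * v)) = S $$ (u, 2 * v)"
      if "u < k" "v < k" for u v
      using that by (simp_all add: D_def diamond_def dim Let_def)
    have eqS: "(\<Sum>v<k. (of_real (S $$ (u, 2 * v)) + of_real (S $$ (u, Suc (2 * v))) * \<i>) * t v) = 0" if "u < k" for u
      using eq that hat k ep by (simp add: om_def numeral_2_eq_2)
    \<comment> \<open>With the pair (Re t, - Im t), the even rows of the diamond matrix produce the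
      real part of the complex product and the odd rows the negative of its imaginary part.\<close>
    define y where "y = (\<lambda>x. if even x then Re (t (x div 2)) else - Im (t (x div 2)))"
    have "y x = 0" if "x < 2 * k" for x
    proof (rule invertible_mat_kernel[OF D Dinv _ that])
      fix x assume x: "x < 2 * k"
      define u where "u = x div 2"
      have u: "u < k" using x by (simp add: u_def)
      have sum2: "(\<Sum>v<2 * k. D $$ (x, v) * y v) = (\<Sum>v<k. D $$ (x, 2 * v) * Re (t v) - D $$ (x, Suc (2 * v)) * Im (t v))"
        unfolding sum_lessThan_mult sum_lessThan_2 by (simp add: y_def)
      show "(\<Sum>v<2 * k. D $$ (x, v) * y v) = 0"
      proof (cases "even x")
        case True
        then have "x = 2 * u" by (simp add: u_def)
        then show ?thesis unfolding sum2 using arg_cong[OF eqS[OF u], of Re] De[OF u] by simp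
      next
        case False
        then have "x = Suc (2 * u)" by (simp add: u_def)
        then have "(\<Sum>v<2 * k. D $$ (x, v) * y v) =
          (\<Sum>v<k. - Im ((of_real (S $$ (u, 2 * v)) + of_real (S $$ (u, Suc (2 * v))) * \<i>) * t v))"
          unfolding sum2 by (intro sum.cong) (use De[OF u] in simp_all)
        also have "\<dots> = - Im (\<Sum>v<k. (of_real (S $$ (u, 2 * v)) + of_real (S $$ (u, Suc (2 * v))) * \<i>) * t v)"
          by (simp only: sum_negf Im_sum)
        finally show ?thesis unfolding eqS[OF u] by simp
      qed
    qed
    from this[of "2 * u'"] this[of "Suc (2 * u')"] show ?thesis
      using u' k by (simp add: y_def complex_eq_iff)
  qed
qed

lemma unit_lower_triangular_invertible:
  fixes M :: "real mat"
  assumes M: "M \<in> carrier_mat k k" and "\<And>x y. x < y \<Longrightarrow> y < k \<Longrightarrow> M $$ (x, y) = 0"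
    and "\<And>x. x < k \<Longrightarrow> M $$ (x, x) = 1"
  shows "invertible_mat M"
proof -
  have "Determinant.det M = prod_list (diag_mat M)"
    by (rule det_lower_triangular[OF _ M]) (rule assms(2))
  also have "\<dots> \<noteq> 0" using assms(3) M by (auto simp: prod_list_zero_iff diag_mat_def)
  finally show ?thesis using invertible_mat_iff_det[OF M] by simp
qed

text \<open>In a corner all entries on and above the diagonal are prescribed, so it is unit lower
  triangular. Hence reduced matrices satisfy the chart conditions automatically.\<close>

lemma reduced_corners:
  assumes P: "P \<in> carrier_mat n n" and red: "reduced P"
  shows "corners_invertible P"
  unfolding corners_invertible_def
proof (intro allI impI ballI)
  fix i j assume i: "i < q" and j: "j \<in> {1..length (w i)}"
  define k where "k = tau (w i) j"
  define S where "S = corner i j P"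
  have S: "S \<in> carrier_mat k (ep i * k)" unfolding S_def k_def by (rule corner_carrier)
  have k: "k = w i ! (length (w i) - j)" using j by (auto simp: k_def tau_def)
  have val: "S $$ (u, ep i * v + e) = (if v = u \<and> e = 0 then 1 else 0)"
    if uv: "u \<le> v" "v < k" "e < ep i" for u v e
  proof -
    \<comment> \<open>Level 0 of chain \<open>v\<close> prescribes the rows
      \<open>u < w i ! (hgt i v - 1)\<close>. This bound exceeds \<open>v\<close>, because the chain
      still exists at its top level, so every \<open>u \<le> v\<close> is included.\<close>
    have "ok i (length (w i) - j) v" using i j uv k by (auto simp: ok_def)
    then have ok0: "ok i 0 v" by (rule ok_mono) simp
    then have h: "0 < hgt i v" by (simp add: ok_iff_hgt)
    then have "ok i (hgt i v - 1) v" by (simp add: ok_iff_hgt)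
    then have "u < w i ! (hgt i v - 1 - 0)" using uv(1) by (simp add: ok_def)
    then have pr: "(u, ep i * (offset (w i) 0 + v) + e) \<in> prescribed_idx (zs ! i) (w i)"
      using prescribed_idx_iff[OF i] ok0 uv(3) by blast
    have "ep i * Suc v \<le> ep i * k" using uv(2) by (intro mult_le_mono2) simp
    then have "S $$ (u, ep i * v + e) = P $$ (I i u, offset ds i + (ep i * v + e))"
      unfolding S_def using corner_index[OF i j P, of u "ep i * v + e"] uv by (simp add: k_def)
    also have "\<dots> = (if ep i * v + e = ep i * u then 1 else 0)"
      using red i pr unfolding reduced_def by (fastforce simp: offset_def)
    also have "ep i * v + e = ep i * u \<longleftrightarrow> v = u \<and> e = 0"
    proof
      assume "ep i * v + e = ep i * u"
      moreover have "ep i * u \<le> ep i * v" using uv(1) by (rule mult_le_mono2)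
      ultimately have "e = 0" "ep i * v = ep i * u" by linarith+
      then show "v = u \<and> e = 0" using ep_pos[of i] by simp
    qed simp
    finally show ?thesis .
  qed
  show "if zs ! i \<in> \<real> then invertible_mat (corner i j P) else invertible_mat (diamond (corner i j P))"
  proof (cases "zs ! i \<in> \<real>")
    case True
    then have ep: "ep i = 1" by (simp add: eps_def)
    have "invertible_mat S"
      by (rule unit_lower_triangular_invertible[of _ k]) (use S ep val[of _ _ 0] in auto)
    then show ?thesis using True by (simp add: S_def)
  next
    case False
    then have ep: "ep i = 2" by (simp add: eps_def)
    have dim: "dim_row S = k" "dim_col S = 2 * k" using S ep by auto
    have "invertible_mat (diamond S)"
    proof (rule unit_lower_triangular_invertible)
      show "diamond S \<in> carrier_mat (2 * k) (2 * k)" by (simp add: diamond_def dim)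
      fix x y assume xy: "x < y" "y < 2 * k"
      have le: "x div 2 \<le> y div 2" "y div 2 < k" using xy by auto
      \<comment> \<open>Inside a diagonal cell the only position above the diagonal is (even, odd),
        which holds the vanishing second coordinate.\<close>
      have "y div 2 = x div 2 \<Longrightarrow> even x \<and> odd y" using xy(1) by presburger
      then show "diamond S $$ (x, y) = 0"
        using val[OF le, of 0] val[OF le, of 1] ep xy by (auto simp: diamond_def dim Let_def)
    next
      fix x assume x: "x < 2 * k"
      define u where "u = x div 2"
      have u: "u < k" "x = 2 * u \<or> x = Suc (2 * u)" using x by (auto simp: u_def)
      have "S $$ (u, 2 * u) = 1" using val[OF order_refl u(1), of 0] ep by simp
      then show "diamond S $$ (x, x) = 1"
        using u by (auto simp: diamond_def dim Let_def)
    qed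
    then show ?thesis using False by (simp add: S_def)
  qed
qed


lemma P_set_iff: "P \<in> P_set A rs \<longleftrightarrow> stacked A rs P \<and> Determinant.det P \<noteq> 0"
proof -
  have "P \<in> carrier_mat n n" if "stacked A rs P"
    using that stacked_iff[OF A_carrier] size by simp
  then show ?thesis
    unfolding P_set_def using A_carrier vec_space.det_rank_iff[of P n] size by auto
qed

lemma P_set_carrier: "P \<in> P_set A rs \<Longrightarrow> P \<in> carrier_mat n n"
  using stacked_iff[OF A_carrier] size by (auto simp: P_set_iff)

text \<open>The rank condition inside \<open>U_set\<close> is automatic: a column block of a
  nonsingular matrix has independent columns.\<close>

lemma V_set_iff: "P \<in> V_set alphas zs rs Iss \<longleftrightarrow> P \<in> P_set A rs \<and> corners_invertible P"
proof -
  have *: "cblock i P \<in> P_set (weyr_block (zs ! i) (w i)) rs" if P: "P \<in> P_set A rs" and i: "i < q" for i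
  proof -
    note Pc = P_set_carrier[OF P]
    have st: "stacked (weyr_block (zs ! i) (w i)) rs (cblock i P)"
      using stacked_blocks[of P] P Pc i size by (simp add: P_set_iff)
    have dim: "dim_row (weyr_block (zs ! i) (w i)) = ds ! i" using weyr_block_carrier[of "zs ! i" "w i"] i by auto
    have cb: "cblock i P \<in> carrier_mat n (ds ! i)" using Pc by (simp add: cblock_def block_def)
    have off: "offset ds i + b < n" if "b < ds ! i" for b using offset_less[of i ds b] i that by simp
    have "vec_space.rank n (cblock i P) = ds ! i"
    proof (rule trivial_kernel_rank[OF cb])
      fix v assume v: "v \<in> carrier_vec (ds ! i)" "cblock i P *\<^sub>v v = 0\<^sub>v n"
      \<comment> \<open>A kernel vector of the column block, extended by 0, is a kernel vector of
        \<open>P\<close>.\<close>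
      define x where "x = vec n (\<lambda>c. if offset ds i \<le> c \<and> c < offset ds i + ds ! i then v $ (c - offset ds i) else 0)"
      have "P *\<^sub>v x = 0\<^sub>v n"
      proof (rule eq_vecI)
        fix a assume a: "a < dim_vec (0\<^sub>v n)"
        have "(P *\<^sub>v x) $ a = (\<Sum>c<n. P $$ (a, c) * x $ c)"
          using a Pc by (simp add: scalar_prod_def atLeast0LessThan x_def)
        also have "\<dots> = (\<Sum>j<length ds. \<Sum>b<ds ! j. P $$ (a, offset ds j + b) * x $ (offset ds j + b))"
          by (rule sum_offset)
        also have "\<dots> = (\<Sum>b<ds ! i. P $$ (a, offset ds i + b) * x $ (offset ds i + b))"
        proof (rule sum_eq_single)
          fix j assume j: "j \<in> {..<length ds}" "j \<noteq> i"
          have "x $ (offset ds j + b) = 0" if b: "b < ds ! j" for b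
          proof -
            have "\<not> (offset ds i \<le> offset ds j + b \<and> offset ds j + b < offset ds i + ds ! i)"
            proof
              assume as: "offset ds i \<le> offset ds j + b \<and> offset ds j + b < offset ds i + ds ! i"
              define b' where "b' = offset ds j + b - offset ds i"
              have "b' < ds ! i" "offset ds j + b = offset ds i + b'" using as unfolding b'_def by linarith+
              then show False using offset_inj[of j ds b i b'] j b i by simp
            qed
            moreover have "offset ds j + b < n" using offset_less[of j ds b] j b by simp
            ultimately show ?thesis unfolding x_def by (subst index_vec) (simp_all only: if_False)
          qed
          then show "(\<Sum>b<ds ! j. P $$ (a, offset ds j + b) * x $ (offset ds j + b)) = 0" by simp
        qed (use i in auto)
        also have "\<dots> = (\<Sum>b<ds ! i. cblock i P $$ (a, b) * v $ b)"
          using a Pc off by (intro sum.cong) (auto simp: x_def cblock_index)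
        also have "\<dots> = (cblock i P *\<^sub>v v) $ a"
          using a cb v(1) by (simp add: scalar_prod_def atLeast0LessThan)
        finally show "(P *\<^sub>v x) $ a = 0\<^sub>v n $ a" using v(2) by simp
      qed (use Pc in simp)
      moreover have "x \<in> carrier_vec n" by (simp add: x_def)
      ultimately have "x = 0\<^sub>v n" using det_0_iff_vec_prod_zero[OF Pc] P unfolding P_set_iff by blast
      show "v = 0\<^sub>v (ds ! i)"
      proof (rule eq_vecI)
        fix b assume b: "b < dim_vec (0\<^sub>v (ds ! i))"
        then have "x $ (offset ds i + b) = v $ b" using off by (simp add: x_def)
        then show "v $ b = 0\<^sub>v (ds ! i) $ b" using \<open>x = 0\<^sub>v n\<close> off b by simp
      qed (use v in simp)
    qed
    then show ?thesis using st dim size by (simp add: P_set_def)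
  qed
  have "col_block alphas zs i P \<in> U_set (zs ! i) (w i) rs (Iss ! i) \<longleftrightarrow>
     (\<forall>j\<in>{1..length (w i)}. if zs ! i \<in> \<real> then invertible_mat (corner i j P) else invertible_mat (diamond (corner i j P)))"
    if "P \<in> P_set A rs" "i < q" for i
    unfolding U_set_def col_block_eq corner_def Let_def using *[OF that] by simp
  then show ?thesis
    unfolding V_set_def weyr_form_eq corners_invertible_def by blast
qed

lemma commutes_mat:
  assumes X: "X \<in> carrier_mat n n"
  shows "commutes (\<lambda>b c. X $$ (b, c)) \<longleftrightarrow> X * A = A * X"
proof
  assume c: "commutes (\<lambda>b c. X $$ (b, c))"
  show "X * A = A * X"
  proof (rule eq_matI)
    fix a b assume "a < dim_row (A * X)" "b < dim_col (A * X)"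
    then have ab: "a < n" "b < n" using A_carrier X by auto
    show "(X * A) $$ (a, b) = (A * X) $$ (a, b)"
      using index_mult_mat_sum[OF X A_carrier ab] index_mult_mat_sum[OF A_carrier X ab] c ab
      by (simp add: commutes_def)
  qed (use A_carrier X in auto)
next
  assume eq: "X * A = A * X"
  show "commutes (\<lambda>b c. X $$ (b, c))"
    unfolding commutes_def
  proof (intro allI impI)
    fix a b assume ab: "a < n" "b < n"
    show "(\<Sum>c<n. A $$ (a, c) * X $$ (c, b)) = (\<Sum>c<n. X $$ (a, c) * A $$ (c, b))"
      unfolding index_mult_mat_sum[OF X A_carrier ab, symmetric] index_mult_mat_sum[OF A_carrier X ab, symmetric] eq ..
  qed
qed

lemma commutant_prescribed_zero:
  assumes P: "P \<in> carrier_mat n n" "row_inj (\<lambda>u c. P $$ (u, c)) I"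
    and X: "X \<in> carrier_mat n n" "X * A = A * X"
    and zero: "\<And>i u c. i < q \<Longrightarrow> (u, c) \<in> prescribed_idx (zs ! i) (w i) \<Longrightarrow> (P * X) $$ (I i u, offset ds i + c) = 0"
  shows "X = 0\<^sub>m n n"
proof (rule eq_matI)
  fix a b assume "a < dim_row (0\<^sub>m n n)" "b < dim_col (0\<^sub>m n n)"
  then have ab: "a < n" "b < n" by auto
  have "X $$ (a, b) = 0"
  proof (rule commutant_unique[OF P(2) _ _ ab])
    show "commutes (\<lambda>b c. X $$ (b, c))" using X commutes_mat by blast
    fix i l v u assume ok: "ok i l v" and u: "u < w i ! (hgt i v - 1 - l)"
    note i = okD(1)[OF ok]
    show "hat (\<lambda>c. \<Sum>b<n. P $$ (I i u, b) * X $$ (b, c)) i l v = 0"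
      unfolding hat_def
    proof (rule sum.neutral, rule ballI)
      fix e assume e: "e \<in> {..<ep i}"
      have pr: "(u, ep i * (offset (w i) l + v) + e) \<in> prescribed_idx (zs ! i) (w i)"
        using prescribed_idx_iff[OF i] ok u e by blast
      have row: "I i u < n" using prescribed_row(2)[OF i pr] by (rule row_less)
      have "(\<Sum>b<n. P $$ (I i u, b) * X $$ (b, gc i l v e)) = (P * X) $$ (I i u, gc i l v e)"
        using index_mult_mat_sum[OF P(1) X(1) row gc_less[OF ok]] e by simp
      also have "\<dots> = 0" using zero[OF i pr] by (simp add: gc_def)
      finally show "of_real (\<Sum>b<n. P $$ (I i u, b) * X $$ (b, gc i l v e)) * om \<i> e = 0" by simp
    qed
  qed
  then show "X $$ (a, b) = 0\<^sub>m n n $$ (a, b)" using ab by simp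
qed (use X in auto)

lemma commutant_prescribed_ex:
  assumes P: "P \<in> carrier_mat n n" "row_inj (\<lambda>u c. P $$ (u, c)) I"
  shows "\<exists>X\<in>carrier_mat n n. X * A = A * X \<and>
    (\<forall>i u c. i < q \<longrightarrow> (u, c) \<in> prescribed_idx (zs ! i) (w i) \<longrightarrow>
      (P * X) $$ (I i u, offset ds i + c) = G $$ (I i u, offset ds i + c))"
proof -
  obtain X where X: "commutes X" "\<forall>i l v u. ok i l v \<longrightarrow> u < w i ! (hgt i v - 1 - l) \<longrightarrow>
    hat (\<lambda>c. \<Sum>b<n. P $$ (I i u, b) * X b c) i l v = hat (\<lambda>c. G $$ (I i u, c)) i l v"
    using commutant_exists[OF P(2), of "\<lambda>u c. G $$ (u, c)"] by blast
  define M where "M = mat n n (\<lambda>(b, c). X b c)"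
  have M: "M \<in> carrier_mat n n" by (simp add: M_def)
  have "commutes (\<lambda>b c. M $$ (b, c))" using X(1) by (simp add: commutes_def M_def)
  then have "M * A = A * M" using commutes_mat[OF M] by blast
  moreover have "(P * M) $$ (I i u, offset ds i + c) = G $$ (I i u, offset ds i + c)"
    if i: "i < q" and pr: "(u, c) \<in> prescribed_idx (zs ! i) (w i)" for i u c
  proof -
    obtain l v e where k: "ok i l v" "e < ep i" "u < w i ! (hgt i v - 1 - l)" "c = ep i * (offset (w i) l + v) + e"
      using prescribed_idx_iff[OF i] pr by blast
    have row: "I i u < n" using prescribed_row(2)[OF i pr] by (rule row_less)
    have c: "offset ds i + c = gc i l v e" by (simp add: gc_def k)
    have "hat (\<lambda>c. \<Sum>b<n. P $$ (I i u, b) * X b c) i l v = hat (\<lambda>c. G $$ (I i u, c)) i l v"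
      using X(2) k by blast
    from hat_eqD[OF this k(2)] have "(\<Sum>b<n. P $$ (I i u, b) * X b (gc i l v e)) = G $$ (I i u, gc i l v e)" .
    moreover have "(P * M) $$ (I i u, gc i l v e) = (\<Sum>b<n. P $$ (I i u, b) * X b (gc i l v e))"
      unfolding index_mult_mat_sum[OF P(1) M row gc_less[OF k(1,2)]]
      by (rule sum.cong) (use gc_less[OF k(1,2)] in \<open>auto simp: M_def\<close>)
    ultimately show ?thesis unfolding c by simp
  qed
  ultimately show ?thesis using M by blast
qed

lemma add_commutant:
  assumes "X \<in> carrier_mat n n" "X * A = A * X"
  shows "(X - 1\<^sub>m n) * A = A * (X - 1\<^sub>m n)"
  using assms A_carrier minus_mult_distrib_mat[OF assms(1) one_carrier_mat A_carrier]
    mult_minus_distrib_mat[OF A_carrier assms(1) one_carrier_mat] by simp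

text \<open>The homogeneous uniqueness statement applied to X - 1.\<close>

lemma commutant_eq_one:
  assumes P: "P \<in> carrier_mat n n" "row_inj (\<lambda>u c. P $$ (u, c)) I"
    and X: "X \<in> carrier_mat n n" "X * A = A * X"
    and eq: "\<And>i u c. i < q \<Longrightarrow> (u, c) \<in> prescribed_idx (zs ! i) (w i) \<Longrightarrow>
      (P * X) $$ (I i u, offset ds i + c) = P $$ (I i u, offset ds i + c)"
  shows "X = 1\<^sub>m n"
proof -
  define Z where "Z = X - 1\<^sub>m n"
  have Z: "Z \<in> carrier_mat n n" using X(1) by (simp add: Z_def minus_carrier_mat)
  have PZ: "P * Z = P * X - P" unfolding Z_def
    using mult_minus_distrib_mat[OF P(1) X(1) one_carrier_mat] P(1) by simp
  have "Z = 0\<^sub>m n n"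
  proof (rule commutant_prescribed_zero[OF P Z])
    show "Z * A = A * Z" unfolding Z_def by (rule add_commutant[OF X])
    fix i u c assume i: "i < q" and pr: "(u, c) \<in> prescribed_idx (zs ! i) (w i)"
    have "I i u < n" using prescribed_row(2)[OF i pr] by (rule row_less)
    moreover have "offset ds i + c < n" using offset_less[of i ds c] prescribed_row(3)[OF i pr] i by simp
    ultimately show "(P * Z) $$ (I i u, offset ds i + c) = 0"
      unfolding PZ using eq[OF i pr] P(1) X(1) by simp
  qed
  show ?thesis
  proof (rule eq_matI)
    fix a b assume ab: "a < dim_row (1\<^sub>m n)" "b < dim_col (1\<^sub>m n)"
    then have "Z $$ (a, b) = 0" using \<open>Z = 0\<^sub>m n n\<close> by simp
    then show "X $$ (a, b) = 1\<^sub>m n $$ (a, b)" using ab X(1) by (simp add: Z_def)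
  qed (use X in auto)
qed

lemma centralizer_group_iff:
  "X \<in> centralizer_group A \<longleftrightarrow> X \<in> carrier_mat n n \<and> invertible_mat X \<and> X * A = A * X"
  unfolding centralizer_group_def using A_carrier by auto

lemma P_set_mult:
  assumes P: "P \<in> P_set A rs" and X: "X \<in> centralizer_group A"
  shows "P * X \<in> P_set A rs"
proof -
  have X': "X \<in> carrier_mat n n" "X * A = A * X" "Determinant.det X \<noteq> 0"
    using X invertible_mat_iff_det[of X n] by (auto simp: centralizer_group_iff)
  have "stacked A rs (P * X)" using stacked_mult[OF A_carrier _ X'(1,2)] P by (simp add: P_set_iff)
  moreover have "Determinant.det (P * X) \<noteq> 0"
    using det_mult[OF P_set_carrier[OF P] X'(1)] X'(3) P by (simp add: P_set_iff)
  ultimately show ?thesis by (simp add: P_set_iff)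
qed

lemma orbit_eqD:
  assumes "P \<in> P_set A rs" "cent_orbit A P = cent_orbit A P'"
  shows "\<exists>X\<in>centralizer_group A. P = P' * X"
proof -
  have "1\<^sub>m n \<in> centralizer_group A"
    using A_carrier invertible_mat_iff_det[of "1\<^sub>m n :: real mat" n] by (simp add: centralizer_group_iff)
  then have "P * 1\<^sub>m n \<in> cent_orbit A P" unfolding cent_orbit_def by blast
  then have "P \<in> cent_orbit A P'"
    unfolding right_mult_one_mat[OF P_set_carrier[OF assms(1)]] assms(2) .
  then show ?thesis unfolding cent_orbit_def by auto
qed

lemma centralizer_inverse:
  assumes "X \<in> centralizer_group A"
  obtains Z where "Z \<in> centralizer_group A" "X * Z = 1\<^sub>m n" "Z * X = 1\<^sub>m n"
proof -
  have X: "X \<in> carrier_mat n n" "invertible_mat X" "X * A = A * X"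
    using assms by (auto simp: centralizer_group_iff)
  define Y where "Y = (1 / Determinant.det X) \<cdot>\<^sub>m adj_mat X"
  have nz: "Determinant.det X \<noteq> 0" using X invertible_mat_iff_det by blast
  have Y: "Y \<in> carrier_mat n n" using adj_mat(1)[OF X(1)] by (simp add: Y_def)
  have XY: "X * Y = 1\<^sub>m n"
    unfolding Y_def mult_smult_distrib[OF X(1) adj_mat(1)[OF X(1)]] adj_mat(2)[OF X(1)] using nz
    by (intro eq_matI) auto
  have YX: "Y * X = 1\<^sub>m n" by (rule mat_mult_left_right_inverse[OF X(1) Y XY])
  have "Y * A = (Y * A) * (X * Y)" unfolding XY using Y A_carrier by simp
  also have "\<dots> = Y * (A * X) * Y"
    using assoc_mult_mat[OF mult_carrier_mat[OF Y A_carrier] X(1) Y] assoc_mult_mat[OF Y A_carrier X(1)] by simp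
  also have "\<dots> = (Y * X) * A * Y"
    unfolding X(3)[symmetric] using assoc_mult_mat[OF Y X(1) A_carrier] by simp
  also have "\<dots> = A * Y" unfolding YX using A_carrier by simp
  finally have "Y * A = A * Y" .
  moreover have "invertible_mat Y"
    using X(1) Y XY YX by (auto simp: invertible_mat_def inverts_mat_def)
  ultimately show thesis using that Y XY YX by (simp add: centralizer_group_iff)
qed

lemma centralizer_mult:
  assumes "X \<in> centralizer_group A" "Z \<in> centralizer_group A"
  shows "X * Z \<in> centralizer_group A"
proof -
  have X: "X \<in> carrier_mat n n" "Determinant.det X \<noteq> 0" "X * A = A * X"
    and Z: "Z \<in> carrier_mat n n" "Determinant.det Z \<noteq> 0" "Z * A = A * Z"
    using assms invertible_mat_iff_det[of _ n] by (auto simp: centralizer_group_iff)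
  have "(X * Z) * A = X * (A * Z)" using assoc_mult_mat[OF X(1) Z(1) A_carrier] Z(3) by simp
  also have "\<dots> = A * (X * Z)"
    using assoc_mult_mat[OF X(1) A_carrier Z(1)] assoc_mult_mat[OF A_carrier X(1) Z(1)] X(3) by simp
  finally have "(X * Z) * A = A * (X * Z)" .
  then show ?thesis
    using invertible_mat_iff_det[OF mult_carrier_mat[OF X(1) Z(1)]] det_mult[OF X(1) Z(1)] X Z
    by (simp add: centralizer_group_iff)
qed

lemma orbit_mult:
  assumes P: "P \<in> P_set A rs" and X: "X \<in> centralizer_group A"
  shows "cent_orbit A (P * X) = cent_orbit A P"
proof -
  obtain Y where Y: "Y \<in> centralizer_group A" "X * Y = 1\<^sub>m n" by (rule centralizer_inverse[OF X])
  note Pc = P_set_carrier[OF P]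
  have c: "Z \<in> carrier_mat n n" if "Z \<in> centralizer_group A" for Z using that by (simp add: centralizer_group_iff)
  show ?thesis
  proof (rule subset_antisym; rule subsetI)
    fix R assume "R \<in> cent_orbit A (P * X)"
    then obtain Z where Z: "Z \<in> centralizer_group A" "R = P * X * Z" unfolding cent_orbit_def by blast
    then have "R = P * (X * Z)" using assoc_mult_mat[OF Pc c[OF X] c[OF Z(1)]] by simp
    then show "R \<in> cent_orbit A P" using centralizer_mult[OF X Z(1)] unfolding cent_orbit_def by blast
  next
    fix R assume "R \<in> cent_orbit A P"
    then obtain Z where Z: "Z \<in> centralizer_group A" "R = P * Z" unfolding cent_orbit_def by blast
    have "P * X * (Y * Z) = P * ((X * Y) * Z)"
      using assoc_mult_mat[OF Pc c[OF X] mult_carrier_mat[OF c[OF Y(1)] c[OF Z(1)]]]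
        assoc_mult_mat[OF c[OF X] c[OF Y(1)] c[OF Z(1)]] by simp
    then have "R = P * X * (Y * Z)" using Z(2) Y(2) c[OF Z(1)] by simp
    then show "R \<in> cent_orbit A (P * X)" using centralizer_mult[OF Y(1) Z(1)] unfolding cent_orbit_def by blast
  qed
qed

text \<open>The matrix relating two reduced members of an orbit preserves all prescribed entries,
  and only the identity does that.\<close>

lemma reduced_unique:
  assumes P: "P \<in> P_set A rs" "reduced P" and P': "P' \<in> P_set A rs" "reduced P'"
    and orb: "cent_orbit A P = cent_orbit A P'"
  shows "P = P'"
proof -
  obtain X where X: "X \<in> centralizer_group A" "P = P' * X" using orbit_eqD[OF P(1) orb] by blast
  note c = P_set_carrier[OF P'(1)]
  have "X = 1\<^sub>m n"
  proof (rule commutant_eq_one[OF c corners_row_inj[OF c reduced_corners[OF c P'(2)]]])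
    fix i u c assume i: "i < q" and pr: "(u, c) \<in> prescribed_idx (zs ! i) (w i)"
    have "P $$ (I i u, offset ds i + c) = (if c = ep i * u then 1 else 0)"
      "P' $$ (I i u, offset ds i + c) = (if c = ep i * u then 1 else 0)"
      using P(2) P'(2) i pr unfolding reduced_def by fastforce+
    then show "(P' * X) $$ (I i u, offset ds i + c) = P' $$ (I i u, offset ds i + c)"
      unfolding X(2)[symmetric] by simp
  qed (use X in \<open>simp_all add: centralizer_group_iff\<close>)
  then show ?thesis using X(2) c by simp
qed

definition target :: "real mat" where
  "target = mat n n (\<lambda>(a, b). if \<exists>i u c. i < q \<and> (u, c) \<in> prescribed_idx (zs ! i) (w i) \<and>
      a = I i u \<and> b = offset ds i + c \<and> c = ep i * u then 1 else 0)"

text \<open>The prescribed values are consistent as entries of one matrix: blocks use different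
  columns, and within a block distinct positions in the index sequence are distinct rows.\<close>

lemma target_index:
  assumes i: "i < q" and pr: "(u, c) \<in> prescribed_idx (zs ! i) (w i)"
  shows "target $$ (I i u, offset ds i + c) = (if c = ep i * u then 1 else 0)"
proof -
  have row: "I i u < n" using prescribed_row(2)[OF i pr] by (rule row_less)
  have col: "offset ds i + c < n" using offset_less[of i ds c] prescribed_row(3)[OF i pr] i by simp
  have "(\<exists>i' u' c'. i' < q \<and> (u', c') \<in> prescribed_idx (zs ! i') (w i') \<and>
    I i u = I i' u' \<and> offset ds i + c = offset ds i' + c' \<and> c' = ep i' * u') \<longleftrightarrow> c = ep i * u"
  proof
    assume "\<exists>i' u' c'. i' < q \<and> (u', c') \<in> prescribed_idx (zs ! i') (w i') \<and>
      I i u = I i' u' \<and> offset ds i + c = offset ds i' + c' \<and> c' = ep i' * u'"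
    then obtain i' u' c' where *: "i' < q" "(u', c') \<in> prescribed_idx (zs ! i') (w i')"
      "I i u = I i' u'" "offset ds i + c = offset ds i' + c'" "c' = ep i' * u'" by blast
    have ic: "i = i'" "c = c'"
      using offset_inj[of i ds c i' c'] *(4) prescribed_row(3)[OF i pr] prescribed_row(3)[OF *(1,2)] i *(1) by auto
    have "w i \<noteq> []" using pr unfolding prescribed_idx_def by auto
    then have "length (w i) \<in> {1..length (w i)}" by (simp add: Suc_le_eq)
    from idx_props(2)[OF i this] have "u = u'"
      using *(2,3) ic prescribed_row(1)[OF i pr] prescribed_row(1)[OF *(1,2)] idx_length[OF i]
      by (simp add: I_def nth_eq_iff_index_eq)
    then show "c = ep i * u" using *(5) ic by simp
  qed (use i pr in blast)
  then show ?thesis using row col by (simp add: target_def)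
qed

text \<open>The linear system yields a commuting X with PX reduced, but says nothing about
  invertibility. Since the reduced matrix has invertible corners too, the system can be solved back
  towards P by some Y; then P and P(XY) share the prescribed entries, and uniqueness gives XY =
  1.\<close>

lemma reduced_exists:
  assumes P: "P \<in> V_set alphas zs rs Iss"
  shows "\<exists>X\<in>centralizer_group A. reduced (P * X)"
proof -
  have PV: "P \<in> P_set A rs" "corners_invertible P" using P V_set_iff by auto
  note Pc = P_set_carrier[OF PV(1)]
  note Pinj = corners_row_inj[OF Pc PV(2)]
  obtain X where X: "X \<in> carrier_mat n n" "X * A = A * X"
    "\<And>i u c. i < q \<Longrightarrow> (u, c) \<in> prescribed_idx (zs ! i) (w i) \<Longrightarrow> (P * X) $$ (I i u, offset ds i + c) = target $$ (I i u, offset ds i + c)"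
    using commutant_prescribed_ex[OF Pc Pinj, of target] by blast
  define R where "R = P * X"
  have Rc: "R \<in> carrier_mat n n" using Pc X(1) by (simp add: R_def)
  have red: "reduced R" unfolding reduced_def R_def using X(3) target_index by auto
  obtain Y where Y: "Y \<in> carrier_mat n n" "Y * A = A * Y"
    "\<And>i u c. i < q \<Longrightarrow> (u, c) \<in> prescribed_idx (zs ! i) (w i) \<Longrightarrow> (R * Y) $$ (I i u, offset ds i + c) = P $$ (I i u, offset ds i + c)"
    using commutant_prescribed_ex[OF Rc corners_row_inj[OF Rc reduced_corners[OF Rc red]], of P] by blast
  have PXY: "P * (X * Y) = R * Y" using assoc_mult_mat[OF Pc X(1) Y(1)] by (simp add: R_def)
  have "(X * Y) * A = X * (A * Y)" using assoc_mult_mat[OF X(1) Y(1) A_carrier] Y(2) by simp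
  also have "\<dots> = A * (X * Y)"
    using assoc_mult_mat[OF X(1) A_carrier Y(1)] assoc_mult_mat[OF A_carrier X(1) Y(1)] X(2) by simp
  finally have "X * Y = 1\<^sub>m n"
    by (intro commutant_eq_one[OF Pc Pinj mult_carrier_mat[OF X(1) Y(1)]]) (simp_all add: PXY Y(3))
  then have "invertible_mat X"
    using mat_mult_left_right_inverse[OF X(1) Y(1)] X(1) Y(1) by (auto simp: invertible_mat_def inverts_mat_def)
  then have "X \<in> centralizer_group A" using X by (simp add: centralizer_group_iff)
  then show ?thesis using red unfolding R_def by blast
qed

lemma reduced_V_set: "P \<in> P_set A rs \<Longrightarrow> reduced P \<Longrightarrow> P \<in> V_set alphas zs rs Iss"
  using V_set_iff reduced_corners P_set_carrier by blast

end

section \<open>Linear coordinates on stacked matrices and the parametrization\<close>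

lemma div_mod_pair:
  fixes c m :: nat
  assumes "c < m" shows "(u * m + c) div m = u" "(u * m + c) mod m = c"
  using assms by (simp_all add: div_mult_self3)

lemma div_mod_less:
  fixes k m :: nat
  assumes "k < r * m" shows "k div m < r" "k mod m < m"
proof -
  have "0 < m" using assms by (cases m) auto
  then show "k div m < r" "k mod m < m" using assms by (simp_all add: div_less_iff_less_mult)
qed

locale weyr_slice = weyr_index +
  fixes fs :: "(nat \<times> nat \<times> nat) list"
  assumes fs_distinct: "distinct fs" and fs_set: "set fs = free_pos (hd rs) alphas zs Iss"
begin

abbreviation "r \<equiv> hd rs"

text \<open>The inverse of the global chart: \<open>y\<close> lists the first block row by row, with
  rows of length \<open>n\<close>.\<close>

definition build :: "(nat \<Rightarrow> real) \<Rightarrow> real mat" where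
  "build y = rebuild A rs (mat r n (\<lambda>(u, c). y (u * n + c)))"

definition lin :: "nat \<times> nat \<times> nat \<Rightarrow> nat" where
  "lin = (\<lambda>(i, u, b). u * n + (offset ds i + b))"

lemma lin_cases:
  assumes "k < r * n"
  obtains i u b where "i < q" "u < r" "b < ds ! i" "k = lin (i, u, b)"
proof -
  note dm = div_mod_less[OF assms]
  from dm(2) obtain i b where ib: "i < length ds" "b < ds ! i" "k mod n = offset ds i + b" by (rule offset_cases)
  have "k = k div n * n + (offset ds i + b)" unfolding ib(3)[symmetric] by simp
  then have "k = lin (i, k div n, b)" by (simp only: lin_def prod.case)
  then show thesis using that[of i "k div n" b] dm(1) ib by simp
qed

lemma lin_div_mod:
  assumes "i < q" "b < ds ! i"
  shows "lin (i, u, b) div n = u" "lin (i, u, b) mod n = offset ds i + b" "offset ds i + b < n"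
proof -
  show *: "offset ds i + b < n" using offset_less[of i ds b] assms by simp
  show "lin (i, u, b) div n = u" "lin (i, u, b) mod n = offset ds i + b"
    using div_mod_pair[OF *] by (simp_all add: lin_def)
qed

lemma lin_less: "i < q \<Longrightarrow> b < ds ! i \<Longrightarrow> u < r \<Longrightarrow> lin (i, u, b) < r * n"
proof -
  assume "i < q" "b < ds ! i" and u: "u < r"
  then have "lin (i, u, b) < Suc u * n" using lin_div_mod(3)[of i b] by (simp add: lin_def)
  also have "\<dots> \<le> r * n" using u by (intro mult_le_mono1) simp
  finally show ?thesis .
qed

lemma lin_inj:
  assumes "i < q" "b < ds ! i" "i' < q" "b' < ds ! i'" "lin (i, u, b) = lin (i', u', b')"
  shows "(i, u, b) = (i', u', b')"
proof -
  have "u = u'" using lin_div_mod(1)[OF assms(1,2), of u] lin_div_mod(1)[OF assms(3,4), of u'] assms(5) by simp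
  moreover have "offset ds i + b = offset ds i' + b'"
    using lin_div_mod(2)[OF assms(1,2), of u] lin_div_mod(2)[OF assms(3,4), of u'] assms(5) by simp
  ultimately show ?thesis using offset_inj[of i ds b i' b'] assms by simp
qed

lemma build_first: "first (build y) = mat r n (\<lambda>(u, c). y (u * n + c))"
  unfolding build_def by (rule first_rebuild[OF A_carrier]) simp

lemma build_stacked: "stacked A rs (build y)"
  unfolding build_def by (rule stacked_rebuild[OF A_carrier]) simp

lemma build_carrier: "build y \<in> carrier_mat n n"
  using rebuild_carrier[OF A_carrier] size by (simp add: build_def)

lemma first_entry: "P \<in> carrier_mat n n \<Longrightarrow> u < r \<Longrightarrow> c < n \<Longrightarrow> first P $$ (u, c) = P $$ (u, c)"
  by (rule first_index) auto

lemma build_index: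
  assumes "u < r" "c < n" shows "build y $$ (u, c) = y (u * n + c)"
  using first_entry[OF build_carrier assms] assms by (simp add: build_first)

lemma build_entry:
  assumes "l < length rs" "u < rs ! l" "c < n"
  shows "build y $$ (offset rs l + u, c) = (\<Sum>b<n. y (u * n + b) * (A ^\<^sub>m l) $$ (b, c))"
proof -
  let ?F = "mat r n (\<lambda>(u, c). y (u * n + c))"
  have F: "?F \<in> carrier_mat r n" and Al: "A ^\<^sub>m l \<in> carrier_mat n n" using A_carrier by simp_all
  have u: "u < r" using rs_le[OF assms(1)] assms(2) by simp
  have "build y $$ (offset rs l + u, c) = (?F * A ^\<^sub>m l) $$ (u, c)"
    unfolding build_def by (rule rebuild_index[OF A_carrier assms])
  also have "\<dots> = (\<Sum>b<n. ?F $$ (u, b) * (A ^\<^sub>m l) $$ (b, c))"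
    by (rule index_mult_mat_sum[OF F Al u assms(3)])
  also have "\<dots> = (\<Sum>b<n. y (u * n + b) * (A ^\<^sub>m l) $$ (b, c))"
    using u by (intro sum.cong) auto
  finally show ?thesis .
qed

lemma eq_buildI:
  assumes P: "stacked A rs P" and eq: "\<And>u c. u < r \<Longrightarrow> c < n \<Longrightarrow> P $$ (u, c) = y (u * n + c)"
  shows "P = build y"
proof (rule stacked_eqI[OF A_carrier P build_stacked])
  have Pc: "P \<in> carrier_mat n n" using P stacked_iff[OF A_carrier] size by simp
  show "first P = first (build y)"
  proof (rule eq_matI)
    fix u c assume "u < dim_row (first (build y))" "c < dim_col (first (build y))"
    then have uc: "u < r" "c < n" by (simp_all add: build_first)
    show "first P $$ (u, c) = first (build y) $$ (u, c)"
      using first_entry[OF Pc uc] eq[OF uc] uc by (simp add: build_first)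
  qed (use first_carrier[of P] Pc in \<open>auto simp: build_first\<close>)
qed

lemma build_coords: "stacked A rs P \<Longrightarrow> build (mat_coords r n P) = P"
proof (rule eq_buildI[symmetric])
  fix u c assume uc: "u < r" "c < n"
  have "u * n + c < Suc u * n" using uc by simp
  also have "\<dots> \<le> r * n" using uc by (intro mult_le_mono1) simp
  finally show "P $$ (u, c) = mat_coords r n P (u * n + c)" using div_mod_pair[OF uc(2)] by (simp add: mat_coords_def)
qed

lemma coords_build:
  assumes "\<forall>k\<ge>r * n. y k = 0" shows "mat_coords r n (build y) = y"
proof (rule ext)
  fix k show "mat_coords r n (build y) k = y k"
  proof (cases "k < r * n")
    case True
    then have "k div n < r" "k mod n < n" by (rule div_mod_less)+
    then show ?thesis using True build_index[of "k div n" "k mod n" y] by (simp add: mat_coords_def)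
  qed (use assms in \<open>simp add: mat_coords_def\<close>)
qed

definition \<sigma> :: "nat \<Rightarrow> nat option" where
  "\<sigma> k = (if \<exists>m<length fs. lin (fs ! m) = k then Some (THE m. m < length fs \<and> lin (fs ! m) = k) else None)"

definition L :: "(nat \<Rightarrow> real) \<Rightarrow> nat \<Rightarrow> real" where
  "L x k = (if k < r * n then case \<sigma> k of Some m \<Rightarrow> x m | None \<Rightarrow> target $$ (k div n, k mod n) else 0)"

lemma fsD: "m < length fs \<Longrightarrow> \<exists>i u b. fs ! m = (i, u, b) \<and> i < q \<and> u < r \<and> b < ds ! i \<and>
   (u, b) \<notin> prescribed_pos (zs ! i) (w i) (Iss ! i)"
  using nth_mem[of m fs] unfolding fs_set free_pos_def by auto

lemma lin_fs_inj:
  assumes "m < length fs" "m' < length fs" "lin (fs ! m) = lin (fs ! m')"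
  shows "m = m'"
proof -
  obtain i u b where 1: "fs ! m = (i, u, b)" "i < q" "b < ds ! i" using fsD[OF assms(1)] by blast
  obtain i' u' b' where 2: "fs ! m' = (i', u', b')" "i' < q" "b' < ds ! i'" using fsD[OF assms(2)] by blast
  have "fs ! m = fs ! m'" using lin_inj[OF 1(2,3) 2(2,3), of u u'] assms(3) 1(1) 2(1) by simp
  then show ?thesis using fs_distinct assms by (simp add: nth_eq_iff_index_eq)
qed

lemma sigma_Some_iff: "\<sigma> k = Some m \<longleftrightarrow> m < length fs \<and> lin (fs ! m) = k"
proof -
  have "(THE m. m < length fs \<and> lin (fs ! m) = k) = m" if "m < length fs" "lin (fs ! m) = k" for m
    using that lin_fs_inj by (intro the_equality) auto
  then show ?thesis unfolding \<sigma>_def by auto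
qed

lemma sigma_None_lin:
  assumes "i < q" "u < r" "b < ds ! i"
  shows "\<sigma> (lin (i, u, b)) = None \<longleftrightarrow> (u, b) \<in> prescribed_pos (zs ! i) (w i) (Iss ! i)"
proof
  assume N: "\<sigma> (lin (i, u, b)) = None"
  show "(u, b) \<in> prescribed_pos (zs ! i) (w i) (Iss ! i)"
  proof (rule ccontr)
    assume "(u, b) \<notin> prescribed_pos (zs ! i) (w i) (Iss ! i)"
    then have "(i, u, b) \<in> set fs" unfolding fs_set free_pos_def using assms by simp
    then obtain m where "m < length fs" "fs ! m = (i, u, b)" by (auto simp: in_set_conv_nth)
    then have "\<sigma> (lin (i, u, b)) = Some m" by (simp add: sigma_Some_iff)
    then show False using N by simp
  qed
next
  assume P: "(u, b) \<in> prescribed_pos (zs ! i) (w i) (Iss ! i)"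
  show "\<sigma> (lin (i, u, b)) = None"
  proof (rule ccontr)
    assume "\<sigma> (lin (i, u, b)) \<noteq> None"
    then obtain m where m: "m < length fs" "lin (fs ! m) = lin (i, u, b)" by (auto simp: sigma_Some_iff)
    obtain i' u' b' where 1: "fs ! m = (i', u', b')" "i' < q" "b' < ds ! i'"
      "(u', b') \<notin> prescribed_pos (zs ! i') (w i') (Iss ! i')" using fsD[OF m(1)] by blast
    then have "(i', u', b') = (i, u, b)" using lin_inj[OF 1(2,3) assms(1,3), of u' u] m(2) by simp
    then show False using 1(4) P by simp
  qed
qed

lemma prescribed_pos_iff:
  assumes i: "i < q"
  shows "(u, b) \<in> prescribed_pos (zs ! i) (w i) (Iss ! i) \<longleftrightarrow> (\<exists>u'. u = I i u' \<and> (u', b) \<in> prescribed_idx (zs ! i) (w i))"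
  unfolding prescribed_pos_eq by (auto simp: I_def)

lemma L_prescribed:
  assumes i: "i < q" and pr: "(u, c) \<in> prescribed_idx (zs ! i) (w i)"
  shows "L x (lin (i, I i u, c)) = (if c = ep i * u then 1 else 0)"
proof -
  note b = prescribed_row(2,3)[OF assms]
  have "\<sigma> (lin (i, I i u, c)) = None"
    using sigma_None_lin[OF i b] prescribed_pos_iff[OF i] pr by blast
  then show ?thesis
    using lin_less[OF i b(2,1)] lin_div_mod[OF i b(2)] target_index[OF assms] by (simp add: L_def)
qed

lemma L_free:
  assumes "m < length fs" shows "L x (lin (fs ! m)) = x m"
proof -
  obtain i u b where 1: "fs ! m = (i, u, b)" "i < q" "u < r" "b < ds ! i" using fsD[OF assms] by blast
  have "\<sigma> (lin (fs ! m)) = Some m" using assms sigma_Some_iff by blast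
  then show ?thesis using lin_less[OF 1(2,4,3)] by (simp add: L_def 1(1))
qed

lemma build_lin:
  assumes "i < q" "u < r" "b < ds ! i"
  shows "build y $$ (u, offset ds i + b) = y (lin (i, u, b))"
  using build_index[OF assms(2) lin_div_mod(3)[OF assms(1,3)]] by (simp add: lin_def)

lemma build_L_reduced: "reduced (build (L x))"
  unfolding reduced_def
proof (intro allI impI ballI, clarify)
  fix i u c assume i: "i < q" and pr: "(u, c) \<in> prescribed_idx (zs ! i) (w i)"
  show "build (L x) $$ (I i u, offset ds i + c) = (if c = ep i * u then 1 else 0)"
    using build_lin[OF i prescribed_row(2,3)[OF i pr]] L_prescribed[OF i pr] by simp
qed

lemma build_L_free: "m < length fs \<Longrightarrow> fs ! m = (i, u, b) \<Longrightarrow> build (L x) $$ (u, offset ds i + b) = x m"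
  using fsD[of m] build_lin[of i u b "L x"] L_free[of m x] by auto

lemma reduced_shape_eq:
  assumes R: "R \<in> carrier_mat n n"
  shows "(\<forall>i<q. reduced_shape (zs ! i) (w i) rs (Iss ! i) (cblock i R)) \<longleftrightarrow> stacked A rs R \<and> reduced R"
proof -
  have cb: "cblock i R \<in> carrier_mat n (ep i * sum_list (w i))" if "i < q" for i
    using R that by (simp add: cblock_def block_def)
  have "reduced_shape (zs ! i) (w i) rs (Iss ! i) (cblock i R) \<longleftrightarrow> stacked (weyr_block (zs ! i) (w i)) rs (cblock i R) \<and>
    (\<forall>(u, c)\<in>prescribed_idx (zs ! i) (w i). R $$ (I i u, offset ds i + c) = (if c = ep i * u then 1 else 0))"
    if i: "i < q" for i
  proof -
    have "cblock i R $$ (idx (Iss ! i) (length (w i)) ! u, c) = R $$ (I i u, offset ds i + c)"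
      if pr: "(u, c) \<in> prescribed_idx (zs ! i) (w i)" for u c
      using cblock_index[of "I i u" R c i] row_less[OF prescribed_row(2)[OF i pr]] prescribed_row(3)[OF i pr] R
      by (simp add: I_def)
    then show ?thesis
      unfolding reduced_shape_iff[OF dec[OF i] idx_length[OF i] cb[OF i]] by fastforce
  qed
  then show ?thesis using stacked_blocks[of R] R size unfolding reduced_def by auto
qed

lemma eq_build_L:
  assumes R: "R \<in> carrier_mat n n" "stacked A rs R" "reduced R"
    and free: "\<And>m i u b. m < length fs \<Longrightarrow> fs ! m = (i, u, b) \<Longrightarrow> R $$ (u, offset ds i + b) = x m"
  shows "R = build (L x)"
proof (rule eq_buildI[OF R(2)])
  fix u c assume uc: "u < r" "c < n"
  from uc(2) obtain i b where ib: "i < length ds" "b < ds ! i" "c = offset ds i + b" by (rule offset_cases)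
  then have i: "i < q" by simp
  have k: "u * n + c = lin (i, u, b)" by (simp add: lin_def ib)
  show "R $$ (u, c) = L x (u * n + c)"
  proof (cases "(u, b) \<in> prescribed_pos (zs ! i) (w i) (Iss ! i)")
    case True
    then obtain u' where u': "u = I i u'" "(u', b) \<in> prescribed_idx (zs ! i) (w i)"
      using prescribed_pos_iff[OF i] by blast
    have "R $$ (u, c) = (if b = ep i * u' then 1 else 0)"
      using R(3) i u' ib unfolding reduced_def by fastforce
    then show ?thesis unfolding k using L_prescribed[OF i u'(2)] u'(1) by simp
  next
    case False
    then have "(i, u, b) \<in> set fs" unfolding fs_set free_pos_def using i uc ib by simp
    then obtain m where m: "m < length fs" "fs ! m = (i, u, b)" by (auto simp: in_set_conv_nth)
    then show ?thesis unfolding k using free[OF m] L_free[OF m(1), of x] ib by simp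
  qed
qed

text \<open>Prescribed and free positions exhaust the first block, and the first block determines a
  stacked matrix; so the definite description has exactly one solution, and it is affine in
  \<open>x\<close>.\<close>

lemma nu_eq: "nu alphas zs rs Iss fs x = build (L x)"
proof -
  have iff: "(R \<in> carrier_mat (sum_list rs) (sum_list rs) \<and>
     (\<forall>i<q. reduced_shape (zs ! i) (w i) rs (Iss ! i) (cblock i R)) \<and>
     (\<forall>k<length fs. case fs ! k of (i, u, c) \<Rightarrow> cblock i R $$ (u, c) = x k)) \<longleftrightarrow>
     (R \<in> carrier_mat n n \<and> (stacked A rs R \<and> reduced R) \<and>
     (\<forall>m i u b. m < length fs \<longrightarrow> fs ! m = (i, u, b) \<longrightarrow> R $$ (u, offset ds i + b) = x m))" for R
  proof (cases "R \<in> carrier_mat n n")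
    case True
    have "(case fs ! k of (i, u, c) \<Rightarrow> cblock i R $$ (u, c) = x k) \<longleftrightarrow>
       (\<forall>i u b. fs ! k = (i, u, b) \<longrightarrow> R $$ (u, offset ds i + b) = x k)" if k: "k < length fs" for k
    proof -
      obtain i u b where 1: "fs ! k = (i, u, b)" "i < q" "u < r" "b < ds ! i" using fsD[OF k] by blast
      then show ?thesis using cblock_index[of u R b i] row_less[OF 1(3)] True by simp
    qed
    then show ?thesis using reduced_shape_eq[OF True] True size by auto
  qed (simp add: size)
  show ?thesis
    unfolding nu_def col_block_eq iff
  proof (rule the_equality)
    show "build (L x) \<in> carrier_mat n n \<and> (stacked A rs (build (L x)) \<and> reduced (build (L x))) \<and>
     (\<forall>m i u b. m < length fs \<longrightarrow> fs ! m = (i, u, b) \<longrightarrow> build (L x) $$ (u, offset ds i + b) = x m)"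
      using build_carrier build_stacked build_L_reduced build_L_free by blast
    fix R assume "R \<in> carrier_mat n n \<and> (stacked A rs R \<and> reduced R) \<and>
     (\<forall>m i u b. m < length fs \<longrightarrow> fs ! m = (i, u, b) \<longrightarrow> R $$ (u, offset ds i + b) = x m)"
    then show "R = build (L x)" using eq_build_L by blast
  qed
qed

text \<open>The prescribed positions lie inside the first block, so the subtraction of natural
  numbers is a genuine count of the complement.\<close>

lemma card_free: "length fs = r * n - (\<Sum>i<q. ep i * (\<Sum>l<length (w i). (w i ! l)\<^sup>2))"
proof -
  define T where "T = (SIGMA i:{..<q}. {..<r} \<times> {..<ds ! i})"
  define S where "S = (SIGMA i:{..<q}. prescribed_pos (zs ! i) (w i) (Iss ! i))"
  have sub: "prescribed_pos (zs ! i) (w i) (Iss ! i) \<subseteq> {..<r} \<times> {..<ds ! i}" if i: "i < q" for i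
  proof
    fix p assume "p \<in> prescribed_pos (zs ! i) (w i) (Iss ! i)"
    then obtain u b where p: "p = (I i u, b)" "(u, b) \<in> prescribed_idx (zs ! i) (w i)"
      using prescribed_pos_iff[OF i] by (metis surj_pair)
    then show "p \<in> {..<r} \<times> {..<ds ! i}" using prescribed_row[OF i p(2)] by simp
  qed
  have ST: "S \<subseteq> T" unfolding S_def T_def by (rule Sigma_mono) (use sub in simp_all)
  have fin: "finite (prescribed_pos (zs ! i) (w i) (Iss ! i))" if "i < q" for i
    by (rule finite_subset[OF sub[OF that]]) simp
  have "card (prescribed_pos (zs ! i) (w i) (Iss ! i)) = card (prescribed_idx (zs ! i) (w i))" if i: "i < q" for i
    unfolding prescribed_pos_eq
  proof (rule card_image, rule inj_onI)
    fix p p' assume *: "p \<in> prescribed_idx (zs ! i) (w i)" "p' \<in> prescribed_idx (zs ! i) (w i)"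
      "(case p of (u, c) \<Rightarrow> (idx (Iss ! i) (length (w i)) ! u, c)) = (case p' of (u, c) \<Rightarrow> (idx (Iss ! i) (length (w i)) ! u, c))"
    obtain u c u' c' where p: "p = (u, c)" "p' = (u', c')" by (metis surj_pair)
    have "w i \<noteq> []" using *(1) unfolding prescribed_idx_def by auto
    then have "length (w i) \<in> {1..length (w i)}" by (simp add: Suc_le_eq)
    from idx_props(2)[OF i this] have "u = u'"
      using *(3) p prescribed_row(1)[OF i *(1)[unfolded p]] prescribed_row(1)[OF i *(2)[unfolded p]] idx_length[OF i]
      by (simp add: nth_eq_iff_index_eq)
    then show "p = p'" using *(3) p by simp
  qed
  then have cS: "card S = (\<Sum>i<q. ep i * (\<Sum>l<length (w i). (w i ! l)\<^sup>2))"
    unfolding S_def using fin by (subst card_SigmaI) (auto simp: card_prescribed_idx)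
  have "card T = (\<Sum>i<q. r * ds ! i)" unfolding T_def by (simp add: card_SigmaI card_cartesian_product)
  also have "\<dots> = r * n"
    by (simp add: sum_distrib_left[symmetric] sum_list_sum_nth atLeast0LessThan)
  finally have cT: "card T = r * n" .
  have "free_pos r alphas zs Iss = T - S" unfolding free_pos_def T_def S_def by auto
  then have "card (free_pos r alphas zs Iss) = r * n - card S"
    using card_Diff_subset[OF _ ST] ST cT by (simp add: T_def finite_subset)
  moreover have "length fs = card (set fs)" using fs_distinct by (simp add: distinct_card)
  ultimately show ?thesis using fs_set cS by simp
qed


section \<open>The parametrized slice and its orbits\<close>

definition orb :: "(nat \<Rightarrow> real) \<Rightarrow> real mat set" where
  "orb y = cent_orbit A (build y)"

definition T :: "(nat \<Rightarrow> real) set" where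
  "T = {y. (\<forall>k\<ge>r * n. y k = 0) \<and> Determinant.det (build y) \<noteq> 0}"

definition W :: "(nat \<Rightarrow> real) set" where
  "W = {x. (\<forall>k\<ge>length fs. x k = 0) \<and> L x \<in> T}"

lemma T_iff: "y \<in> T \<longleftrightarrow> (\<forall>k\<ge>r * n. y k = 0) \<and> build y \<in> P_set A rs"
  using build_stacked by (simp add: T_def P_set_iff)

lemma L_high: "k \<ge> r * n \<Longrightarrow> L x k = 0"
  by (simp add: L_def)

lemma coords_in_T: "P \<in> P_set A rs \<Longrightarrow> mat_coords r n P \<in> T"
  using build_coords[of P] by (simp add: T_iff P_set_iff mat_coords_def)

lemma W_iff: "x \<in> W \<longleftrightarrow> (\<forall>k\<ge>length fs. x k = 0) \<and> build (L x) \<in> P_set A rs"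
  by (simp add: W_def T_iff L_high)

lemma orb_inj: "inj_on (orb \<circ> L) W"
proof (rule inj_onI)
  fix x x' assume x: "x \<in> W" "x' \<in> W" and eq: "(orb \<circ> L) x = (orb \<circ> L) x'"
  have "build (L x) = build (L x')"
    by (rule reduced_unique) (use x eq build_L_reduced in \<open>auto simp: W_iff orb_def\<close>)
  then have "x m = x' m" if m: "m < length fs" for m
  proof -
    obtain i u b where "fs ! m = (i, u, b)" by (metis surj_pair)
    from build_L_free[OF m this, of x] build_L_free[OF m this, of x'] \<open>build (L x) = build (L x')\<close>
    show ?thesis by simp
  qed
  moreover have "x m = x' m" if "m \<ge> length fs" for m using x that by (simp add: W_iff)
  ultimately show "x = x'" by (metis ext not_le)
qed

lemma orb_image: "(orb \<circ> L) ` W = cent_orbit A ` V_set alphas zs rs Iss"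
proof (rule subset_antisym; rule subsetI)
  fix q assume "q \<in> (orb \<circ> L) ` W"
  then obtain x where "x \<in> W" "q = cent_orbit A (build (L x))" by (auto simp: orb_def)
  then show "q \<in> cent_orbit A ` V_set alphas zs rs Iss"
    using reduced_V_set[OF _ build_L_reduced] by (auto simp: W_iff)
next
  fix q assume "q \<in> cent_orbit A ` V_set alphas zs rs Iss"
  then obtain P where P: "P \<in> V_set alphas zs rs Iss" "q = cent_orbit A P" by blast
  then have PS: "P \<in> P_set A rs" by (simp add: V_set_iff)
  obtain X where X: "X \<in> centralizer_group A" "reduced (P * X)" using reduced_exists[OF P(1)] by blast
  define R where "R = P * X"
  have R: "R \<in> P_set A rs" unfolding R_def by (rule P_set_mult[OF PS X(1)])
  \<comment> \<open>The parameters are read off from the free entries of the reduced member of the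
    orbit.\<close>
  define x where "x = (\<lambda>m. if m < length fs then case fs ! m of (i, u, b) \<Rightarrow> R $$ (u, offset ds i + b) else 0)"
  have "R = build (L x)"
    by (rule eq_build_L[OF P_set_carrier[OF R]]) (use R X(2) in \<open>auto simp: P_set_iff R_def x_def\<close>)
  moreover have "x \<in> W" using R \<open>R = build (L x)\<close> by (simp add: W_iff) (simp add: x_def)
  moreover have "q = cent_orbit A R" unfolding R_def P(2) by (rule orbit_mult[OF PS X(1), symmetric])
  ultimately show "q \<in> (orb \<circ> L) ` W" unfolding orb_def by force
qed

text \<open>The direction is RX for a commuting X chosen so that RX has the demanded values at the
  prescribed positions. The line R + tRX = R(1 + tX) stays in the orbit of R as long as it consists
  of nonsingular matrices.\<close>

lemma orb_fill:
  assumes x: "x \<in> W"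
  shows "\<exists>\<zeta>. (\<forall>j<r * n. \<sigma> j = None \<longrightarrow> \<zeta> j = Z j) \<and> (\<forall>j\<ge>r * n. \<zeta> j = 0) \<and>
    (\<forall>t. (\<lambda>j. L x j + t * \<zeta> j) \<in> T \<longrightarrow> orb (\<lambda>j. L x j + t * \<zeta> j) = orb (L x))"
proof -
  define R where "R = build (L x)"
  have R: "R \<in> P_set A rs" using x by (simp add: R_def W_iff)
  note Rc = P_set_carrier[OF R]
  have inj: "row_inj (\<lambda>u c. R $$ (u, c)) I"
    using corners_row_inj[OF Rc reduced_corners[OF Rc]] build_L_reduced by (simp add: R_def)
  define G where "G = mat n n (\<lambda>(a, c). Z (a * n + c))"
  obtain X where X: "X \<in> carrier_mat n n" "X * A = A * X"
    "\<And>i u c. i < q \<Longrightarrow> (u, c) \<in> prescribed_idx (zs ! i) (w i) \<Longrightarrow> (R * X) $$ (I i u, offset ds i + c) = G $$ (I i u, offset ds i + c)"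
    using commutant_prescribed_ex[OF Rc inj, of G] by blast
  have st: "stacked A rs R" "stacked A rs (R * X)"
    using R stacked_mult[OF A_carrier _ X(1,2)] by (auto simp: P_set_iff)
  define \<zeta> where "\<zeta> = mat_coords r n (R * X)"
  have "\<zeta> j = Z j" if j: "j < r * n" "\<sigma> j = None" for j
  proof -
    from j(1) obtain i u b where k: "i < q" "u < r" "b < ds ! i" "j = lin (i, u, b)" by (rule lin_cases)
    then obtain u' where u': "u = I i u'" "(u', b) \<in> prescribed_idx (zs ! i) (w i)"
      using j(2) sigma_None_lin[OF k(1-3)] prescribed_pos_iff[OF k(1)] by blast
    have "\<zeta> j = (R * X) $$ (u, offset ds i + b)"
      using j(1) lin_div_mod(1,2)[OF k(1,3), of u] k(4) by (simp add: \<zeta>_def mat_coords_def)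
    also have "\<dots> = G $$ (u, offset ds i + b)" using X(3)[OF k(1) u'(2)] u'(1) by simp
    also have "\<dots> = Z j" using row_less[OF k(2)] lin_div_mod(3)[OF k(1,3)] k(4) by (simp add: G_def lin_def)
    finally show ?thesis .
  qed
  moreover have "\<zeta> j = 0" if "j \<ge> r * n" for j using that by (simp add: \<zeta>_def mat_coords_def)
  moreover have "orb (\<lambda>j. L x j + t * \<zeta> j) = orb (L x)" if T: "(\<lambda>j. L x j + t * \<zeta> j) \<in> T" for t
  proof -
    \<comment> \<open>X itself may be singular; invertibility of 1 + tX follows from the nonzero
      determinant of R(1 + tX), which membership in \<open>T\<close> provides.\<close>
    define E where "E = 1\<^sub>m n + t \<cdot>\<^sub>m X"
    have E: "E \<in> carrier_mat n n" using X(1) by (simp add: E_def)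
    have XA: "(t \<cdot>\<^sub>m X) \<in> carrier_mat n n" using X(1) by simp
    have "E * A = A + t \<cdot>\<^sub>m (X * A)"
      unfolding E_def using add_mult_distrib_mat[OF one_carrier_mat XA A_carrier] mult_smult_assoc_mat[OF X(1) A_carrier] A_carrier
      by simp
    moreover have "A * E = A + t \<cdot>\<^sub>m (A * X)"
      unfolding E_def using mult_add_distrib_mat[OF A_carrier one_carrier_mat XA] mult_smult_distrib[OF A_carrier X(1)] A_carrier
      by simp
    ultimately have EA: "E * A = A * E" using X(2) by simp
    have RE: "R * E = R + t \<cdot>\<^sub>m (R * X)"
      unfolding E_def using mult_add_distrib_mat[OF Rc one_carrier_mat XA] mult_smult_distrib[OF Rc X(1)] Rc by simp
    have "R * E = build (\<lambda>j. L x j + t * \<zeta> j)"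
    proof (rule eq_buildI[OF stacked_mult[OF A_carrier st(1) E EA]])
      fix u c assume uc: "u < r" "c < n"
      have un: "u < n" using row_less[OF uc(1)] .
      have "u * n + c < Suc u * n" using uc by simp
      also have "\<dots> \<le> r * n" using uc by (intro mult_le_mono1) simp
      finally have "\<zeta> (u * n + c) = (R * X) $$ (u, c)"
        using div_mod_pair[OF uc(2)] by (simp add: \<zeta>_def mat_coords_def)
      moreover have "R $$ (u, c) = L x (u * n + c)" unfolding R_def by (rule build_index[OF uc])
      moreover have "(R * E) $$ (u, c) = R $$ (u, c) + t * (R * X) $$ (u, c)"
        unfolding RE using un uc(2) Rc X(1) by (simp del: index_mult_mat(1) add: index_mult_mat(2,3))
      ultimately show "(R * E) $$ (u, c) = L x (u * n + c) + t * \<zeta> (u * n + c)" by simp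
    qed
    moreover from this have "Determinant.det (R * E) \<noteq> 0" using T by (simp add: T_def)
    then have "Determinant.det E \<noteq> 0" using det_mult[OF Rc E] by auto
    then have "E \<in> centralizer_group A" using E EA invertible_mat_iff_det[OF E] by (simp add: centralizer_group_iff)
    then have "cent_orbit A (R * E) = cent_orbit A R" by (rule orbit_mult[OF R])
    ultimately show ?thesis by (simp add: orb_def R_def)
  qed
  ultimately show ?thesis by blast
qed

end

subsection \<open>Dimension count\<close>

lemma map_poly_mult_hom:
  fixes f :: "'a :: comm_semiring_0 \<Rightarrow> 'b :: comm_semiring_0"
  assumes "f 0 = 0" "\<And>x y. f (x + y) = f x + f y" "\<And>x y. f (x * y) = f x * f y"
  shows "map_poly f (p * q) = map_poly f p * map_poly f q"
proof (rule poly_eqI)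
  fix k
  have "f (\<Sum>i\<in>S. g i) = (\<Sum>i\<in>S. f (g i))" for g :: "nat \<Rightarrow> 'a" and S
    by (induction S rule: infinite_finite_induct) (simp_all add: assms)
  then show "poly.coeff (map_poly f (p * q)) k = poly.coeff (map_poly f p * map_poly f q) k"
    by (simp add: coeff_map_poly assms coeff_mult)
qed

lemmas map_poly_of_real_mult = map_poly_mult_hom[of complex_of_real, simplified]
lemmas map_poly_cnj_mult = map_poly_mult_hom[of cnj, simplified]

lemma map_poly_cnj_linear_power: "map_poly cnj ([:- z, 1:] ^ k) = [:- cnj z, 1:] ^ k"
proof (induction k)
  case (Suc k)
  have "map_poly cnj [:- z, 1:] = [:- cnj z, 1:]" by (simp add: map_poly_pCons)
  then show ?case unfolding power_Suc map_poly_cnj_mult Suc by simp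
qed simp

text \<open>Conjugating the coefficients fixes a real polynomial and turns a power of the linear
  factor at \<open>z\<close> into the same power at the conjugate.\<close>

lemma order_cnj_le:
  assumes "\<alpha> \<noteq> 0"
  shows "Polynomial.order z (map_poly complex_of_real \<alpha>) \<le> Polynomial.order (cnj z) (map_poly complex_of_real \<alpha>)"
proof -
  let ?p = "map_poly complex_of_real \<alpha>"
  have nz: "?p \<noteq> 0" using assms by (simp add: map_poly_eq_0_iff)
  have real: "map_poly cnj ?p = ?p" by (rule poly_eqI) (simp add: coeff_map_poly)
  obtain s where "?p = [:- z, 1:] ^ Polynomial.order z ?p * s" using order_1[of z ?p] by (auto elim: dvdE)
  then have "map_poly cnj ?p = [:- cnj z, 1:] ^ Polynomial.order z ?p * map_poly cnj s"
    by (metis map_poly_cnj_mult map_poly_cnj_linear_power)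
  then have "[:- cnj z, 1:] ^ Polynomial.order z ?p dvd ?p" unfolding real by (metis dvd_triv_left)
  then show ?thesis using order_divides[of "cnj z" "Polynomial.order z ?p" ?p] nz by simp
qed

lemma order_cnj:
  "\<alpha> \<noteq> 0 \<Longrightarrow> Polynomial.order (cnj z) (map_poly complex_of_real \<alpha>) = Polynomial.order z (map_poly complex_of_real \<alpha>)"
  using order_cnj_le[of \<alpha> z] order_cnj_le[of \<alpha> "cnj z"] by simp

text \<open>The polynomial splits over the complex numbers. The set \<open>Z\<close> may exceed the
  root set because the order is 0 away from the roots.\<close>

lemma degree_eq_sum_order:
  fixes p :: "complex poly"
  assumes "p \<noteq> 0" "finite Z" "{z. poly p z = 0} \<subseteq> Z"
  shows "degree p = (\<Sum>z\<in>Z. Polynomial.order z p)"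
proof -
  have "degree p = degree (Polynomial.smult (lead_coeff p) (\<Prod>z | poly p z = 0. [:- z, 1:] ^ Polynomial.order z p))"
    by (simp only: complex_poly_decompose)
  also have "\<dots> = degree (\<Prod>z | poly p z = 0. [:- z, 1:] ^ Polynomial.order z p)"
    using assms(1) by simp
  also have "\<dots> = (\<Sum>z | poly p z = 0. degree ([:- z, 1:] ^ Polynomial.order z p))"
    by (rule degree_prod_sum_eq) simp
  also have "\<dots> = (\<Sum>z | poly p z = 0. Polynomial.order z p)"
    by (simp add: degree_linear_power)
  also have "\<dots> = (\<Sum>z\<in>Z. Polynomial.order z p)"
    by (rule sum.mono_neutral_left) (use assms in \<open>auto simp: order_root\<close>)
  finally show ?thesis .
qed

section \<open>Weighted counting in conjugate partitions\<close>

lemma conjugate_partition_nth: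
  assumes "l < length (conjugate_partition a)"
  shows "conjugate_partition a ! l = card {j. j < length a \<and> l < a ! j}"
  using assms by (auto simp: conjugate_partition_def Suc_le_eq simp del: upt_Suc split: if_splits)

lemma conjugate_partition_sorted: "sorted_wrt (\<ge>) (conjugate_partition a)"
  unfolding sorted_wrt_iff_nth_less
proof (intro allI impI)
  fix i j assume "i < j" "j < length (conjugate_partition a)"
  then show "conjugate_partition a ! j \<le> conjugate_partition a ! i"
    by (simp add: conjugate_partition_nth) (rule card_mono, auto)
qed

lemma length_conjugate_partition: "length (conjugate_partition a) = (if a = [] then 0 else hd a)"
  by (simp add: conjugate_partition_def del: upt_Suc)

text \<open>Double counting of the cells of the Young diagram, a cell being weighted by
  \<open>f\<close> of the part it belongs to.\<close>

lemma sum_conjugate_partition: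
  fixes f :: "nat \<Rightarrow> nat"
  assumes a: "sorted_wrt (\<ge>) a"
  shows "(\<Sum>l<length (conjugate_partition a). \<Sum>j<conjugate_partition a ! l. f j) = (\<Sum>j<length a. f j * a ! j)"
proof -
  let ?w = "conjugate_partition a"
  have le: "a ! j' \<le> a ! j" if "j \<le> j'" "j' < length a" for j j'
    using sorted_wrt_nth_less[OF a, of j j'] that by (cases "j = j'") auto
  have seg: "{j. j < length a \<and> l < a ! j} = {..<?w ! l}" if l: "l < length ?w" for l
  proof -
    define S where "S = {j. j < length a \<and> l < a ! j}"
    have fin: "finite S" by (simp add: S_def)
    have down: "j \<in> S" if "j' \<in> S" "j \<le> j'" for j j'
      using that le[of j j'] by (auto simp: S_def)
    have "S = {..<card S}"
    proof (cases "S = {}")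
      case False
      then have "Max S \<in> S" using fin by simp
      then have "S = {..Max S}" using down Max_ge[OF fin] by blast
      then have "S = {..<Suc (Max S)}" by (simp add: lessThan_Suc_atMost)
      then show ?thesis by (metis card_lessThan)
    qed simp
    then show ?thesis using conjugate_partition_nth[OF l] by (simp add: S_def)
  qed
  have "(\<Sum>l<length ?w. \<Sum>j<?w ! l. f j) = (\<Sum>l<length ?w. \<Sum>j<length a. if l < a ! j then f j else 0)"
  proof (rule sum.cong[OF refl])
    fix l assume "l \<in> {..<length ?w}"
    then have "(\<Sum>j<?w ! l. f j) = (\<Sum>j | j < length a \<and> l < a ! j. f j)" using seg by simp
    also have "\<dots> = (\<Sum>j<length a. if l < a ! j then f j else 0)"
      by (rule sum.mono_neutral_cong_left) auto
    finally show "(\<Sum>j<?w ! l. f j) = (\<Sum>j<length a. if l < a ! j then f j else 0)" .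
  qed
  also have "\<dots> = (\<Sum>j<length a. \<Sum>l<length ?w. if l < a ! j then f j else 0)" by (rule sum.swap)
  also have "\<dots> = (\<Sum>j<length a. f j * a ! j)"
  proof (rule sum.cong[OF refl])
    fix j assume j: "j \<in> {..<length a}"
    then have "a \<noteq> []" by auto
    then have "a ! j \<le> length ?w" using le[of 0 j] j by (simp add: length_conjugate_partition hd_conv_nth)
    then have "(\<Sum>l<length ?w. if l < a ! j then f j else 0) = (\<Sum>l<a ! j. f j)"
      by (intro sum.mono_neutral_cong_right) auto
    then show "(\<Sum>l<length ?w. if l < a ! j then f j else 0) = f j * a ! j" by simp
  qed
  finally show ?thesis .
qed

lemma sum_list_conjugate_partition:
  assumes "sorted_wrt (\<ge>) a"
  shows "sum_list (conjugate_partition a) = (\<Sum>j<length a. a ! j)"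
  using sum_conjugate_partition[OF assms, of "\<lambda>_. 1"] by (simp add: sum_list_sum_nth atLeast0LessThan)

lemma sum_odd: "(\<Sum>j<k. 2 * j + 1) = (k :: nat)\<^sup>2"
  by (induction k) (simp_all add: power2_eq_square)

text \<open>A square is a sum of consecutive odd numbers. This is where the factors
  \<open>2 * l - 1\<close> in the formula for the centralizer dimension come from.\<close>

lemma sum_squares_conjugate_partition:
  assumes "sorted_wrt (\<ge>) a"
  shows "(\<Sum>l<length (conjugate_partition a). (conjugate_partition a ! l)\<^sup>2) = (\<Sum>j<length a. (2 * j + 1) * a ! j)"
  using sum_conjugate_partition[OF assms, of "\<lambda>j. 2 * j + 1"] by (simp only: sum_odd)

context
  fixes alphas :: "real poly list" and rts :: "real list" and cts zs :: "complex list"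
  assumes monic: "\<forall>\<alpha>\<in>set alphas. lead_coeff \<alpha> = 1"
    and div_chain: "\<forall>i. Suc i < length alphas \<longrightarrow> alphas ! i dvd alphas ! Suc i"
    and ne: "alphas \<noteq> []"
    and roots: "enumerates_roots (last alphas) rts cts"
    and zs: "zs = map complex_of_real rts @ cts"
begin

definition mult_at :: "complex \<Rightarrow> real poly \<Rightarrow> nat" where
  "mult_at z \<alpha> = Polynomial.order z (map_poly complex_of_real \<alpha>)"

lemma alpha_nonzero: "\<alpha> \<in> set alphas \<Longrightarrow> \<alpha> \<noteq> 0"
  using monic by fastforce

lemma alphas_dvd: "i \<le> j \<Longrightarrow> j < length alphas \<Longrightarrow> alphas ! i dvd alphas ! j"
proof (induction j rule: dec_induct)
  case (step j)
  then have "alphas ! i dvd alphas ! j" by simp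
  also have "alphas ! j dvd alphas ! Suc j" using div_chain step.prems by simp
  finally show ?case .
qed simp

lemma mult_at_mono: "\<alpha> dvd \<beta> \<Longrightarrow> \<beta> \<noteq> 0 \<Longrightarrow> mult_at z \<alpha> \<le> mult_at z \<beta>"
  unfolding mult_at_def
  by (rule dvd_imp_order_le) (auto simp: map_poly_eq_0_iff map_poly_of_real_mult elim!: dvdE)

lemma mults_sorted: "sorted_wrt (\<ge>) (map (mult_at z) (rev alphas))"
  unfolding sorted_wrt_iff_nth_less
proof (intro allI impI)
  fix i j assume "i < j" "j < length (map (mult_at z) (rev alphas))"
  then show "map (mult_at z) (rev alphas) ! j \<le> map (mult_at z) (rev alphas) ! i"
    by (auto simp: rev_nth intro!: mult_at_mono alphas_dvd alpha_nonzero)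
qed

lemma weyr_chars_eq: "weyr_chars alphas z = conjugate_partition (map (mult_at z) (rev alphas))"
  unfolding weyr_chars_def by (rule arg_cong[where f = conjugate_partition], rule map_cong) (simp_all add: mult_at_def)

lemma weyr_chars_sorted: "sorted_wrt (\<ge>) (weyr_chars alphas z)"
  unfolding weyr_chars_eq by (rule conjugate_partition_sorted)

lemma cts_not_real: "z \<in> set cts \<Longrightarrow> z \<notin> \<real>"
  using roots unfolding enumerates_roots_def by auto

lemma zs_separated:
  assumes "i < length zs" "j < length zs" "i \<noteq> j"
  shows "zs ! i \<noteq> zs ! j" "zs ! i \<noteq> cnj (zs ! j)"
proof -
  have d: "distinct rts" "distinct (cts @ map cnj cts)" using roots unfolding enumerates_roots_def by auto
  have "set (map complex_of_real rts) \<inter> set cts = {}" by (auto dest: cts_not_real)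
  then have dz: "distinct zs" using d by (auto simp: zs distinct_map inj_on_def)
  then show ne: "zs ! i \<noteq> zs ! j" using assms by (simp add: nth_eq_iff_index_eq)
  show "zs ! i \<noteq> cnj (zs ! j)"
  proof
    assume eq: "zs ! i = cnj (zs ! j)"
    show False
    proof (cases "zs ! j \<in> \<real>")
      case True
      then show False using eq ne by (simp add: Reals_cnj_iff)
    next
      case False
      then have "zs ! i \<notin> \<real>" using eq Reals_cnj_iff by (metis complex_cnj_cnj)
      then have "zs ! i \<in> set cts" "zs ! j \<in> set cts"
        using False nth_mem[OF assms(1)] nth_mem[OF assms(2)] by (auto simp: zs)
      then show False using d(2) eq by auto
    qed
  qed
qed

text \<open>By the divisibility chain all roots of \<open>\<alpha>\<close> are roots of the last
  polynomial and hence enumerated. Conjugate roots have equal multiplicity, so \<open>eps z\<close>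
  counts each chosen nonreal root twice.\<close>

lemma degree_eq_sum_mult:
  assumes \<alpha>: "\<alpha> \<in> set alphas"
  shows "degree \<alpha> = (\<Sum>z\<leftarrow>zs. eps z * mult_at z \<alpha>)"
proof -
  let ?p = "map_poly complex_of_real \<alpha>"
  let ?Z = "set (map complex_of_real rts) \<union> set (cts @ map cnj cts)"
  have nz: "?p \<noteq> 0" using alpha_nonzero[OF \<alpha>] by (simp add: map_poly_eq_0_iff)
  have d: "distinct rts" "distinct (cts @ map cnj cts)" using roots unfolding enumerates_roots_def by auto
  have last: "last alphas = alphas ! (length alphas - 1)" using ne by (rule last_conv_nth)
  have "\<alpha> dvd last alphas"
    unfolding last using \<alpha> ne by (auto simp: in_set_conv_nth intro!: alphas_dvd)
  then obtain \<beta> where \<beta>: "last alphas = \<alpha> * \<beta>" by (auto elim: dvdE)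
  have "{z. poly ?p z = 0} \<subseteq> ?Z"
  proof
    fix z assume "z \<in> {z. poly ?p z = 0}"
    then have z: "poly (map_poly complex_of_real (last alphas)) z = 0"
      by (simp add: \<beta> map_poly_of_real_mult)
    show "z \<in> ?Z"
    proof (cases "z \<in> \<real>")
      case True
      then obtain x where x: "z = complex_of_real x" by (auto elim: Reals_cases)
      have "poly (map_poly complex_of_real p) (complex_of_real x) = complex_of_real (poly p x)" for p
        by (induction p) (simp_all add: map_poly_pCons)
      then have "poly (last alphas) x = 0" using z x by simp
      then have "x \<in> set rts" using roots unfolding enumerates_roots_def by auto
      then show ?thesis using x by simp
    next
      case False
      then show ?thesis using z roots unfolding enumerates_roots_def by blast
    qed
  qed
  then have "degree ?p = (\<Sum>z\<in>?Z. Polynomial.order z ?p)" by (intro degree_eq_sum_order nz) auto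
  also have "\<dots> = (\<Sum>z\<in>set (map complex_of_real rts). Polynomial.order z ?p) + (\<Sum>z\<in>set (cts @ map cnj cts). Polynomial.order z ?p)"
  proof (rule sum.union_disjoint)
    have nr: "z \<notin> \<real>" if "z \<in> set (cts @ map cnj cts)" for z
      using that roots unfolding enumerates_roots_def by blast
    show "set (map complex_of_real rts) \<inter> set (cts @ map cnj cts) = {}"
    proof (rule equals0I)
      fix z assume z: "z \<in> set (map complex_of_real rts) \<inter> set (cts @ map cnj cts)"
      then have "z \<in> complex_of_real ` set rts" by simp
      then have "z \<in> \<real>" by (elim imageE) simp
      then show False using nr z by blast
    qed
  qed auto
  also have "(\<Sum>z\<in>set (map complex_of_real rts). Polynomial.order z ?p) = (\<Sum>z\<leftarrow>map complex_of_real rts. eps z * mult_at z \<alpha>)"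
    using d(1) by (subst sum.distinct_set_conv_list) (auto simp: distinct_map inj_on_def mult_at_def eps_def o_def)
  also have "(\<Sum>z\<in>set (cts @ map cnj cts). Polynomial.order z ?p) = (\<Sum>z\<leftarrow>cts @ map cnj cts. Polynomial.order z ?p)"
    by (rule sum.distinct_set_conv_list[OF d(2)])
  also have "\<dots> = (\<Sum>z\<leftarrow>cts. mult_at z \<alpha>) + (\<Sum>z\<leftarrow>cts. mult_at z \<alpha>)"
    by (simp add: o_def order_cnj[OF alpha_nonzero[OF \<alpha>]] mult_at_def)
  also have "\<dots> = (\<Sum>z\<leftarrow>cts. 2 * mult_at z \<alpha>)"
    by (simp add: sum_list_addf[symmetric] mult_2)
  also have "\<dots> = (\<Sum>z\<leftarrow>cts. eps z * mult_at z \<alpha>)"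
    by (intro arg_cong[where f = sum_list] map_cong refl) (simp add: eps_def cts_not_real)
  finally show ?thesis by (simp add: zs degree_map_poly)
qed

text \<open>The weight \<open>g\<close> is left open: \<open>g = 1\<close> gives the total size of
  the Weyr form, and \<open>g j = 2 * j + 1\<close> gives the dimension of the centralizer.\<close>

lemma sum_alphas_swap:
  "(\<Sum>j<length alphas. g j * degree (rev alphas ! j)) =
   (\<Sum>z\<leftarrow>zs. eps z * (\<Sum>j<length alphas. g j * mult_at z (rev alphas ! j)))" for g :: "nat \<Rightarrow> nat"
proof -
  have "(\<Sum>j<length alphas. g j * degree (rev alphas ! j)) =
    (\<Sum>j<length alphas. \<Sum>z\<leftarrow>zs. g j * (eps z * mult_at z (rev alphas ! j)))"
  proof (rule sum.cong[OF refl])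
    fix j assume "j \<in> {..<length alphas}"
    then have "rev alphas ! j \<in> set alphas" using nth_mem[of j "rev alphas"] by simp
    then show "g j * degree (rev alphas ! j) = (\<Sum>z\<leftarrow>zs. g j * (eps z * mult_at z (rev alphas ! j)))"
      by (simp add: degree_eq_sum_mult sum_list_const_mult)
  qed
  also have "\<dots> = (\<Sum>z\<leftarrow>zs. \<Sum>j<length alphas. g j * (eps z * mult_at z (rev alphas ! j)))"
    by (induction zs) (simp_all add: sum.distrib)
  also have "\<dots> = (\<Sum>z\<leftarrow>zs. eps z * (\<Sum>j<length alphas. g j * mult_at z (rev alphas ! j)))"
    by (simp add: sum_distrib_left mult.left_commute)
  finally show ?thesis .
qed

lemma sum_weyr_sizes:
  "(\<Sum>z\<leftarrow>zs. eps z * sum_list (weyr_chars alphas z)) = (\<Sum>\<alpha>\<leftarrow>alphas. degree \<alpha>)"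
proof -
  have "sum_list (weyr_chars alphas z) = (\<Sum>j<length alphas. 1 * mult_at z (rev alphas ! j))" for z
    unfolding weyr_chars_eq sum_list_conjugate_partition[OF mults_sorted] by simp
  then have "(\<Sum>z\<leftarrow>zs. eps z * sum_list (weyr_chars alphas z)) = (\<Sum>j<length alphas. 1 * degree (rev alphas ! j))"
    by (simp only: sum_alphas_swap)
  also have "\<dots> = sum_list (map degree (rev alphas))"
    by (simp add: sum_list_sum_nth atLeast0LessThan)
  also have "\<dots> = sum_list (map degree alphas)" by (simp add: rev_map[symmetric])
  finally show ?thesis .
qed

lemma cent_dim_eq:
  "cent_dim alphas = (\<Sum>z\<leftarrow>zs. eps z * (\<Sum>l<length (weyr_chars alphas z). (weyr_chars alphas z ! l)\<^sup>2))"
proof -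
  have "(\<Sum>l<length (weyr_chars alphas z). (weyr_chars alphas z ! l)\<^sup>2) =
     (\<Sum>j<length alphas. (2 * j + 1) * mult_at z (rev alphas ! j))" for z
    unfolding weyr_chars_eq sum_squares_conjugate_partition[OF mults_sorted] by simp
  then have "(\<Sum>z\<leftarrow>zs. eps z * (\<Sum>l<length (weyr_chars alphas z). (weyr_chars alphas z ! l)\<^sup>2)) =
     (\<Sum>j<length alphas. (2 * j + 1) * degree (rev alphas ! j))"
    by (simp only: sum_alphas_swap)
  \<comment> \<open>The substitution is \<open>l = Suc j\<close>; reversing the list accounts for
    the index \<open>length alphas - l\<close>.\<close>
  also have "\<dots> = (\<Sum>l=1..length alphas. (2 * l - 1) * degree (alphas ! (length alphas - l)))"
    by (rule sum.reindex_bij_witness[of _ "\<lambda>l. l - 1" Suc]) (auto simp: rev_nth)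
  finally show ?thesis by (simp add: cent_dim_def)
qed

end

subsection \<open>The quotient manifold\<close>

locale weyr_quotient = weyr_slice +
  fixes Q :: "real mat set mfd"
  assumes Q: "quotient_structure A rs Q"
begin

lemma Q_manifold: "smooth_manifold Q"
  and Q_submersion: "smooth_submersion (P_mfd A rs) Q (cent_orbit A)"
  using Q by (auto simp: quotient_structure_def)

lemma A_dim: "dim_row A = n" using A_carrier by simp

lemma P_mfd_simps:
  "mdim (P_mfd A rs) = r * n"
  "charts (P_mfd A rs) = {(P_set A rs, mat_coords r n)}"
  "mtop (P_mfd A rs) = pullback_topology (P_set A rs) (mat_coords n n) (Euclidean_space (n * n))"
  by (simp_all add: P_mfd_def A_dim size)

text \<open>Every entry is a linear form in \<open>y\<close> whose coefficients are entries of a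
  power of \<open>A\<close>.\<close>

lemma build_entry_smooth:
  assumes S: "openin (Euclidean_space (r * n)) S" and ab: "a < n" "b < n"
  shows "C_k_on k (r * n) S (\<lambda>y. build y $$ (a, b))"
proof -
  have "a < sum_list rs" using ab size by simp
  then obtain l u where lu: "l < length rs" "u < rs ! l" "a = offset rs l + u" by (rule offset_cases)
  show ?thesis unfolding lu(3) build_entry[OF lu(1,2) ab(2)]
    by (intro C_k_on_sum[OF S] C_k_on_mult[OF S] C_k_on_const[OF S] C_k_on_coord[OF S])
qed

lemma Euc_open: "openin (Euclidean_space d) (Euc d)" by (rule openin_topspace)

lemma T_Euc: "T \<subseteq> Euc (r * n)" by (auto simp: T_def Euc_iff)

lemma T_open: "openin (Euclidean_space (r * n)) T"
proof -
  define f where "f = (\<lambda>y. Determinant.det (build y))"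
  have f_eq: "f = (\<lambda>y. fdet n (\<lambda>a b. build y $$ (a, b)))"
  proof
    fix y
    have "mat n n (\<lambda>(a, b). build y $$ (a, b)) = build y"
      using build_carrier[of y] by (intro eq_matI) auto
    then show "f y = fdet n (\<lambda>a b. build y $$ (a, b))" by (simp add: f_def fdet_def)
  qed
  have "C_k_on 0 (r * n) (Euc (r * n)) f"
    unfolding f_eq by (intro C_k_on_fdet[OF Euc_open] build_entry_smooth[OF Euc_open])
  then have "continuous_map (Euclidean_space (r * n)) euclideanreal f"
    by (simp add: subtopology_topspace)
  from openin_continuous_map_preimage[OF this, of "- {0}"]
  have "openin (Euclidean_space (r * n)) {y \<in> Euc (r * n). f y \<in> - {0}}"
    by (simp add: open_Compl)
  also have "{y \<in> Euc (r * n). f y \<in> - {0}} = T" by (auto simp: T_def Euc_iff f_def)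
  finally show ?thesis .
qed

lemma coords_image: "mat_coords r n ` (P_set A rs \<inter> cent_orbit A -` V) = T \<inter> orb -` V"
proof (rule subset_antisym; rule subsetI)
  fix y assume "y \<in> mat_coords r n ` (P_set A rs \<inter> cent_orbit A -` V)"
  then obtain P where P: "P \<in> P_set A rs" "cent_orbit A P \<in> V" "y = mat_coords r n P" by auto
  have "build y = P" unfolding P(3) by (rule build_coords) (use P in \<open>simp add: P_set_iff\<close>)
  then show "y \<in> T \<inter> orb -` V" using coords_in_T[OF P(1)] P by (simp add: orb_def)
next
  fix y assume y: "y \<in> T \<inter> orb -` V"
  then have "build y \<in> P_set A rs" "mat_coords r n (build y) = y" using coords_build by (auto simp: T_iff)
  then show "y \<in> mat_coords r n ` (P_set A rs \<inter> cent_orbit A -` V)"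
    using y by (intro image_eqI[of _ _ "build y"]) (auto simp: orb_def)
qed

lemma coords_inj: "inj_on (mat_coords r n) (P_set A rs)"
  by (rule inj_on_inverseI[of _ build]) (simp add: build_coords P_set_iff)

lemma inv_coords: "y \<in> T \<Longrightarrow> inv_into (P_set A rs) (mat_coords r n) y = build y"
proof -
  assume y: "y \<in> T"
  have "inv_into (P_set A rs) (mat_coords r n) (mat_coords r n (build y)) = build y"
    by (rule inv_into_f_f[OF coords_inj]) (use y in \<open>simp add: T_iff\<close>)
  moreover have "mat_coords r n (build y) = y" using y coords_build by (simp add: T_iff)
  ultimately show ?thesis by simp
qed

text \<open>The topology on \<open>P_set\<close> is induced by all entries, whereas the chart
  records only the first block. Continuity in the remaining rows therefore has to be
  supplied.\<close>

lemma build_continuous: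
  "continuous_map (subtopology (Euclidean_space (r * n)) T) (mtop (P_mfd A rs)) build"
  unfolding P_mfd_simps
proof (rule continuous_map_pullback')
  have tT: "topspace (subtopology (Euclidean_space (r * n)) T) = T" using T_Euc by auto
  have "mat_coords n n (build y) k = (if k < n * n then build y $$ (k div n, k mod n) else 0)" for y k
    by (simp add: mat_coords_def)
  then have eq: "mat_coords n n \<circ> build = (\<lambda>y k. if k < n * n then build y $$ (k div n, k mod n) else 0)"
    by (simp add: fun_eq_iff)
  show "continuous_map (subtopology (Euclidean_space (r * n)) T) (Euclidean_space (n * n)) (mat_coords n n \<circ> build)"
    unfolding eq continuous_map_componentwise_Euclidean_space
  proof (intro allI impI)
    fix k assume "k < n * n"
    then have "k div n < n" "k mod n < n" by (rule div_mod_less)+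
    from build_entry_smooth[OF T_open this, of 0]
    show "continuous_map (subtopology (Euclidean_space (r * n)) T) euclideanreal (\<lambda>y. build y $$ (k div n, k mod n))"
      by simp
  qed
  show "topspace (subtopology (Euclidean_space (r * n)) T) \<subseteq> build -` P_set A rs"
    unfolding tT by (auto simp: T_iff)
qed

lemma orb_continuous: "continuous_map (subtopology (Euclidean_space (r * n)) T) (mtop Q) orb"
proof -
  have "continuous_map (mtop (P_mfd A rs)) (mtop Q) (cent_orbit A)"
    using Q_submersion by (simp add: smooth_submersion_def smooth_map_def)
  from continuous_map_compose[OF build_continuous this] show ?thesis
    by (simp add: o_def orb_def[abs_def])
qed

lemma orb_vimage_open: "openin (mtop Q) V \<Longrightarrow> openin (Euclidean_space (r * n)) (T \<inter> orb -` V)"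
proof -
  assume "openin (mtop Q) V"
  from openin_continuous_map_preimage[OF orb_continuous this]
  have "openin (subtopology (Euclidean_space (r * n)) T) (T \<inter> orb -` V)"
    by (rule back_subst[of "openin _"]) (use T_Euc in auto)
  then show ?thesis using T_open openin_trans_full by blast
qed

lemma orb_smooth:
  assumes ch: "(V, \<phi>) \<in> charts Q" and i: "i < mdim Q"
  shows "C_k_on k (r * n) (T \<inter> orb -` V) (\<lambda>y. \<phi> (orb y) i)"
proof -
  have op: "openin (Euclidean_space (r * n)) (T \<inter> orb -` V)"
    using orb_vimage_open Q_manifold ch unfolding smooth_manifold_def by blast
  have "smooth_map (P_mfd A rs) Q (cent_orbit A)" using Q_submersion by (simp add: smooth_submersion_def)
  then have "smooth_on (r * n) (mdim Q) (mat_coords r n ` (P_set A rs \<inter> cent_orbit A -` V))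
     (\<phi> \<circ> cent_orbit A \<circ> inv_into (P_set A rs) (mat_coords r n))"
    unfolding smooth_map_def P_mfd_simps using ch by blast
  then have "C_k_on k (r * n) (T \<inter> orb -` V) (\<lambda>y. (\<phi> \<circ> cent_orbit A \<circ> inv_into (P_set A rs) (mat_coords r n)) y i)"
    unfolding smooth_on_def coords_image using i by blast
  also have "?this \<longleftrightarrow> ?thesis"
    by (rule C_k_on_cong[OF op]) (simp add: inv_coords orb_def)
  finally show ?thesis .
qed

text \<open>The submersion hypothesis concerns the Jacobian matrix of the orbit map through
  \<open>inv_into\<close>. Near a point of \<open>T\<close> this agrees with \<open>orb\<close>, and
  full row rank means a trivial left kernel.\<close>

lemma orb_left_kernel:
  assumes ch: "(V, \<phi>) \<in> charts Q" and x: "x \<in> T" "orb x \<in> V"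
    and y: "\<And>j. j < r * n \<Longrightarrow> (\<Sum>i<mdim Q. y i * partial (\<lambda>x. \<phi> (orb x) i) j x) = 0"
  shows "\<forall>i<mdim Q. y i = 0"
proof (intro allI impI)
  fix i assume i: "i < mdim Q"
  define F where "F = \<phi> \<circ> cent_orbit A \<circ> inv_into (P_set A rs) (mat_coords r n)"
  define J where "J = jacobian (r * n) (mdim Q) F x"
  have xT: "x \<in> T \<inter> orb -` V" using x by simp
  have op: "openin (Euclidean_space (r * n)) (T \<inter> orb -` V)"
    using orb_vimage_open Q_manifold ch unfolding smooth_manifold_def by blast
  have J: "J \<in> carrier_mat (mdim Q) (r * n)" by (simp add: J_def jacobian_def)
  from xT obtain P where P: "P \<in> P_set A rs \<inter> cent_orbit A -` V" "x = mat_coords r n P"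
    unfolding coords_image[symmetric] by (rule imageE)
  have "vec_space.rank (mdim Q) J = mdim Q"
    using Q_submersion ch P(1) unfolding smooth_submersion_def P_mfd_simps J_def F_def P(2) by blast
  then show "y i = 0"
  proof (rule full_row_rank_left_kernel[OF J _ _ i])
    fix j assume j: "j < r * n"
    \<comment> \<open>\<open>inv_into\<close> equals \<open>build\<close> only on \<open>T\<close>;
      openness makes the two functions agree along a whole piece of the coordinate line.\<close>
    have "J $$ (i, j) = partial (\<lambda>x. \<phi> (orb x) i) j x" if "i < mdim Q" for i
    proof -
      have "\<forall>\<^sub>F t in nhds (x j). F (x(j := t)) i = \<phi> (orb (x(j := t))) i"
        using line_in_open[OF op xT j]
        by eventually_elim (simp add: F_def inv_coords orb_def del: fun_upd_apply)
      then show ?thesis using that j unfolding J_def jacobian_def partial_def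
        by (simp add: deriv_cong_ev del: fun_upd_apply)
    qed
    then show "(\<Sum>i<mdim Q. y i * J $$ (i, j)) = 0" using y[OF j] by simp
  qed
qed

sublocale slice: smooth_slice Q "length fs" "r * n" T orb L \<sigma> "\<lambda>k. target $$ (k div n, k mod n)" W
proof unfold_locales
  show "smooth_manifold Q" by (rule Q_manifold)
  show "openin (Euclidean_space (r * n)) T" by (rule T_open)
  show "continuous_map (subtopology (Euclidean_space (r * n)) T) (mtop Q) orb" by (rule orb_continuous)
  show "C_k_on k (r * n) (T \<inter> orb -` V) (\<lambda>x. \<phi> (orb x) i)"
    if "(V, \<phi>) \<in> charts Q" "i < mdim Q" for V \<phi> k i by (rule orb_smooth[OF that])
  show "\<forall>i<mdim Q. y i = 0" if "(V, \<phi>) \<in> charts Q" "x \<in> T" "orb x \<in> V"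
    "\<And>j. j < r * n \<Longrightarrow> (\<Sum>i<mdim Q. y i * partial (\<lambda>x. \<phi> (orb x) i) j x) = 0" for V \<phi> x y
    by (rule orb_left_kernel[OF that])
  show "L x j = (if j < r * n then case \<sigma> j of Some k \<Rightarrow> x k | None \<Rightarrow> target $$ (j div n, j mod n) else 0)" for x j
    by (simp add: L_def split: option.split)
  show "k < length fs" if "j < r * n" "\<sigma> j = Some k" for j k using that sigma_Some_iff by blast
  show "j = j'" if "j < r * n" "j' < r * n" "\<sigma> j = Some k" "\<sigma> j' = Some k" for j j' k
    using that by (simp add: sigma_Some_iff)
  show "\<exists>j<r * n. \<sigma> j = Some k" if k: "k < length fs" for k
  proof -
    obtain i u b where "fs ! k = (i, u, b)" "i < q" "u < r" "b < ds ! i" using fsD[OF k] by blast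
    then have "lin (fs ! k) < r * n" "\<sigma> (lin (fs ! k)) = Some k" using k lin_less by (auto simp: sigma_Some_iff)
    then show ?thesis by (intro exI[of _ "lin (fs ! k)"] conjI)
  qed
  show "W = {x \<in> Euc (length fs). L x \<in> T}" by (auto simp: W_def Euc_iff)
  show "inj_on (orb \<circ> L) W" by (rule orb_inj)
  show "\<exists>\<zeta>. (\<forall>j<r * n. \<sigma> j = None \<longrightarrow> \<zeta> j = Z j) \<and> (\<forall>j\<ge>r * n. \<zeta> j = 0) \<and>
       (\<forall>t. (\<lambda>j. L x j + t * \<zeta> j) \<in> T \<longrightarrow> orb (\<lambda>j. L x j + t * \<zeta> j) = orb (L x))" if "x \<in> W" for x Z
    by (rule orb_fill[OF that])
qed

lemma psi_eq: "psi alphas zs rs Iss fs = orb \<circ> L"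
  by (simp add: fun_eq_iff psi_def nu_eq orb_def weyr_form_eq)

end

theorem theorem5p20:
  fixes alphas :: "real poly list" and n r N :: nat and rs :: "nat list"
    and rts :: "real list" and cts zs :: "complex list" and A :: "real mat"
    and Iss :: "nat list list list" and fs :: "(nat \<times> nat \<times> nat) list"
    and Q :: "real mat set mfd"
    and W :: "(nat \<Rightarrow> real) set" and V :: "real mat set set"
  assumes n: "n = length alphas"
    and monic: "\<forall>\<alpha>\<in>set alphas. lead_coeff \<alpha> = 1"
    and div_chain: "\<forall>i. Suc i < n \<longrightarrow> alphas ! i dvd alphas ! Suc i"
    and deg_sum: "(\<Sum>\<alpha>\<leftarrow>alphas. degree \<alpha>) = n"
    and rs: "rs \<noteq> []" "sorted_wrt (\<ge>) rs" "\<forall>x\<in>set rs. x > 0" "sum_list rs = n"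
    and r: "r = hd rs"
    and major: "majorized (conjugate_partition rs) (map degree (rev alphas))"
    and roots: "enumerates_roots (last alphas) rts cts"
    and zs: "zs = map complex_of_real rts @ cts"
    and A: "A = weyr_form alphas zs"
    and N: "N = cent_dim alphas"
    and Iss: "Iss \<in> index_family r alphas zs"
    and fs: "distinct fs" "set fs = free_pos r alphas zs Iss"
    and Q: "quotient_structure A rs Q"
    and W: "W = W_set alphas zs rs Iss fs"
    and V: "V = cent_orbit A ` V_set alphas zs rs Iss"
  shows "openin (Euclidean_space (n * r - N)) W \<and>
    openin (mtop Q) V \<and>
    diffeomorphism (open_submanifold (Euclidean_mfd (n * r - N)) W) (open_submanifold Q V)
      (psi alphas zs rs Iss fs)"
proof -
  have "hd rs \<in> set rs" using rs(1) by simp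
  \<comment> \<open>A nonempty list of positive parts forces \<open>n > 0\<close>, so
    \<open>alphas\<close> is nonempty and \<open>last alphas\<close> is meaningful.\<close>
  then have "0 < n" using rs(3,4) member_le_sum_list by fastforce
  then have ne: "alphas \<noteq> []" using n by auto
  note rs4 = rs(4)
  note ctx = monic div_chain[unfolded n] ne roots zs
  interpret weyr_quotient alphas zs rs Iss fs Q
  proof unfold_locales
    show "sorted_wrt (\<ge>) (weyr_chars alphas z)" for z by (rule weyr_chars_sorted[OF ctx])
    show "zs ! i \<noteq> zs ! j" "zs ! i \<noteq> cnj (zs ! j)" if "i < length zs" "j < length zs" "i \<noteq> j" for i j
      using zs_separated[OF ctx that] by auto
    show "Iss ! i \<in> index_tuples (hd rs) (weyr_chars alphas (zs ! i))" if "i < length zs" for i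
      using Iss that by (simp add: index_family_def r)
    show "sum_list rs = sum_list (map (\<lambda>z. eps z * sum_list (weyr_chars alphas z)) zs)"
      using sum_weyr_sizes[OF ctx] deg_sum rs(4) by simp
    show "set fs = free_pos (hd rs) alphas zs Iss" using fs(2) r by simp
    show "quotient_structure (diag_block_mat (map (\<lambda>z. weyr_block z (weyr_chars alphas z)) zs)) rs Q"
      using Q by (simp add: A weyr_form_def)
  qed (use rs fs in auto)
  have "N = (\<Sum>i<length zs. eps (zs ! i) * (\<Sum>l<length (weyr_chars alphas (zs ! i)). (weyr_chars alphas (zs ! i) ! l)\<^sup>2))"
    unfolding N cent_dim_eq[OF ctx] by (simp add: sum_list_sum_nth atLeast0LessThan)
  then have d: "n * r - N = length fs"
    using card_free rs4 size by (simp add: r mult.commute)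
  have d': "length alphas * hd rs - cent_dim alphas = length fs" using d by (simp only: n r N)
  have W': "W = weyr_slice.W alphas zs rs Iss fs"
    unfolding W W_set_def weyr_form_eq nu_eq d' by (rule Set.set_eqI) (simp add: W_iff Euc_iff)
  have V': "V = psi alphas zs rs Iss fs ` weyr_slice.W alphas zs rs Iss fs"
    unfolding V psi_eq orb_image A weyr_form_eq ..
  show ?thesis
    unfolding d V' W' psi_eq
    by (intro conjI slice.W_open slice.image_open slice.slice_diffeomorphism)
qed

end
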